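(* Let $1\le p<\infty$, let $K$ be a compact Hausdorff space, let $X,Y$ be Banach spaces, let $T:C(K,X)\to Y$ be a strongly bounded operator, and let $\hat T:B(\Sigma,X)\to Y$ be its extension. Then $T$ is weak Dunford-Pettis (respectively weak$^*$ Dunford-Pettis, weak $p$-convergent, weak$^*$ $p$-convergent) if and only if $\hat T$ is weak Dunford-Pettis (respectively weak$^*$ Dunford-Pettis, weak $p$-convergent, weak$^*$ $p$-convergent).
   Context: Operator means bounded linear map. $C(K,X)$ is the space of continuous functions $K\to X$ with the sup norm; $\Sigma$ is the Borel $\sigma$-algebra of $K$. Its dual is $rcabv(\Sigma,X^* )$, the regular countably additive $X^*$-valued Borel measures of bounded variation. Every operator $T:C(K,X)\to Y$ has a representing measure $m:\Sigma\to L(X,Y^{**})$ (written $m\leftrightarrow T$), $m(A)x=T^{**}(\chi_A x)$, where $\chi_A x\in C(K,X)^{**}$ acts on $\mu\in rcabv(\Sigma,X^* )$ by $\langle \mu(A),x\rangle$; one has $T(f)=\int_K f\,dm$. For $y^*\in Y^*$ put $y^*m=T^*(y^* )\in rcabv(\Sigma,X^* )$, so $\langle y^*m(A),x\rangle=\langle m(A)x,y^*\rangle$. The semivariation is $\tilde m(E)=\sup\{|y^*m|(E): \|y^*\|\le 1\}$, with $|\cdot|$ denoting variation. $T$ (or $m$) is strongly bounded if $\tilde m(A_i)\to 0$ for every decreasing sequence $(A_i)$ in $\Sigma$ with empty intersection; in that case $m$ takes values in $L(X,Y)$. $B(\Sigma,X)$ is the space of bounded $\Sigma$-measurable functions $K\to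 X$ with separable range, with the sup norm (functions that are, for the purpose of integration, uniform limits of $X$-valued simple functions). The extension is $\hat T(f)=\int_K f\,dm$, $f\in B(\Sigma,X)$ (the restriction of $T^{**}$ to $B(\Sigma,X)\subset C(K,X)^{**}$); it takes values in $Y$ when $T$ is strongly bounded. A sequence $(x_n)$ in a Banach space $E$ is weakly $p$-summable if $(x^*(x_n))\in\ell_p$ for all $x^*\in E^*$. An operator $S:E\to F$ between Banach spaces is weak Dunford-Pettis (resp. weak$^*$ Dunford-Pettis) if $\langle S(x_n),y_n^*\rangle\to 0$ whenever $(x_n)$ is weakly null in $E$ and $(y_n^* )$ is weakly null (resp. $w^*$-null) in $F^*$; it is weak $p$-convergent (resp. weak$^*$ $p$-convergent) if $\langle S(x_n),y_n^*\rangle\to 0$ whenever $(x_n)$ is weakly $p$-summable in $E$ and $(y_n^* )$ is weakly null (resp. $w^*$-null) in $F^*$. *)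

theory Defs
  imports "HOL-Analysis.Analysis"
begin

section \<open>Duals and sequences\<close>

type_synonym 'a dual = "'a \<Rightarrow>\<^sub>L real"

definition weakly_null :: "(nat \<Rightarrow> 'a::real_normed_vector) \<Rightarrow> bool" where
  "weakly_null x \<longleftrightarrow> (\<forall>\<phi> :: 'a dual. (\<lambda>n. \<phi> (x n)) \<longlonglongrightarrow> 0)"

definition weak_star_null :: "(nat \<Rightarrow> 'a::real_normed_vector dual) \<Rightarrow> bool" where
  "weak_star_null \<phi> \<longleftrightarrow> (\<forall>a. (\<lambda>n. \<phi> n a) \<longlonglongrightarrow> 0)"

definition weakly_p_summable :: "real \<Rightarrow> (nat \<Rightarrow> 'a::real_normed_vector) \<Rightarrow> bool" where
  "weakly_p_summable p x \<longleftrightarrow> (\<forall>\<phi> :: 'a dual. summable (\<lambda>n. \<bar>\<phi> (x n)\<bar> powr p))"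

definition weak_DP :: "('a::real_normed_vector \<Rightarrow>\<^sub>L 'b::real_normed_vector) \<Rightarrow> bool" where
  "weak_DP S \<longleftrightarrow> (\<forall>(x :: nat \<Rightarrow> 'a) (\<phi> :: nat \<Rightarrow> 'b dual).
     weakly_null x \<longrightarrow> weakly_null \<phi> \<longrightarrow> (\<lambda>n. blinfun_apply (\<phi> n) (S (x n))) \<longlonglongrightarrow> 0)"

definition weak_star_DP :: "('a::real_normed_vector \<Rightarrow>\<^sub>L 'b::real_normed_vector) \<Rightarrow> bool" where
  "weak_star_DP S \<longleftrightarrow> (\<forall>(x :: nat \<Rightarrow> 'a) (\<phi> :: nat \<Rightarrow> 'b dual).
     weakly_null x \<longrightarrow> weak_star_null \<phi> \<longrightarrow> (\<lambda>n. blinfun_apply (\<phi> n) (S (x n))) \<longlonglongrightarrow> 0)"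

definition weak_p_convergent ::
    "real \<Rightarrow> ('a::real_normed_vector \<Rightarrow>\<^sub>L 'b::real_normed_vector) \<Rightarrow> bool" where
  "weak_p_convergent p S \<longleftrightarrow> (\<forall>(x :: nat \<Rightarrow> 'a) (\<phi> :: nat \<Rightarrow> 'b dual).
     weakly_p_summable p x \<longrightarrow> weakly_null \<phi> \<longrightarrow> (\<lambda>n. blinfun_apply (\<phi> n) (S (x n))) \<longlonglongrightarrow> 0)"

definition weak_star_p_convergent ::
    "real \<Rightarrow> ('a::real_normed_vector \<Rightarrow>\<^sub>L 'b::real_normed_vector) \<Rightarrow> bool" where
  "weak_star_p_convergent p S \<longleftrightarrow> (\<forall>(x :: nat \<Rightarrow> 'a) (\<phi> :: nat \<Rightarrow> 'b dual).
     weakly_p_summable p x \<longrightarrow> weak_star_null \<phi> \<longrightarrow> (\<lambda>n. blinfun_apply (\<phi> n) (S (x n))) \<longlonglongrightarrow> 0)"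


section \<open>Bounded Borel functions with separable range\<close>

lemma separable_top_of_set_iff:
  fixes S :: "'a::metric_space set"
  shows "separable_space (top_of_set S) \<longleftrightarrow> (\<exists>D. countable D \<and> S \<subseteq> closure D)"
proof
  assume "separable_space (top_of_set S)"
  then obtain C where C: "countable C" "C \<subseteq> S" "top_of_set S closure_of C = S"
    unfolding separable_space_def by auto
  then have "S = S \<inter> closure C"
    by (simp add: closure_of_subtopology inf.absorb2)
  with C show "\<exists>D. countable D \<and> S \<subseteq> closure D" by blast
next
  assume "\<exists>D. countable D \<and> S \<subseteq> closure D"
  then obtain D where D: "countable D" "S \<subseteq> closure D" by blast
  define pick where "pick = (\<lambda>(d, n::nat). SOME s. s \<in> S \<inter> ball d (inverse (Suc n)))"
  define I where "I = {(d, n). d \<in> D \<and> S \<inter> ball d (inverse (real (Suc n))) \<noteq> {}}"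
  define C where "C = pick ` I"
  have pick: "pick (d, n) \<in> S \<inter> ball d (inverse (real (Suc n)))" if "(d, n) \<in> I" for d n
  proof -
    have "\<exists>s. s \<in> S \<inter> ball d (inverse (real (Suc n)))"
      using that by (auto simp: I_def)
    from someI_ex[OF this] show ?thesis by (simp add: pick_def)
  qed
  have "countable I"
    by (rule countable_subset[of _ "D \<times> UNIV"]) (auto simp: I_def D)
  then have cC: "countable C" by (simp add: C_def)
  have CS: "C \<subseteq> S" using pick by (auto simp: C_def)
  have "S \<subseteq> closure C"
  proof
    fix s assume s: "s \<in> S"
    show "s \<in> closure C"
      unfolding closure_approachable
    proof (intro allI impI)
      fix e :: real assume "e > 0"
      then obtain n where n: "inverse (real (Suc n)) < e / 2"
        using reals_Archimedean[of "e/2"] by auto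
      have "s \<in> closure D" using s D by blast
      then obtain d where d: "d \<in> D" "dist d s < inverse (real (Suc n))"
        using closure_approachable[of s D]
        by (metis inverse_positive_iff_positive of_nat_0_less_iff zero_less_Suc)
      then have I: "(d, n) \<in> I" using s by (auto simp: I_def)
      have "dist d (pick (d, n)) < inverse (real (Suc n))" using pick[OF I] by auto
      then have "dist (pick (d, n)) s < e"
        using d(2) n dist_triangle3[of "pick (d, n)" s d] by linarith
      with I show "\<exists>y\<in>C. dist y s < e" by (auto simp: C_def)
    qed
  qed
  with cC CS show "separable_space (top_of_set S)"
    unfolding separable_space_def
    by (intro exI[of _ C]) (auto simp: closure_of_subtopology inf.absorb2)
qed

definition sep_meas :: "('k::topological_space \<Rightarrow> 'x::real_normed_vector) set" where
  "sep_meas = {f. f \<in> borel_measurable borel \<and> bounded (range f)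
                  \<and> separable_space (top_of_set (range f))}"

lemma sep_meas_const: "(\<lambda>_. c) \<in> sep_meas"
  by (auto simp: sep_meas_def separable_top_of_set_iff intro!: exI[of _ "{c}"])

lemma sep_meas_scaleR:
  assumes "f \<in> sep_meas" shows "(\<lambda>x. r *\<^sub>R f x) \<in> sep_meas"
proof -
  from assms obtain D where f: "f \<in> borel_measurable borel" "bounded (range f)"
      and D: "countable D" "range f \<subseteq> closure D"
    by (auto simp: sep_meas_def separable_top_of_set_iff)
  have "(\<lambda>y. r *\<^sub>R y) ` closure D \<subseteq> closure ((\<lambda>y. r *\<^sub>R y) ` D)"
    by (intro image_closure_subset continuous_intros closed_closure closure_subset)
  with D have "range (\<lambda>x. r *\<^sub>R f x) \<subseteq> closure ((\<lambda>y. r *\<^sub>R y) ` D)" by blast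
  moreover have "(\<lambda>x. r *\<^sub>R f x) \<in> borel_measurable borel"
    by (rule borel_measurable_continuous_on[OF _ f(1)]) (intro continuous_intros)
  moreover have "bounded (range (\<lambda>x. r *\<^sub>R f x))"
    using bounded_scaling[OF f(2), of r] by (simp add: image_image)
  ultimately show ?thesis
    using D(1) by (auto simp: sep_meas_def separable_top_of_set_iff intro!: exI[of _ "(\<lambda>y. r *\<^sub>R y) ` D"])
qed

lemma sep_meas_add:
  fixes f g :: "'k::topological_space \<Rightarrow> 'x::real_normed_vector"
  assumes "f \<in> sep_meas" "g \<in> sep_meas" shows "(\<lambda>x. f x + g x) \<in> sep_meas"
proof -
  from assms obtain D E where f: "f \<in> borel_measurable borel" "bounded (range f)"
      and g: "g \<in> borel_measurable borel" "bounded (range g)"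
      and D: "countable D" "range f \<subseteq> closure D"
      and E: "countable E" "range g \<subseteq> closure E"
    by (auto simp: sep_meas_def separable_top_of_set_iff)
  have near: "\<exists>d\<in>D. \<exists>e\<in>E. dist d (f x) < r \<and> dist e (g x) < r" if "r > 0" for x r
  proof -
    have "f x \<in> closure D" "g x \<in> closure E" using D E by auto
    with that show ?thesis unfolding closure_approachable by blast
  qed
  have meas: "(\<lambda>x. f x + g x) \<in> borel_measurable borel"
  proof (rule borel_measurableI)
    fix U :: "'x set" assume U: "open U"
    define I where "I = {(d, e, n::nat). d \<in> D \<and> e \<in> E \<and>
        (\<forall>u\<in>ball d (inverse (Suc n)). \<forall>v\<in>ball e (inverse (Suc n)). u + v \<in> U)}"
    have cI: "countable I"
      by (rule countable_subset[of _ "D \<times> E \<times> UNIV"]) (auto simp: I_def D E)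
    have "(\<lambda>x. f x + g x) -` U =
        (\<Union>(d, e, n)\<in>I. f -` ball d (inverse (Suc n)) \<inter> g -` ball e (inverse (Suc n)))"
      (is "?L = ?R")
    proof
      show "?R \<subseteq> ?L" by (auto simp: I_def)
      show "?L \<subseteq> ?R"
      proof
        fix x assume "x \<in> ?L"
        then obtain \<epsilon> where \<epsilon>: "\<epsilon> > 0" "ball (f x + g x) \<epsilon> \<subseteq> U"
          using U by (auto simp: open_contains_ball)
        then obtain n where n: "inverse (real (Suc n)) < \<epsilon> / 4"
          using reals_Archimedean[of "\<epsilon>/4"] by auto
        obtain d e where de: "d \<in> D" "e \<in> E" "dist d (f x) < inverse (real (Suc n))"
            "dist e (g x) < inverse (real (Suc n))"
          using near[of "inverse (real (Suc n))" x] by auto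
        have "u + v \<in> U" if "dist d u < inverse (real (Suc n))"
            "dist e v < inverse (real (Suc n))" for u v
        proof -
          have "dist (f x) u < \<epsilon> / 2" "dist (g x) v < \<epsilon> / 2"
            using that de n dist_triangle3[of "f x" u d] dist_triangle3[of "g x" v e]
            by linarith+
          then have "dist (f x + g x) (u + v) < \<epsilon>"
            using dist_triangle_add[of "f x" "g x" u v] by linarith
          with \<epsilon> show ?thesis by auto
        qed
        with de have "(d, e, n) \<in> I" by (auto simp: I_def)
        with de show "x \<in> ?R" by (auto intro!: bexI[of _ "(d, e, n)"])
      qed
    qed
    also have "\<dots> \<in> sets borel"
      using cI measurable_sets[OF f(1)] measurable_sets[OF g(1)]
      by (intro sets.countable_UN') (auto intro!: sets.Int)
    finally show "(\<lambda>x. f x + g x) -` U \<inter> space borel \<in> sets borel" by simp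
  qed
  have "range (\<lambda>x. f x + g x) \<subseteq> closure ((\<lambda>(d, e). d + e) ` (D \<times> E))"
  proof clarify
    fix x
    show "f x + g x \<in> closure ((\<lambda>(d, e). d + e) ` (D \<times> E))"
      unfolding closure_approachable
    proof (intro allI impI)
      fix r :: real assume "r > 0"
      then obtain d e where "d \<in> D" "e \<in> E" "dist d (f x) < r / 2" "dist e (g x) < r / 2"
        using near[of "r/2" x] by auto
      then show "\<exists>y\<in>(\<lambda>(d, e). d + e) ` (D \<times> E). dist y (f x + g x) < r"
        using dist_triangle_add[of d e "f x" "g x"]
        by (intro bexI[of _ "d + e"]) auto
    qed
  qed
  moreover have "countable ((\<lambda>(d, e). d + e) ` (D \<times> E))" using D E by auto
  moreover have "bounded (range (\<lambda>x. f x + g x))"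
    using f(2) g(2) by (rule bounded_plus_comp)
  ultimately show ?thesis using meas
    unfolding sep_meas_def separable_top_of_set_iff by blast
qed

text \<open>The type \<open>bsig\<close> is \<open>B(\<Sigma>,X)\<close>. The space \<open>C(K,X)\<close> is the library type of bounded
  continuous functions, boundedness being automatic on a compact \<open>K\<close>.\<close>

typedef (overloaded) ('k, 'x) bsig =
    "sep_meas :: ('k::topological_space \<Rightarrow> 'x::real_normed_vector) set"
  morphisms apply_bsig Bsig
  using sep_meas_const by blast

setup_lifting type_definition_bsig

declare [[coercion "apply_bsig :: ('k::topological_space, 'x::real_normed_vector) bsig \<Rightarrow> 'k \<Rightarrow> 'x"]]

instantiation bsig :: (topological_space, real_normed_vector) real_normed_vector
begin

lift_definition zero_bsig :: "('a, 'b) bsig" is "\<lambda>_. 0" by (rule sep_meas_const)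

lift_definition plus_bsig :: "('a, 'b) bsig \<Rightarrow> ('a, 'b) bsig \<Rightarrow> ('a, 'b) bsig"
  is "\<lambda>f g x. f x + g x" by (rule sep_meas_add)

lift_definition scaleR_bsig :: "real \<Rightarrow> ('a, 'b) bsig \<Rightarrow> ('a, 'b) bsig"
  is "\<lambda>r f x. r *\<^sub>R f x" by (rule sep_meas_scaleR)

lift_definition uminus_bsig :: "('a, 'b) bsig \<Rightarrow> ('a, 'b) bsig" is "\<lambda>f x. - f x"
  using sep_meas_scaleR[of _ "-1"] by simp

lift_definition minus_bsig :: "('a, 'b) bsig \<Rightarrow> ('a, 'b) bsig \<Rightarrow> ('a, 'b) bsig"
  is "\<lambda>f g x. f x - g x"
  using sep_meas_add[OF _ sep_meas_scaleR[of _ "-1"]] by fastforce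

definition norm_bsig :: "('a, 'b) bsig \<Rightarrow> real" where
  "norm_bsig f = (SUP x. norm (f x))"

definition dist_bsig :: "('a, 'b) bsig \<Rightarrow> ('a, 'b) bsig \<Rightarrow> real" where
  "dist_bsig f g = norm (f - g)"

definition sgn_bsig :: "('a, 'b) bsig \<Rightarrow> ('a, 'b) bsig" where
  "sgn_bsig f = scaleR (inverse (norm f)) f"

definition uniformity_bsig :: "(('a, 'b) bsig \<times> ('a, 'b) bsig) filter" where
  "uniformity_bsig = (INF e\<in>{0 <..}. principal {(x, y). dist x y < e})"

definition open_bsig :: "('a, 'b) bsig set \<Rightarrow> bool" where
  "open_bsig S = (\<forall>x\<in>S. \<forall>\<^sub>F (x', y) in uniformity. x' = x \<longrightarrow> y \<in> S)"

instance
proof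
  fix f g h :: "('a, 'b) bsig" and r s :: real
  have bdd: "bdd_above (range (\<lambda>x. norm (u x)))" for u :: "('a, 'b) bsig"
    using apply_bsig[of u] by (auto simp: sep_meas_def bounded_iff bdd_above_def)
  have le: "norm (u x) \<le> norm u" for u :: "('a, 'b) bsig" and x
    unfolding norm_bsig_def by (rule cSUP_upper[OF _ bdd]) simp
  show "f + g + h = f + (g + h)" by transfer (simp add: add.assoc)
  show "f + g = g + f" by transfer (simp add: add.commute)
  show "0 + f = f" by transfer simp
  show "- f + f = 0" by transfer simp
  show "f - g = f + - g" by transfer simp
  show "r *\<^sub>R (f + g) = r *\<^sub>R f + r *\<^sub>R g" by transfer (simp add: scaleR_add_right)
  show "(r + s) *\<^sub>R f = r *\<^sub>R f + s *\<^sub>R f" by transfer (simp add: scaleR_add_left)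
  show "r *\<^sub>R s *\<^sub>R f = (r * s) *\<^sub>R f" by transfer simp
  show "1 *\<^sub>R f = f" by transfer simp
  show "dist f g = norm (f - g)" by (rule dist_bsig_def)
  show "sgn f = scaleR (inverse (norm f)) f" by (rule sgn_bsig_def)
  show "uniformity = (INF e\<in>{0 <..}. principal {(x, y :: ('a, 'b) bsig). dist x y < e})"
    by (rule uniformity_bsig_def)
  show "open U = (\<forall>x\<in>U. \<forall>\<^sub>F (x', y) in uniformity. x' = x \<longrightarrow> y \<in> U)"
    for U :: "('a, 'b) bsig set" by (rule open_bsig_def)
  show "norm f = 0 \<longleftrightarrow> f = 0"
  proof
    assume "norm f = 0"
    then have "apply_bsig f = (\<lambda>_. 0)" using le[of f] by auto
    then show "f = 0" by transfer
  next
    assume "f = 0"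
    then show "norm f = 0" by (simp add: norm_bsig_def zero_bsig.rep_eq)
  qed
  show "norm (f + g) \<le> norm f + norm g"
    unfolding norm_bsig_def[of "f + g"]
    by (rule cSUP_least) (auto simp: plus_bsig.rep_eq intro: order_trans[OF norm_triangle_ineq] add_mono le)
  have sc: "norm (r *\<^sub>R u) \<le> \<bar>r\<bar> * norm u" for u :: "('a, 'b) bsig" and r
    unfolding norm_bsig_def[of "r *\<^sub>R u"]
    by (rule cSUP_least) (auto simp: scaleR_bsig.rep_eq intro: mult_left_mono le)
  show "norm (r *\<^sub>R f) = \<bar>r\<bar> * norm f"
  proof (cases "r = 0")
    case True
    then have "apply_bsig (r *\<^sub>R f) = (\<lambda>_. 0)" by (simp add: scaleR_bsig.rep_eq)
    then show ?thesis using True by (simp add: norm_bsig_def)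
  next
    case False
    have "inverse r *\<^sub>R r *\<^sub>R f = f" using False by transfer simp
    then have "norm f \<le> \<bar>inverse r\<bar> * norm (r *\<^sub>R f)" using sc[of "inverse r" "r *\<^sub>R f"] by simp
    then have "\<bar>r\<bar> * norm f \<le> norm (r *\<^sub>R f)" using False by (simp add: field_simps)
    with sc[of r f] show ?thesis by simp
  qed
qed

end

lemma norm_apply_bsig_le: "norm (apply_bsig f x) \<le> norm f"
proof -
  have "bdd_above (range (\<lambda>x. norm (f x)))"
    using apply_bsig[of f] by (auto simp: sep_meas_def bounded_iff bdd_above_def)
  then show ?thesis unfolding norm_bsig_def by (intro cSUP_upper) auto
qed

lemma norm_bsig_le: "(\<And>x. norm (apply_bsig f x) \<le> c) \<Longrightarrow> norm f \<le> c"
  unfolding norm_bsig_def by (rule cSUP_least) auto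

instance bsig :: (topological_space, banach) banach
proof
  fix F :: "nat \<Rightarrow> ('a, 'b) bsig"
  assume F: "Cauchy F"
  have unif: "\<exists>N. \<forall>m\<ge>N. \<forall>n\<ge>N. \<forall>x. norm (F m x - F n x) < e" if e: "e > 0" for e
  proof -
    obtain N where N: "\<forall>m\<ge>N. \<forall>n\<ge>N. norm (F m - F n) < e"
      using F e unfolding Cauchy_def dist_norm by blast
    have "norm (F m x - F n x) \<le> norm (F m - F n)" for m n x
      using norm_apply_bsig_le[of "F m - F n" x] by (simp add: minus_bsig.rep_eq)
    with N show ?thesis by (metis le_less_trans)
  qed
  define g where "g x = lim (\<lambda>n. F n x)" for x
  have lim: "(\<lambda>n. F n x) \<longlonglongrightarrow> g x" for x
  proof -
    have "Cauchy (\<lambda>n. F n x)" unfolding Cauchy_def dist_norm using unif by meson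
    then show ?thesis
      unfolding g_def using Cauchy_convergent_iff convergent_LIMSEQ_iff by blast
  qed
  have near: "\<exists>N. \<forall>n\<ge>N. \<forall>x. norm (F n x - g x) \<le> e" if e: "e > 0" for e
  proof -
    obtain N where N: "\<forall>m\<ge>N. \<forall>n\<ge>N. \<forall>x. norm (F m x - F n x) < e" using unif[OF e] by blast
    have "norm (F n x - g x) \<le> e" if "n \<ge> N" for n x
    proof (rule tendsto_upperbound)
      show "(\<lambda>m. norm (F n x - F m x)) \<longlonglongrightarrow> norm (F n x - g x)"
        by (intro tendsto_intros lim)
      show "\<forall>\<^sub>F m in sequentially. norm (F n x - F m x) \<le> e"
        using N that by (auto simp: eventually_sequentially intro!: exI[of _ N] less_imp_le)
    qed simp
    then show ?thesis by blast
  qed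
  have Fs: "apply_bsig (F n) \<in> sep_meas" for n by (rule apply_bsig)
  have "g \<in> borel_measurable borel"
    by (rule borel_measurable_LIMSEQ_metric[of "\<lambda>n. apply_bsig (F n)"])
      (use Fs lim in \<open>auto simp: sep_meas_def\<close>)
  moreover have "bounded (range g)"
  proof -
    obtain N where N: "\<forall>n\<ge>N. \<forall>x. norm (F n x - g x) \<le> 1" using near[of 1] by auto
    have "norm (g x) \<le> norm (F N) + 1" for x
      using N norm_apply_bsig_le[of "F N" x] norm_triangle_ineq2[of "g x" "F N x"]
      by (smt (verit) norm_minus_commute order_refl)
    then show ?thesis by (auto simp: bounded_iff)
  qed
  moreover have "\<exists>D. countable D \<and> range g \<subseteq> closure D"
  proof -
    have "\<forall>n. \<exists>D. countable D \<and> range (F n) \<subseteq> closure D"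
      using Fs by (simp add: sep_meas_def separable_top_of_set_iff)
    then obtain D where D: "\<And>n. countable (D n)" "\<And>n. range (F n) \<subseteq> closure (D n)"
      by metis
    have "g x \<in> closure (\<Union>n. D n)" for x
    proof (rule Lim_in_closed_set[OF closed_closure _ _ lim[of x]])
      have "F n x \<in> closure (\<Union>n. D n)" for n
        using D(2)[of n] closure_mono[of "D n" "\<Union>n. D n"] by blast
      then show "\<forall>\<^sub>F n in sequentially. F n x \<in> closure (\<Union>n. D n)" by simp
    qed simp
    with D(1) show ?thesis by (intro exI[of _ "\<Union>n. D n"]) auto
  qed
  ultimately have "g \<in> sep_meas" by (simp add: sep_meas_def separable_top_of_set_iff)
  then obtain G :: "('a, 'b) bsig" where G: "apply_bsig G = g"
    using Bsig_inverse by blast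
  have "F \<longlonglongrightarrow> G"
  proof (rule LIMSEQ_I)
    fix e :: real assume "e > 0"
    then obtain N where N: "\<forall>n\<ge>N. \<forall>x. norm (F n x - g x) \<le> e / 2" using near[of "e/2"] by auto
    have "norm (F n - G) \<le> e / 2" if "n \<ge> N" for n
      using N that by (intro norm_bsig_le) (simp add: minus_bsig.rep_eq G)
    with \<open>e > 0\<close> show "\<exists>N. \<forall>n\<ge>N. norm (F n - G) < e" by (force intro!: exI[of _ N])
  qed
  then show "convergent F" by (auto simp: convergent_def)
qed


section \<open>Vector measures and integration\<close>

definition variation ::
    "('k::topological_space set \<Rightarrow> 'z::real_normed_vector) \<Rightarrow> 'k set \<Rightarrow> ennreal" where
  "variation \<mu> A =
     (SUP P\<in>{P. finite P \<and> P \<subseteq> sets borel \<and> partition_on A P}. \<Sum>B\<in>P. ennreal (norm (\<mu> B)))"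

text \<open>Set functions are total in HOL, so elements of \<open>rcabv\<close> are normalised to vanish outside
  the Borel sets; this makes the measure representing a functional unique.\<close>

definition rcabv :: "('k::topological_space set \<Rightarrow> 'z::real_normed_vector) set" where
  "rcabv = {\<mu>.
     (\<forall>A. A \<notin> sets borel \<longrightarrow> \<mu> A = 0) \<and>
     (\<forall>A :: nat \<Rightarrow> 'k set. range A \<subseteq> sets borel \<longrightarrow> disjoint_family A \<longrightarrow>
        (\<lambda>i. \<mu> (A i)) sums \<mu> (\<Union>i. A i)) \<and>
     variation \<mu> UNIV < \<infinity> \<and>
     (\<forall>A\<in>sets borel. \<forall>e>0. \<exists>C U. compact C \<and> open U \<and> C \<subseteq> A \<and> A \<subseteq> U \<and> variation \<mu> (U - C) < e)}"

definition variation_measure :: "('k::topological_space set \<Rightarrow> 'z::real_normed_vector) \<Rightarrow> 'k measure"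
  where "variation_measure \<mu> = measure_of UNIV (sets borel) (variation \<mu>)"

definition simple_vm_integral ::
    "('k set \<Rightarrow> 'x::real_normed_vector dual) \<Rightarrow> ('k \<Rightarrow> 'x) \<Rightarrow> real" where
  "simple_vm_integral \<mu> s = (\<Sum>v\<in>range s. \<mu> (s -` {v}) v)"

text \<open>The integral of an \<open>'x\<close>-valued function against an \<open>'x dual\<close>-valued measure: limit of the
  integrals of simple functions converging to the integrand in \<open>L\<^sup>1\<close> of the variation. If the
  integrand is a uniform limit of simple functions, any such uniform approximation computes it.\<close>

definition has_vm_integral ::
    "('k::topological_space set \<Rightarrow> 'x::real_normed_vector dual) \<Rightarrow> ('k \<Rightarrow> 'x) \<Rightarrow> real \<Rightarrow> bool" where
  "has_vm_integral \<mu> f I \<longleftrightarrow> f \<in> borel_measurable borel \<and>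
     (\<exists>s. (\<forall>i::nat. simple_function borel (s i)) \<and>
          (\<lambda>i. \<integral>\<^sup>+t. ennreal (norm (f t - s i t)) \<partial>variation_measure \<mu>) \<longlonglongrightarrow> 0 \<and>
          (\<lambda>i. simple_vm_integral \<mu> (s i)) \<longlonglongrightarrow> I)"

definition vm_integral ::
    "('k::topological_space set \<Rightarrow> 'x::real_normed_vector dual) \<Rightarrow> ('k \<Rightarrow> 'x) \<Rightarrow> real" where
  "vm_integral \<mu> f = (THE I. has_vm_integral \<mu> f I)"

text \<open>The identification of \<open>C(K,X)\<^sup>*\<close> with \<open>rcabv\<close>: the functional \<open>\<Lambda>\<close> is integration
  against \<open>\<mu>\<close>.\<close>

definition functional_measure ::
    "('k::topological_space \<Rightarrow>\<^sub>C 'x::real_normed_vector) dual \<Rightarrow> ('k set \<Rightarrow> 'x dual) \<Rightarrow> bool" where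
  "functional_measure \<Lambda> \<mu> \<longleftrightarrow>
     \<mu> \<in> rcabv \<and> (\<forall>f :: 'k \<Rightarrow>\<^sub>C 'x. has_vm_integral \<mu> (apply_bcontfun f) (\<Lambda> f))"


section \<open>The representing measure and the extension of an operator on \<open>C(K,X)\<close>\<close>

definition scalar_part ::
    "('k set \<Rightarrow> 'x::real_normed_vector \<Rightarrow>\<^sub>L 'y::real_normed_vector dual dual) \<Rightarrow>
     'y dual \<Rightarrow> 'k set \<Rightarrow> 'x dual" where
  "scalar_part m \<phi> A = Blinfun (\<lambda>x. blinfun_apply (blinfun_apply (m A) x) \<phi>)"

lemma scalar_part_apply [simp]: "blinfun_apply (scalar_part m \<phi> A) x = m A x \<phi>"
proof -
  have "bounded_linear (\<lambda>x. blinfun_apply (blinfun_apply (m A) x) \<phi>)"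
    by (rule bounded_linear_compose[OF blinfun.bounded_linear_left blinfun.bounded_linear_right])
  then show ?thesis by (simp add: scalar_part_def bounded_linear_Blinfun_apply)
qed

text \<open>Here \<open>\<phi> o\<^sub>L T\<close> is \<open>T\<^sup>*(\<phi>)\<close>. That its measure \<open>\<mu>\<close> is \<open>scalar_part m \<phi>\<close> says
  \<open>m(A)x(\<phi>) = \<mu>(A)x = (\<chi>\<^sub>A x)(T\<^sup>*(\<phi>))\<close> for all \<open>A\<close> and \<open>x\<close>, that is, \<open>m(A)x = T\<^sup>*\<^sup>*(\<chi>\<^sub>A x)\<close>.\<close>

definition represents ::
    "('k::topological_space set \<Rightarrow> 'x::real_normed_vector \<Rightarrow>\<^sub>L 'y::real_normed_vector dual dual) \<Rightarrow>
     (('k \<Rightarrow>\<^sub>C 'x) \<Rightarrow>\<^sub>L 'y) \<Rightarrow> bool" where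
  "represents m T \<longleftrightarrow> (\<forall>\<phi> :: 'y dual. functional_measure (\<phi> o\<^sub>L T) (scalar_part m \<phi>))"

definition semivariation ::
    "('k::topological_space set \<Rightarrow> 'x::real_normed_vector \<Rightarrow>\<^sub>L 'y::real_normed_vector dual dual) \<Rightarrow>
     'k set \<Rightarrow> ennreal" where
  "semivariation m E = (SUP \<phi>\<in>{\<phi> :: 'y dual. norm \<phi> \<le> 1}. variation (scalar_part m \<phi>) E)"

text \<open>On a compact Hausdorff space every operator has exactly one representing measure, so
  the existential below merely selects it.\<close>

definition strongly_bounded ::
    "(('k::topological_space \<Rightarrow>\<^sub>C 'x::real_normed_vector) \<Rightarrow>\<^sub>L 'y::real_normed_vector) \<Rightarrow> bool" where
  "strongly_bounded T \<longleftrightarrow> (\<exists>m. represents m T \<and>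
     (\<forall>A :: nat \<Rightarrow> 'k set. range A \<subseteq> sets borel \<longrightarrow> decseq A \<longrightarrow> (\<Inter>i. A i) = {} \<longrightarrow>
        (\<lambda>i. semivariation m (A i)) \<longlonglongrightarrow> 0))"

definition rep_measure ::
    "(('k::topological_space \<Rightarrow>\<^sub>C 'x::real_normed_vector) \<Rightarrow>\<^sub>L 'y::real_normed_vector) \<Rightarrow>
     'k set \<Rightarrow> 'x \<Rightarrow>\<^sub>L 'y dual dual" where
  "rep_measure T = (THE m. represents m T)"

text \<open>\<open>T\<^sup>*\<^sup>*\<close> sends \<open>f\<close> to the functional \<open>\<phi> \<mapsto> \<integral> f d(T\<^sup>*(\<phi>))\<close>, the integral of \<open>f\<close> against
  the representing measure of \<open>T\<close>; the extension is the element \<open>y\<close> of \<open>'y\<close> whose canonical image in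
  the bidual is this functional. Such a \<open>y\<close> exists if \<open>T\<close> is strongly bounded on a compact
  Hausdorff space and \<open>'y\<close> is complete; otherwise the value may be unspecified.\<close>

definition extension ::
    "(('k::topological_space \<Rightarrow>\<^sub>C 'x::real_normed_vector) \<Rightarrow>\<^sub>L 'y::real_normed_vector) \<Rightarrow>
     ('k, 'x) bsig \<Rightarrow>\<^sub>L 'y" where
  "extension T = Blinfun (\<lambda>f. THE y. \<forall>\<phi> :: 'y dual.
     blinfun_apply \<phi> y = vm_integral (scalar_part (rep_measure T) \<phi>) (apply_bsig f))"

end

(*
Strong boundedness makes the semivariation of the representing measure regular: every Borel set is
exhausted by compact subsets. Lusin's theorem then holds for the semivariation, so a whole sequence
f n in B(Sigma, X) is continuous on one compact C whose complement has small semivariation. A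
bounded linear simultaneous extension from C yields h n in C(K, X), uniformly bounded by the f n,
that agree with the f n on C, and the extension of T at f n is close to T (h n) uniformly in n.
By Hahn-Banach every functional on the h n is a functional on the f n, so weak nullity and weak
p-summability pass from f to h. The converse implications are composition with the inclusion
of C(K, X) into B(Sigma, X).
*)

theory Submission
  imports Defs
begin

section \<open>The Hahn-Banach theorem\<close>

text \<open>The obstacle is that a closed subset of \<open>K\<close> may admit no bounded linear
  extension operator: one for the Stone-Cech remainder of the integers would give a complement of
  c_0 in l_\<infinity>. But only one sequence has to be extended. Operators on all of
  \<open>B(\<Sigma>,X)\<close> are built that converge along this sequence, and a functional is
  pulled back to the subspace where the limit exists, then enlarged. Separability of the ranges is
  what allows a single compact set for all n, since countably many preimages of balls decide
  continuity. The semivariation is a supremum of measures and only subadditive, so the arguments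
  about it are made for submeasures, without a control measure. Uniform boundedness turns an error
  that is small in the norm of \<open>Y\<close>, uniformly in n, into a small error of the pairings.
  The same approximation also shows that the extension exists and is linear and bounded.\<close>

definition sublinear :: "('a::real_vector \<Rightarrow> real) \<Rightarrow> bool" where
  "sublinear p \<longleftrightarrow> (\<forall>x y. p (x + y) \<le> p x + p y) \<and> (\<forall>r x. 0 < r \<longrightarrow> p (r *\<^sub>R x) = r * p x)"

lemma sublinear_add: "sublinear p \<Longrightarrow> p (x + y) \<le> p x + p y"
  by (simp add: sublinear_def)

lemma sublinear_scaleR: "sublinear p \<Longrightarrow> 0 < r \<Longrightarrow> p (r *\<^sub>R x) = r * p x"
  by (simp add: sublinear_def)

lemma sublinear_zero: "sublinear p \<Longrightarrow> p 0 = 0"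
  using sublinear_scaleR[of p 2 0] by simp

lemma sublinear_minus_ge: "sublinear p \<Longrightarrow> - p (- x) \<le> p x"
  using sublinear_add[of p x "- x"] by (simp add: sublinear_zero)

text \<open>Subadditivity and homogeneity survive an infimum as soon as some index \<open>k\<close>
  does at least as well at the sum or at the multiple. The three uses take infima over shifts along
  a ray, over a chain, and over the points of a subspace.\<close>

lemma sublinear_INF:
  fixes h :: "'i \<Rightarrow> 'a::real_vector \<Rightarrow> real"
  assumes ne: "I \<noteq> {}"
    and bdd: "\<And>x. bdd_below ((\<lambda>i. h i x) ` I)"
    and add: "\<And>i j x y. i \<in> I \<Longrightarrow> j \<in> I \<Longrightarrow> \<exists>k\<in>I. h k (x + y) \<le> h i x + h j y"
    and scale: "\<And>i r x. i \<in> I \<Longrightarrow> 0 < r \<Longrightarrow> \<exists>k\<in>I. h k (r *\<^sub>R x) \<le> r * h i x"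
  shows "sublinear (\<lambda>x. INF i\<in>I. h i x)"
proof -
  let ?q = "\<lambda>x. INF i\<in>I. h i x"
  have low: "?q x \<le> h i x" if "i \<in> I" for i x
    by (rule cINF_lower[OF bdd that])
  have sc: "?q (r *\<^sub>R x) \<le> r * ?q x" if r: "0 < r" for r x
  proof -
    have "?q (r *\<^sub>R x) / r \<le> ?q x"
    proof (rule cINF_greatest[OF ne])
      fix i assume "i \<in> I"
      then obtain k where "k \<in> I" "h k (r *\<^sub>R x) \<le> r * h i x" using scale r by blast
      then have "?q (r *\<^sub>R x) \<le> r * h i x" using low[of k "r *\<^sub>R x"] by linarith
      then show "?q (r *\<^sub>R x) / r \<le> h i x" using r by (simp add: field_simps)
    qed
    then show ?thesis using r by (simp add: field_simps)
  qed
  have "?q (x + y) \<le> ?q x + ?q y" for x y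
  proof -
    have "?q (x + y) - ?q y \<le> ?q x"
    proof (rule cINF_greatest[OF ne])
      fix i assume i: "i \<in> I"
      have "?q (x + y) - h i x \<le> ?q y"
      proof (rule cINF_greatest[OF ne])
        fix j assume "j \<in> I"
        then obtain k where "k \<in> I" "h k (x + y) \<le> h i x + h j y" using add i by blast
        then show "?q (x + y) - h i x \<le> h j y" using low[of k "x + y"] by linarith
      qed
      then show "?q (x + y) - ?q y \<le> h i x" by linarith
    qed
    then show ?thesis by linarith
  qed
  moreover have "?q (r *\<^sub>R x) = r * ?q x" if r: "0 < r" for r x
  proof (rule antisym)
    \<comment> \<open>The reverse inequality is \<open>sc\<close> for \<open>inverse r\<close> at
      the point \<open>r *\<^sub>R x\<close>.\<close>
    have "?q (inverse r *\<^sub>R r *\<^sub>R x) \<le> inverse r * ?q (r *\<^sub>R x)" using r by (intro sc) simp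
    then show "r * ?q x \<le> ?q (r *\<^sub>R x)" using r by (simp add: field_simps)
  qed (rule sc[OF r])
  ultimately show ?thesis by (simp add: sublinear_def)
qed

text \<open>Lowering \<open>p\<close> in the direction \<open>x\<close>, by the infimum over
  \<open>t \<ge> 0\<close> of \<open>p (y + t *\<^sub>R x) - t * p x\<close>, again gives a
  sublinear functional below \<open>p\<close>, hence \<open>p\<close> itself. At
  \<open>y = - x\<close> the term for \<open>t = 1\<close> equals \<open>- p x\<close>.\<close>

lemma minimal_sublinear_odd:
  assumes p: "sublinear p"
    and min: "\<And>q. sublinear q \<Longrightarrow> (\<And>x. q x \<le> p x) \<Longrightarrow> q = p"
  shows "p (- x) = - p x"
proof -
  define h where "h t y = p (y + t *\<^sub>R x) - t * p x" for t y
  have low: "- p (- y) \<le> h t y" if "t \<ge> 0" for t y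
  proof -
    have "p (t *\<^sub>R x) = t * p x"
      using that sublinear_scaleR[OF p, of t x] sublinear_zero[OF p] by (cases "t = 0") auto
    then show ?thesis
      using sublinear_add[OF p, of "- y" "y + t *\<^sub>R x"] by (simp add: h_def)
  qed
  have bdd: "bdd_below ((\<lambda>t. h t y) ` {0..})" for y
    using low[of _ y] by (auto intro!: bdd_belowI2)
  have "sublinear (\<lambda>y. INF t\<in>{0..}. h t y)"
  proof (rule sublinear_INF)
    fix s t :: real and y z
    assume st: "s \<in> {0..}" "t \<in> {0..}"
    have "p (y + z + (s + t) *\<^sub>R x) \<le> p (y + s *\<^sub>R x) + p (z + t *\<^sub>R x)"
      using sublinear_add[OF p, of "y + s *\<^sub>R x" "z + t *\<^sub>R x"]
      by (simp add: algebra_simps)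
    then show "\<exists>k\<in>{0..}. h k (y + z) \<le> h s y + h t z"
      using st by (intro bexI[of _ "s + t"]) (auto simp: h_def algebra_simps)
  next
    fix t r :: real and y
    assume t: "t \<in> {0..}" and r: "0 < r"
    have "p (r *\<^sub>R y + (r * t) *\<^sub>R x) = r * p (y + t *\<^sub>R x)"
      using sublinear_scaleR[OF p r, of "y + t *\<^sub>R x"] by (simp add: algebra_simps)
    then show "\<exists>k\<in>{0..}. h k (r *\<^sub>R y) \<le> r * h t y"
      using r t by (intro bexI[of _ "r * t"]) (auto simp: h_def algebra_simps)
  qed (use bdd in auto)
  moreover have "(INF t\<in>{0..}. h t y) \<le> p y" for y
    using cINF_lower[OF bdd[of y], of 0] by (simp add: h_def)
  ultimately have "(\<lambda>y. INF t\<in>{0..}. h t y) = p" by (rule min)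
  then have "p (- x) = (INF t\<in>{0..}. h t (- x))" by metis
  also have "\<dots> \<le> h 1 (- x)" by (rule cINF_lower[OF bdd]) simp
  also have "\<dots> = - p x" by (simp add: h_def sublinear_zero[OF p])
  finally show ?thesis using sublinear_minus_ge[OF p, of x] by linarith
qed

text \<open>A minimal sublinear functional is linear, so Zorn's lemma can be applied to total functions.\<close>

lemma hahn_banach_sublinear:
  fixes q :: "'a::real_vector \<Rightarrow> real"
  assumes q: "sublinear q"
  obtains l where "linear l" "\<And>x. l x \<le> q x"
proof -
  let ?A = "{p. sublinear p \<and> (\<forall>x. p x \<le> q x)}"
  \<comment> \<open>The order is reversed, so that the maximal element found by Zorn's lemma is a
    minimal functional.\<close>
  let ?P = "\<lambda>p p'. \<forall>x. p' x \<le> (p x :: real)"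
  have po: "partial_order_on ?A (relation_of ?P ?A)"
  proof (rule partial_order_on_relation_ofI)
    show "a = b" if "\<forall>x. b x \<le> a x" "\<forall>x. a x \<le> b x" for a b :: "'a \<Rightarrow> real"
      using that by (intro ext order_antisym) auto
  qed (auto intro: order_trans)
  have ch: "\<exists>u\<in>?A. \<forall>a\<in>C. ?P a u" if C: "C \<in> Chains (relation_of ?P ?A)" for C
  proof (cases "C = {}")
    case True
    then show ?thesis using q by auto
  next
    case False
    have CA: "p \<in> ?A" if "p \<in> C" for p
      using C that by (auto simp: Chains_def relation_of_def)
    have tot: "?P p p' \<or> ?P p' p" if "p \<in> C" "p' \<in> C" for p p'
      using C that by (auto simp: Chains_def relation_of_def)
    \<comment> \<open>At each point one real number bounds all members of the chain from below, so
      their infimum is a genuine real.\<close>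
    have low: "- q (- x) \<le> p x" if "p \<in> C" for p x
      using CA[OF that] sublinear_minus_ge[of p x] by (simp, smt (verit))
    then have bdd: "bdd_below ((\<lambda>p. p x) ` C)" for x
      by (auto intro!: bdd_belowI2)
    have le: "(INF p\<in>C. p x) \<le> p x" if "p \<in> C" for p x
      by (rule cINF_lower[OF bdd that])
    have "sublinear (\<lambda>x. INF p\<in>C. p x)"
    proof (rule sublinear_INF[where h = "\<lambda>p. p"])
      fix p p' x y assume pp: "p \<in> C" "p' \<in> C"
      \<comment> \<open>Two members of a chain are comparable, and the smaller one serves as
        \<open>k\<close>.\<close>
      have "p (x + y) \<le> p x + p' y \<or> p' (x + y) \<le> p x + p' y"
      proof (cases "?P p p'")
        case True
        then show ?thesis
          using CA[OF pp(2)] sublinear_add[of p' x y] by (smt (verit) mem_Collect_eq)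
      next
        case False
        then have "?P p' p" using tot[OF pp] by blast
        then show ?thesis
          using CA[OF pp(1)] sublinear_add[of p x y] by (smt (verit) mem_Collect_eq)
      qed
      then show "\<exists>k\<in>C. k (x + y) \<le> p x + p' y" using pp by blast
    next
      fix p r x assume "p \<in> C" "0 < (r::real)"
      then show "\<exists>k\<in>C. k (r *\<^sub>R x) \<le> r * p x"
        using CA sublinear_scaleR by (metis (mono_tags, lifting) mem_Collect_eq order_refl)
    qed (use False bdd in auto)
    moreover have "(INF p\<in>C. p x) \<le> q x" for x
    proof -
      obtain p where "p \<in> C" using False by blast
      then show ?thesis using le[of p x] CA[of p] by (auto intro: order_trans)
    qed
    ultimately show ?thesis using le by (intro bexI[of _ "\<lambda>x. INF p\<in>C. p x"]) auto
  qed
  obtain p where p: "p \<in> ?A" and max: "\<And>p'. p' \<in> ?A \<Longrightarrow> ?P p p' \<Longrightarrow> p' = p"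
    using predicate_Zorn[OF po ch] by blast
  have sub: "sublinear p" and pq: "p x \<le> q x" for x using p by auto
  have odd: "p (- x) = - p x" for x
  proof (rule minimal_sublinear_odd[OF sub])
    fix q' assume "sublinear q'" "\<And>x. q' x \<le> p x"
    then show "q' = p" using pq by (intro max) (auto intro: order_trans)
  qed
  have "p (x + y) = p x + p y" for x y
    using sublinear_add[OF sub, of x y] sublinear_add[OF sub, of "- x" "- y"] odd[of x] odd[of y]
      odd[of "x + y"] by simp
  moreover have "p (r *\<^sub>R x) = r *\<^sub>R p x" for r x
  proof (cases r "0 :: real" rule: linorder_cases)
    case less
    then have "p (- (r *\<^sub>R x)) = - r * p x" using sublinear_scaleR[OF sub, of "- r" x] by simp
    then show ?thesis by (simp add: odd)
  qed (use sublinear_zero[OF sub] sublinear_scaleR[OF sub] in auto)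
  ultimately have "linear p" by (intro linearI)
  with pq show ?thesis using that by blast
qed

text \<open>The sublinear version is applied to the infimal convolution of \<open>\<psi>\<close> on
  \<open>V\<close> with \<open>c\<close> times the norm. A linear functional below it is at most
  \<open>c * norm x\<close> (take \<open>v = 0\<close>) and at most \<open>\<psi>\<close> on
  \<open>V\<close> (take \<open>v = x\<close>); on a subspace the latter is an equality, as the
  point may be negated.\<close>

theorem hahn_banach_extension:
  fixes \<psi> :: "'a::real_normed_vector \<Rightarrow> real"
  assumes V: "subspace V"
    and add: "\<And>v w. v \<in> V \<Longrightarrow> w \<in> V \<Longrightarrow> \<psi> (v + w) = \<psi> v + \<psi> w"
    and scale: "\<And>r v. v \<in> V \<Longrightarrow> \<psi> (r *\<^sub>R v) = r * \<psi> v"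
    and bound: "\<And>v. v \<in> V \<Longrightarrow> \<bar>\<psi> v\<bar> \<le> c * norm v" and c: "0 \<le> c"
  obtains \<Lambda> :: "'a dual" where "norm \<Lambda> \<le> c" "\<And>v. v \<in> V \<Longrightarrow> blinfun_apply \<Lambda> v = \<psi> v"
proof -
  have V0: "0 \<in> V" by (rule subspace_0[OF V])
  have psi0: "\<psi> 0 = 0" using scale[OF V0, of 0] by simp
  define h where "h v x = \<psi> v + c * norm (x - v)" for v x
  have low: "- (c * norm x) \<le> h v x" if "v \<in> V" for v x
  proof -
    have "c * norm v \<le> c * (norm (x - v) + norm x)"
      using norm_triangle_ineq2[of v x] norm_minus_commute[of x v] c
      by (intro mult_left_mono) auto
    then show ?thesis using bound[OF that] by (auto simp: h_def algebra_simps)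
  qed
  have bdd: "bdd_below ((\<lambda>v. h v x) ` V)" for x
    by (rule bdd_belowI2[where m = "- (c * norm x)"]) (rule low)
  define q where "q = (\<lambda>x. INF v\<in>V. h v x)"
  have q_le: "q x \<le> h v x" if "v \<in> V" for v x
    unfolding q_def by (rule cINF_lower[OF bdd that])
  have "sublinear q" unfolding q_def
  proof (rule sublinear_INF)
    fix v w x y assume vw: "v \<in> V" "w \<in> V"
    have "c * norm (x + y - (v + w)) \<le> c * (norm (x - v) + norm (y - w))"
      using norm_triangle_ineq[of "x - v" "y - w"] c
      by (intro mult_left_mono) (simp_all add: algebra_simps)
    then show "\<exists>k\<in>V. h k (x + y) \<le> h v x + h w y"
      using vw by (intro bexI[of _ "v + w"])
        (auto simp: h_def add algebra_simps subspace_add[OF V])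
  next
    fix v r x assume v: "v \<in> V" and r: "0 < (r::real)"
    have "norm (r *\<^sub>R x - r *\<^sub>R v) = r * norm (x - v)"
      using r by (simp flip: scaleR_diff_right)
    then show "\<exists>k\<in>V. h k (r *\<^sub>R x) \<le> r * h v x"
      using v by (intro bexI[of _ "r *\<^sub>R v"])
        (auto simp: h_def scale algebra_simps subspace_scale[OF V])
  qed (use V0 bdd in auto)
  then obtain l where l: "linear l" and lq: "\<And>x. l x \<le> q x"
    by (rule hahn_banach_sublinear) blast
  have lc: "l x \<le> c * norm x" for x
    using lq[of x] q_le[OF V0, of x] by (simp add: h_def psi0)
  have abs: "norm (l x) \<le> norm x * c" for x
    using lc[of x] lc[of "- x"] linear_neg[OF l, of x] by (simp add: mult.commute abs_le_iff)
  have bl: "bounded_linear l"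
    using l abs by (intro bounded_linear_intro[where K = c]) (auto simp: linear_add linear_scale)
  have lv: "l v \<le> \<psi> v" if "v \<in> V" for v
    using lq[of v] q_le[OF that, of v] by (simp add: h_def)
  have "l v = \<psi> v" if "v \<in> V" for v
  proof -
    have "l (- v) \<le> \<psi> (- v)" using that subspace_neg[OF V] by (intro lv)
    then show ?thesis using lv[OF that] scale[OF that, of "-1"] linear_neg[OF l, of v] by simp
  qed
  moreover have "norm (Blinfun l) \<le> c"
    using abs c by (intro norm_blinfun_bound) (auto simp: bounded_linear_Blinfun_apply[OF bl] mult.commute)
  ultimately show ?thesis
    using that[of "Blinfun l"] by (simp add: bounded_linear_Blinfun_apply[OF bl])
qed

lemma norming_functional:
  fixes x :: "'a::real_normed_vector"
  obtains \<phi> :: "'a dual" where "norm \<phi> \<le> 1" "blinfun_apply \<phi> x = norm x"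
proof (cases "x = 0")
  case True
  then show ?thesis using that[of 0] by simp
next
  case False
  \<comment> \<open>\<open>SOME t\<close> reads off the coordinate on the line through
    \<open>x\<close>, which is unique as \<open>x\<close> is nonzero.\<close>
  define \<psi> where "\<psi> v = (SOME t. v = t *\<^sub>R x) * norm x" for v
  have psi: "\<psi> (t *\<^sub>R x) = t * norm x" for t
    using False by (simp add: \<psi>_def)
  have V: "v \<in> span {x} \<longleftrightarrow> (\<exists>t. v = t *\<^sub>R x)" for v
    by (auto simp: span_singleton)
  obtain \<Lambda> :: "'a dual" where L: "norm \<Lambda> \<le> 1" "\<And>v. v \<in> span {x} \<Longrightarrow> blinfun_apply \<Lambda> v = \<psi> v"
  proof (rule hahn_banach_extension[of "span {x}" \<psi> 1])
    fix v w assume "v \<in> span {x}" "w \<in> span {x}"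
    then obtain s t where "v = s *\<^sub>R x" "w = t *\<^sub>R x" by (auto simp: V)
    then show "\<psi> (v + w) = \<psi> v + \<psi> w"
      by (simp add: psi flip: scaleR_add_left) (simp add: algebra_simps)
  next
    fix r v assume "v \<in> span {x}"
    then obtain t where "v = t *\<^sub>R x" by (auto simp: V)
    then show "\<psi> (r *\<^sub>R v) = r * \<psi> v" by (simp add: psi)
  next
    fix v assume "v \<in> span {x}"
    then obtain t where "v = t *\<^sub>R x" by (auto simp: V)
    then show "\<bar>\<psi> v\<bar> \<le> 1 * norm v" by (simp add: psi abs_mult)
  qed auto
  have "\<Lambda> x = norm x" using L(2)[of x] psi[of 1] by (simp add: span_base)
  with L(1) show ?thesis using that by blast
qed

lemma norm_le_by_functionals:
  fixes x :: "'a::real_normed_vector"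
  assumes "\<And>\<phi> :: 'a dual. norm \<phi> \<le> 1 \<Longrightarrow> \<bar>blinfun_apply \<phi> x\<bar> \<le> c"
  shows "norm x \<le> c"
proof -
  obtain \<phi> :: "'a dual" where "norm \<phi> \<le> 1" "blinfun_apply \<phi> x = norm x" by (rule norming_functional)
  with assms[of \<phi>] show ?thesis by simp
qed

lemma eq_by_functionals:
  fixes x y :: "'a::real_normed_vector"
  assumes "\<And>\<phi> :: 'a dual. blinfun_apply \<phi> x = blinfun_apply \<phi> y"
  shows "x = y"
proof -
  have "norm (x - y) \<le> 0"
    by (rule norm_le_by_functionals) (simp add: blinfun.diff_right assms)
  then show ?thesis by simp
qed


section \<open>Uniform boundedness\<close>

text \<open>Wherever \<open>a\<close> lies, the values at \<open>a + r *\<^sub>R z\<close> and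
  \<open>a - r *\<^sub>R z\<close> differ by \<open>2 * r * \<phi> z\<close>, so one of them is
  large. The norm need not be attained on the unit ball, whence a factor below 1; the choice 2/3
  leaves room above the 1/2 that the gliding hump consumes.\<close>

lemma blinfun_large_near:
  fixes \<phi> :: "'a::real_normed_vector dual"
  assumes r: "0 < r"
  obtains x where "norm (x - a) \<le> r" "\<bar>blinfun_apply \<phi> x\<bar> \<ge> 2 / 3 * r * norm \<phi>"
proof (cases "\<phi> = 0")
  case True
  then show ?thesis using that[of a] r by simp
next
  case False
  have "\<exists>z. norm z \<le> 1 \<and> 2 / 3 * norm \<phi> \<le> \<bar>\<phi> z\<bar>"
  proof (rule ccontr)
    assume neg: "\<not> ?thesis"
    have "\<bar>blinfun_apply \<phi> x\<bar> \<le> 2 / 3 * norm \<phi> * norm x" for x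
    proof (cases "x = 0")
      case nz: False
      have "norm (inverse (norm x) *\<^sub>R x) \<le> 1" using nz by simp
      then have "\<bar>\<phi> (inverse (norm x) *\<^sub>R x)\<bar> < 2 / 3 * norm \<phi>"
        using neg by (meson not_le)
      then show ?thesis using nz by (simp add: blinfun.scaleR_right abs_mult field_simps)
    qed simp
    then have "norm \<phi> \<le> 2 / 3 * norm \<phi>" by (intro norm_blinfun_bound) auto
    with False show False by simp
  qed
  then obtain z where z: "norm z \<le> 1" "2 / 3 * norm \<phi> \<le> \<bar>\<phi> z\<bar>" by blast
  have "r * (2 / 3 * norm \<phi>) \<le> r * \<bar>\<phi> z\<bar>" using z r by (intro mult_left_mono) auto
  then have big: "2 / 3 * r * norm \<phi> \<le> r * \<bar>\<phi> z\<bar>" by (simp add: algebra_simps)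
  have "\<phi> (a + r *\<^sub>R z) - \<phi> (a - r *\<^sub>R z) = 2 * (r * \<phi> z)"
    by (simp add: blinfun.add_right blinfun.diff_right blinfun.scaleR_right)
  then have "\<bar>2 * (r * \<phi> z)\<bar> \<le> \<bar>\<phi> (a + r *\<^sub>R z)\<bar> + \<bar>\<phi> (a - r *\<^sub>R z)\<bar>"
    by linarith
  then have "2 * (r * \<bar>\<phi> z\<bar>) \<le> \<bar>\<phi> (a + r *\<^sub>R z)\<bar> + \<bar>\<phi> (a - r *\<^sub>R z)\<bar>"
    using r by (simp add: abs_mult)
  then have "2 / 3 * r * norm \<phi> \<le> \<bar>\<phi> (a + r *\<^sub>R z)\<bar> \<or> 2 / 3 * r * norm \<phi> \<le> \<bar>\<phi> (a - r *\<^sub>R z)\<bar>"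
    using big by linarith
  moreover have "norm (r *\<^sub>R z) \<le> r" using z r by (simp add: mult_left_le)
  ultimately show ?thesis
    using that[of "a + r *\<^sub>R z"] that[of "a - r *\<^sub>R z"] by (auto simp del: norm_scaleR)
qed

text \<open>Sokal's gliding hump: if the norms were unbounded, one could move from point to point by
  geometrically shrinking steps along which the functionals grow faster.\<close>

theorem uniform_boundedness:
  fixes \<phi> :: "'i \<Rightarrow> 'a::banach dual"
  assumes ptw: "\<And>x. \<exists>c. \<forall>i. \<bar>blinfun_apply (\<phi> i) x\<bar> \<le> c"
  shows "\<exists>c. \<forall>i. norm (\<phi> i) \<le> c"
proof (rule ccontr)
  assume "\<not> ?thesis"
  then have "\<forall>n. \<exists>i. norm (\<phi> i) \<ge> 4 ^ n" by (meson nle_le)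
  then obtain s where s: "\<And>n::nat. norm (\<phi> (s n)) \<ge> 4 ^ n" by metis
  \<comment> \<open>The steps have length at most \<open>(1/3) ^ n\<close> while the norms are at
    least \<open>4 ^ n\<close>, so the values grow at least like \<open>(4/3) ^ n\<close>, up to a
    constant.\<close>
  define P where "P n a x \<longleftrightarrow> norm (x - a) \<le> (1/3) ^ n \<and> \<bar>\<phi> (s n) x\<bar> \<ge> 2 / 3 * (1/3) ^ n * norm (\<phi> (s n))"
    for n :: nat and a x
  have "\<forall>n a. \<exists>x. P n a x"
    unfolding P_def by (metis blinfun_large_near zero_less_power zero_less_divide_1_iff zero_less_numeral)
  then obtain N where N: "\<And>n a. P n a (N n a)" by metis
  define x where "x = rec_nat 0 (\<lambda>n. N (Suc n))"
  have x: "P (Suc n) (x n) (x (Suc n))" for n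
    by (simp add: x_def N)
  have step: "norm (x (Suc n) - x n) \<le> (1/3) ^ Suc n" for n
    using x[of n] by (simp add: P_def)
  \<comment> \<open>All later steps together move the point by at most half of
    \<open>(1/3) ^ n\<close>. They can therefore cancel only 1/2 of the 2/3 gained at step
    \<open>n\<close>, which leaves the fraction 1/6. The subtracted term makes the induction
    close.\<close>
  have tail: "norm (x (n + k) - x n) \<le> 1/2 * (1/3) ^ n - 1/2 * (1/3) ^ (n + k)" for n k
  proof (induction k)
    case (Suc k)
    have "norm (x (n + Suc k) - x n) \<le> norm (x (Suc (n + k)) - x (n + k)) + norm (x (n + k) - x n)"
      using norm_triangle_ineq[of "x (Suc (n + k)) - x (n + k)" "x (n + k) - x n"] by simp
    also have "\<dots> \<le> (1/3) ^ Suc (n + k) + (1/2 * (1/3) ^ n - 1/2 * (1/3) ^ (n + k))"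
      using step[of "n + k"] Suc by (rule add_mono)
    also have "\<dots> = 1/2 * (1/3) ^ n - 1/2 * (1/3) ^ (n + Suc k)" by simp
    finally show ?case .
  qed simp
  have tail': "norm (x (n + k) - x n) \<le> 1/2 * (1/3) ^ n" for n k
    using tail[of n k] zero_le_power[of "1/3 :: real" "n + k"] by linarith
  have "Cauchy x"
  proof (rule CauchyI)
    fix e :: real assume "0 < e"
    then obtain n where n: "(1/3) ^ n < (e::real)" using real_arch_pow_inv[of e "1/3"] by auto
    have "norm (x k - x l) < e" if "k \<ge> n" "l \<ge> n" for k l
    proof -
      have "norm (x k - x n) \<le> 1/2 * (1/3) ^ n" "norm (x l - x n) \<le> 1/2 * (1/3) ^ n"
        using tail'[of n "k - n"] tail'[of n "l - n"] that by auto
      then show ?thesis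
        using n norm_triangle_ineq4[of "x k - x n" "x l - x n"] by (simp add: algebra_simps)
    qed
    then show "\<exists>M. \<forall>k\<ge>M. \<forall>l\<ge>M. norm (x k - x l) < e" by blast
  qed
  then obtain y where y: "x \<longlonglongrightarrow> y" using Cauchy_convergent_iff convergent_def by blast
  have near: "norm (y - x n) \<le> 1/2 * (1/3) ^ n" for n
  proof (rule tendsto_upperbound)
    show "(\<lambda>k. norm (x k - x n)) \<longlonglongrightarrow> norm (y - x n)" by (intro tendsto_intros y)
    show "\<forall>\<^sub>F k in sequentially. norm (x k - x n) \<le> 1/2 * (1/3) ^ n"
      using tail' by (auto simp: eventually_sequentially le_iff_add)
  qed simp
  obtain c where c: "\<And>i. \<bar>\<phi> i y\<bar> \<le> c" using ptw by blast
  obtain n where n: "6 * c < (4/3) ^ n" using real_arch_pow[of "4/3" "6 * c"] by auto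
  let ?f = "\<phi> (s (Suc n))" and ?e = "(1/3) ^ Suc n :: real"
  have "\<bar>?f (y - x (Suc n))\<bar> \<le> norm ?f * (1/2 * ?e)"
    using norm_blinfun[of ?f "y - x (Suc n)"]
      mult_left_mono[OF near[of "Suc n"] norm_ge_zero[of ?f]] by simp
  moreover have "2 / 3 * ?e * norm ?f \<le> \<bar>?f (x (Suc n))\<bar>" using x[of n] by (simp add: P_def)
  moreover have "\<bar>?f (x (Suc n))\<bar> \<le> \<bar>?f y\<bar> + \<bar>?f (y - x (Suc n))\<bar>"
    by (simp add: blinfun.diff_right)
  moreover have "2 / 3 * ?e * norm ?f - norm ?f * (1/2 * ?e) = 1 / 6 * ?e * norm ?f" by simp
  ultimately have "1 / 6 * ?e * norm ?f \<le> \<bar>?f y\<bar>" by linarith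
  moreover have "?e * norm ?f \<ge> ?e * 4 ^ Suc n"
    using s[of "Suc n"] by (intro mult_left_mono) auto
  moreover have "?e * 4 ^ Suc n = (4/3) ^ Suc n" by (simp add: power_divide)
  ultimately have "(4/3) ^ Suc n \<le> 6 * c" using c[of "s (Suc n)"] by linarith
  moreover have "(4/3 :: real) ^ n \<le> (4/3) ^ Suc n" by simp
  ultimately show False using n by linarith
qed

section \<open>Norm bounds for weakly convergent sequences\<close>

lemma weak_star_null_bounded:
  fixes \<phi> :: "nat \<Rightarrow> 'a::banach dual"
  assumes "weak_star_null \<phi>"
  obtains c where "0 < c" "\<And>n. norm (\<phi> n) \<le> c"
proof -
  have "\<exists>c. \<forall>n. \<bar>\<phi> n x\<bar> \<le> c" for x
  proof -
    have "Bseq (\<lambda>n. \<phi> n x)"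
      using assms unfolding weak_star_null_def by (metis convergentI convergent_imp_Bseq)
    then show ?thesis by (auto simp: Bseq_def)
  qed
  then obtain c where "\<And>n. norm (\<phi> n) \<le> c" using uniform_boundedness by blast
  then show ?thesis using that[of "max c 1"] by (simp add: max.coboundedI1)
qed

text \<open>The sequence is viewed in the bidual, as functionals on the dual, which is complete;
  uniform boundedness applies there, and norming functionals bring the bound back.\<close>

lemma weakly_null_bounded:
  fixes x :: "nat \<Rightarrow> 'a::real_normed_vector"
  assumes "weakly_null x"
  obtains c where "0 < c" "\<And>n. norm (x n) \<le> c"
proof -
  define ev :: "nat \<Rightarrow> 'a dual dual" where "ev n = Blinfun (\<lambda>\<phi>. blinfun_apply \<phi> (x n))" for n
  have ev: "blinfun_apply (ev n) \<phi> = blinfun_apply \<phi> (x n)" for n \<phi>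
    by (simp add: ev_def bounded_linear_Blinfun_apply[OF blinfun.bounded_linear_left])
  have "weak_star_null ev"
    using assms by (simp add: weak_star_null_def weakly_null_def ev)
  then obtain c where c: "0 < c" "\<And>n. norm (ev n) \<le> c" by (rule weak_star_null_bounded) blast
  have "norm (x n) \<le> c" for n
  proof (rule norm_le_by_functionals)
    fix \<phi> :: "'a dual" assume "norm \<phi> \<le> 1"
    then show "\<bar>\<phi> (x n)\<bar> \<le> c"
      using norm_blinfun[of "ev n" \<phi>] c(2)[of n] c(1)
      by (simp add: ev) (metis mult_left_le norm_ge_zero order_trans)
  qed
  with c(1) show ?thesis using that by blast
qed

lemma weakly_null_imp_weak_star_null:
  fixes \<phi> :: "nat \<Rightarrow> 'a::real_normed_vector dual"
  assumes "weakly_null \<phi>"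
  shows "weak_star_null \<phi>"
  unfolding weak_star_null_def
proof
  fix a :: 'a
  have "(\<lambda>n. blinfun_apply (Blinfun (\<lambda>\<phi> :: 'a dual. blinfun_apply \<phi> a)) (\<phi> n)) \<longlonglongrightarrow> 0"
    using assms by (simp only: weakly_null_def)
  then show "(\<lambda>n. \<phi> n a) \<longlonglongrightarrow> 0"
    by (simp add: bounded_linear_Blinfun_apply[OF blinfun.bounded_linear_left])
qed

text \<open>Terms of a convergent series tend to zero, and the power \<open>1 / p\<close> preserves
  this. Its purpose is to make weakly \<open>p\<close>-summable sequences norm bounded.\<close>

lemma weakly_p_summable_imp_weakly_null:
  assumes "0 < p" "weakly_p_summable p x"
  shows "weakly_null x"
  unfolding weakly_null_def
proof
  fix \<phi> :: "'a dual"
  have "(\<lambda>n. \<bar>\<phi> (x n)\<bar> powr p) \<longlonglongrightarrow> 0"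
    using assms(2) by (auto simp: weakly_p_summable_def intro: summable_LIMSEQ_zero)
  then have "(\<lambda>n. (\<bar>\<phi> (x n)\<bar> powr p) powr (1 / p)) \<longlonglongrightarrow> 0"
    using assms(1) tendsto_powr'[of _ 0 _ "\<lambda>_. 1 / p" "1 / p"] by fastforce
  then show "(\<lambda>n. \<phi> (x n)) \<longlonglongrightarrow> 0"
    using assms(1) by (simp add: powr_powr tendsto_rabs_zero_iff)
qed


section \<open>The variation of a vector measure\<close>

text \<open>The clause of \<open>rcabv\<close> from which the variation measure and the integral
  estimates are derived.\<close>

definition vector_measure ::
    "('k::topological_space set \<Rightarrow> 'z::real_normed_vector) \<Rightarrow> bool" where
  "vector_measure \<mu> \<longleftrightarrow> (\<forall>A :: nat \<Rightarrow> 'k set. range A \<subseteq> sets borel \<longrightarrow> disjoint_family A \<longrightarrow>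
     (\<lambda>i. \<mu> (A i)) sums \<mu> (\<Union>i. A i))"

lemma rcabv_imp_vector_measure: "\<mu> \<in> rcabv \<Longrightarrow> vector_measure \<mu>"
  by (simp add: rcabv_def vector_measure_def)

lemma vector_measure_sums:
  "vector_measure \<mu> \<Longrightarrow> (\<And>i. A i \<in> sets borel) \<Longrightarrow> disjoint_family A \<Longrightarrow>
    (\<lambda>i::nat. \<mu> (A i)) sums \<mu> (\<Union>i. A i)"
  unfolding vector_measure_def by blast

lemma vector_measure_empty:
  assumes "vector_measure \<mu>" shows "\<mu> {} = 0"
proof -
  have "(\<lambda>i::nat. \<mu> {}) sums \<mu> {}"
    using vector_measure_sums[OF assms, of "\<lambda>_. {}"] by (simp add: disjoint_family_on_def)
  then have "summable (\<lambda>i::nat. \<mu> {})" by (rule sums_summable)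
  then have "(\<lambda>i::nat. \<mu> {}) \<longlonglongrightarrow> 0" by (rule summable_LIMSEQ_zero)
  then show ?thesis by (simp add: LIMSEQ_const_iff)
qed

lemma vector_measure_Un:
  assumes m: "vector_measure \<mu>" and AB: "A \<in> sets borel" "B \<in> sets borel" "A \<inter> B = {}"
  shows "\<mu> (A \<union> B) = \<mu> A + \<mu> B"
proof -
  have "(\<lambda>i. \<mu> (binaryset A B i)) sums \<mu> (\<Union>i. binaryset A B i)"
    using AB by (intro vector_measure_sums[OF m])
      (auto simp: binaryset_def disjoint_family_on_def split: if_splits)
  moreover have "(\<lambda>i. \<mu> (binaryset A B i)) sums (\<mu> A + \<mu> B)"
    by (rule binaryset_sums) (rule vector_measure_empty[OF m])
  ultimately show ?thesis by (simp add: UN_binaryset_eq sums_unique2)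
qed

lemma vector_measure_UN:
  assumes m: "vector_measure \<mu>" and "finite I" and "\<And>i. i \<in> I \<Longrightarrow> B i \<in> sets borel"
    and "disjoint_family_on B I"
  shows "\<mu> (\<Union>i\<in>I. B i) = (\<Sum>i\<in>I. \<mu> (B i))"
  using assms(2-)
proof (induction I rule: finite_induct)
  case (insert i I)
  have "B i \<inter> (\<Union>i\<in>I. B i) = {}"
    using insert.hyps insert.prems(2) by (fastforce simp: disjoint_family_on_def)
  then have "\<mu> (B i \<union> (\<Union>i\<in>I. B i)) = \<mu> (B i) + \<mu> (\<Union>i\<in>I. B i)"
    using insert.hyps insert.prems by (intro vector_measure_Un[OF m]) auto
  then show ?case
    using insert by (auto simp: disjoint_family_on_def)
qed (simp add: vector_measure_empty[OF m])

text \<open>The supremum in \<open>variation\<close> ranges over exact partitions. An indexed family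
  that may have empty members and need not cover \<open>A\<close> is completed to one: empty members
  are dropped, having measure zero, and the remainder \<open>R\<close> becomes a further block
  unless it is empty.\<close>

lemma sum_le_variation:
  assumes m: "vector_measure \<mu>" and I: "finite I"
    and B: "\<And>i. i \<in> I \<Longrightarrow> B i \<in> sets borel" "\<And>i. i \<in> I \<Longrightarrow> B i \<subseteq> A"
    and disj: "disjoint_family_on B I" and A: "A \<in> sets borel"
  shows "(\<Sum>i\<in>I. ennreal (norm (\<mu> (B i)))) \<le> variation \<mu> A"
proof -
  define J where "J = {i \<in> I. B i \<noteq> {}}"
  define R where "R = A - (\<Union>i\<in>I. B i)"
  define P where "P = B ` J \<union> ({R} - {{}})"
  have inj: "inj_on B J"
    using disj unfolding inj_on_def J_def disjoint_family_on_def by blast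
  have "R \<in> sets borel" using A B I by (auto simp: R_def)
  then have Ps: "P \<subseteq> sets borel" using B by (auto simp: P_def J_def)
  have part: "partition_on A P"
  proof (rule partition_onI)
    have "\<Union> P = (\<Union>i\<in>J. B i) \<union> R" unfolding P_def by blast
    also have "(\<Union>i\<in>J. B i) = (\<Union>i\<in>I. B i)" unfolding J_def by blast
    also have "(\<Union>i\<in>I. B i) \<union> R = A" using B(2) unfolding R_def by blast
    finally show "\<Union> P = A" .
    show "disjnt C D" if "C \<in> P" "D \<in> P" "C \<noteq> D" for C D
    proof -
      have "B i \<inter> R = {}" if "i \<in> I" for i using that by (auto simp: R_def)
      moreover have "B i \<inter> B j = {}" if "i \<in> I" "j \<in> I" "B i \<noteq> B j" for i j
        using disj that unfolding disjoint_family_on_def by metis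
      ultimately show ?thesis
        using that unfolding P_def J_def disjnt_def by blast
    qed
  qed (auto simp: P_def J_def)
  have "(\<Sum>i\<in>I. ennreal (norm (\<mu> (B i)))) = (\<Sum>i\<in>J. ennreal (norm (\<mu> (B i))))"
    by (rule sum.mono_neutral_right) (auto simp: J_def I vector_measure_empty[OF m])
  also have "\<dots> = (\<Sum>C\<in>B ` J. ennreal (norm (\<mu> C)))"
    by (simp add: sum.reindex[OF inj])
  also have "\<dots> \<le> (\<Sum>C\<in>P. ennreal (norm (\<mu> C)))"
    by (rule sum_mono2) (auto simp: P_def J_def I)
  also have "\<dots> \<le> variation \<mu> A"
    unfolding variation_def using part Ps
    by (intro SUP_upper) (auto simp: P_def J_def I)
  finally show ?thesis .
qed

lemma variation_least:
  assumes "\<And>P. finite P \<Longrightarrow> P \<subseteq> sets borel \<Longrightarrow> partition_on A P \<Longrightarrow> (\<Sum>B\<in>P. ennreal (norm (\<mu> B))) \<le> c"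
  shows "variation \<mu> A \<le> c"
  unfolding variation_def using assms by (intro SUP_least) auto

lemma norm_le_variation:
  assumes "vector_measure \<mu>" "A \<in> sets borel"
  shows "ennreal (norm (\<mu> A)) \<le> variation \<mu> A"
  using sum_le_variation[OF assms(1), of "{()}" "\<lambda>_. A" A] assms(2)
  by (simp add: disjoint_family_on_def)

lemma variation_mono:
  assumes m: "vector_measure \<mu>" and "A \<in> sets borel" "B \<in> sets borel" "A \<subseteq> B"
  shows "variation \<mu> A \<le> variation \<mu> B"
proof (rule variation_least)
  fix P assume "finite P" "P \<subseteq> sets borel" "partition_on A P"
  then show "(\<Sum>B\<in>P. ennreal (norm (\<mu> B))) \<le> variation \<mu> B"
    using assms by (intro sum_le_variation[OF m])
      (auto simp: partition_on_def disjoint_family_on_def pairwise_def disjnt_def)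
qed

text \<open>A partition of \<open>A\<close> and one of \<open>B\<close> unite to a partition of
  \<open>A \<union> B\<close>, and the two suprema are taken one at a time.\<close>

lemma variation_superadditive:
  assumes m: "vector_measure \<mu>" and AB: "A \<in> sets borel" "B \<in> sets borel" "A \<inter> B = {}"
  shows "variation \<mu> A + variation \<mu> B \<le> variation \<mu> (A \<union> B)"
proof -
  let ?S = "\<lambda>A. {P. finite P \<and> P \<subseteq> sets borel \<and> partition_on A P}"
  let ?s = "\<lambda>P. \<Sum>B\<in>P. ennreal (norm (\<mu> B))"
  have ne: "?S A \<noteq> {}" if "A \<in> sets borel" for A :: "'a set"
  proof (cases "A = {}")
    case True
    then show ?thesis by (auto simp: partition_on_empty)
  next
    case False
    then have "{A} \<in> ?S A" using that partition_on_space[OF False] by simp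
    then show ?thesis by (rule ex_in_conv[THEN iffD1, OF exI])
  qed
  have le: "?s P + ?s Q \<le> variation \<mu> (A \<union> B)" if P: "P \<in> ?S A" and Q: "Q \<in> ?S B" for P Q
  proof -
    have dj: "C \<inter> D = {}" if "C \<in> P" "D \<in> Q" for C D
      using P Q that AB(3) by (auto simp: partition_on_def)
    have "P \<inter> Q = {}"
    proof (rule ccontr)
      assume "P \<inter> Q \<noteq> {}"
      then obtain C where "C \<in> P" "C \<in> Q" by blast
      with dj[of C C] show False using P by (auto simp: partition_on_def)
    qed
    then have "?s P + ?s Q = ?s (P \<union> Q)" using P Q by (simp add: sum.union_disjoint del: sum_ennreal)
    also have "\<dots> \<le> variation \<mu> (A \<union> B)"
    proof (rule sum_le_variation[OF m])
      have "disjoint P" "disjoint Q" using P Q by (auto dest: partition_onD2)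
      then show "disjoint_family_on (\<lambda>C. C) (P \<union> Q)"
        using dj unfolding disjoint_family_on_def pairwise_def disjnt_def by (metis Int_commute Un_iff)
    qed (use P Q AB in \<open>auto simp: partition_on_def\<close>)
    finally show ?thesis .
  qed
  have le': "?s P + variation \<mu> B \<le> variation \<mu> (A \<union> B)" if P: "P \<in> ?S A" for P
  proof -
    have "?s P + variation \<mu> B = (SUP Q\<in>?S B. ?s P + ?s Q)"
      unfolding variation_def by (rule ennreal_SUP_add_right[OF ne[OF AB(2)]])
    also have "\<dots> \<le> variation \<mu> (A \<union> B)" by (rule SUP_least) (rule le[OF P])
    finally show ?thesis .
  qed
  have "variation \<mu> A + variation \<mu> B = (SUP P\<in>?S A. ?s P + variation \<mu> B)"
    unfolding variation_def[of \<mu> A] by (rule ennreal_SUP_add_left[symmetric, OF ne[OF AB(1)]])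
  also have "\<dots> \<le> variation \<mu> (A \<union> B)" by (rule SUP_least) (rule le')
  finally show ?thesis .
qed

lemma variation_empty [simp]:
  assumes "vector_measure \<mu>" shows "variation \<mu> {} = 0"
proof -
  have "variation \<mu> {} \<le> 0" by (rule variation_least) (simp add: partition_on_empty)
  then show ?thesis by simp
qed

text \<open>Superadditivity gives one inequality for finite unions, and monotonicity carries it to
  the limit. For the other one, each block of a partition of the union is cut along the sets
  \<open>A i\<close>, and the double sum is rearranged.\<close>

lemma countably_additive_variation:
  assumes m: "vector_measure \<mu>"
  shows "countably_additive (sets borel) (variation \<mu>)"
  unfolding countably_additive_def
proof (intro allI impI antisym)
  fix A :: "nat \<Rightarrow> 'a set"
  assume A: "range A \<subseteq> sets borel" "disjoint_family A" "(\<Union>i. A i) \<in> sets borel"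
  have "(\<Sum>i<n. variation \<mu> (A i)) \<le> variation \<mu> (\<Union>i<n. A i)" for n
  proof (induction n)
    case (Suc n)
    have "A i \<inter> A n = {}" if "i < n" for i using A(2) that by (simp add: disjoint_family_on_def)
    then have "(\<Union>i<n. A i) \<inter> A n = {}" by blast
    then have "variation \<mu> (\<Union>i<n. A i) + variation \<mu> (A n) \<le> variation \<mu> ((\<Union>i<n. A i) \<union> A n)"
      using A(1) by (intro variation_superadditive[OF m]) auto
    then have "(\<Sum>i<n. variation \<mu> (A i)) + variation \<mu> (A n) \<le> variation \<mu> ((\<Union>i<n. A i) \<union> A n)"
      using add_right_mono[OF Suc] by (rule order_trans[rotated])
    then show ?case by (simp add: lessThan_Suc Un_commute add.commute)
  qed (simp add: m)
  moreover have "variation \<mu> (\<Union>i<n. A i) \<le> variation \<mu> (\<Union>i. A i)" for n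
    using A by (intro variation_mono[OF m]) auto
  ultimately show "(\<Sum>i. variation \<mu> (A i)) \<le> variation \<mu> (\<Union>i. A i)"
    by (intro suminf_le_const) (auto intro: order_trans)
next
  fix A :: "nat \<Rightarrow> 'a set"
  assume A: "range A \<subseteq> sets borel" "disjoint_family A" "(\<Union>i. A i) \<in> sets borel"
  show "variation \<mu> (\<Union>i. A i) \<le> (\<Sum>i. variation \<mu> (A i))"
  proof (rule variation_least)
    fix P assume P: "finite P" "P \<subseteq> sets borel" "partition_on (\<Union>i. A i) P"
    have "ennreal (norm (\<mu> B)) \<le> (\<Sum>i. ennreal (norm (\<mu> (B \<inter> A i))))" if B: "B \<in> P" for B
    proof -
      have s: "(\<lambda>i. \<mu> (B \<inter> A i)) sums \<mu> (\<Union>i. B \<inter> A i)"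
        using A P B by (intro vector_measure_sums[OF m]) (auto simp: disjoint_family_on_def)
      have "(\<Union>i. B \<inter> A i) = B" using P B by (auto simp: partition_on_def)
      with s have "(\<lambda>n. norm (\<Sum>i<n. \<mu> (B \<inter> A i))) \<longlonglongrightarrow> norm (\<mu> B)"
        unfolding sums_def by (auto intro: tendsto_norm)
      then have lim: "(\<lambda>n. ennreal (norm (\<Sum>i<n. \<mu> (B \<inter> A i)))) \<longlonglongrightarrow> ennreal (norm (\<mu> B))"
        by (rule tendsto_ennrealI)
      have "ennreal (norm (\<Sum>i<n. \<mu> (B \<inter> A i))) \<le> (\<Sum>i. ennreal (norm (\<mu> (B \<inter> A i))))" for n
      proof -
        have "ennreal (norm (\<Sum>i<n. \<mu> (B \<inter> A i))) \<le> ennreal (\<Sum>i<n. norm (\<mu> (B \<inter> A i)))"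
          by (intro ennreal_leI norm_sum)
        also have "\<dots> = (\<Sum>i<n. ennreal (norm (\<mu> (B \<inter> A i))))" by (simp add: sum_ennreal)
        also have "\<dots> \<le> (\<Sum>i. ennreal (norm (\<mu> (B \<inter> A i))))" by (rule sum_le_suminf) auto
        finally show ?thesis .
      qed
      then show ?thesis by (intro LIMSEQ_le_const2[OF lim]) auto
    qed
    then have "(\<Sum>B\<in>P. ennreal (norm (\<mu> B))) \<le> (\<Sum>B\<in>P. \<Sum>i. ennreal (norm (\<mu> (B \<inter> A i))))"
      by (rule sum_mono)
    also have "\<dots> = (\<Sum>i. \<Sum>B\<in>P. ennreal (norm (\<mu> (B \<inter> A i))))"
      by (rule suminf_sum[symmetric]) auto
    also have "\<dots> \<le> (\<Sum>i. variation \<mu> (A i))"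
    proof (intro suminf_le sum_le_variation[OF m])
      show "disjoint_family_on (\<lambda>B. B \<inter> A n) P" for n
        using partition_onD2[OF P(3)] unfolding disjoint_family_on_def pairwise_def disjnt_def by blast
    qed (use A P in auto)
    finally show "(\<Sum>B\<in>P. ennreal (norm (\<mu> B))) \<le> (\<Sum>i. variation \<mu> (A i))" .
  qed
qed

lemma sets_variation_measure [simp, measurable_cong]: "sets (variation_measure \<mu>) = sets borel"
  using sets.sigma_sets_eq[of borel] by (simp add: variation_measure_def sets_measure_of_conv)

lemma emeasure_variation_measure:
  assumes "vector_measure \<mu>" "A \<in> sets borel"
  shows "emeasure (variation_measure \<mu>) A = variation \<mu> A"
  unfolding variation_measure_def
proof (rule emeasure_measure_of_sigma)
  show "sigma_algebra UNIV (sets borel :: 'a set set)"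
    using sets.sigma_algebra_axioms[of borel] by simp
  show "positive (sets borel) (variation \<mu>)" by (simp add: positive_def assms(1))
qed (use assms countably_additive_variation in auto)

lemma variation_scaleR:
  "variation (\<lambda>A. r *\<^sub>R \<mu> A) E = ennreal \<bar>r\<bar> * variation \<mu> E"
  unfolding variation_def SUP_mult_left_ennreal
  by (rule SUP_cong[OF refl]) (simp add: sum_distrib_left ennreal_mult del: sum_ennreal)


section \<open>The integral of a bounded function\<close>

lemma sep_meas_measurable: "f \<in> sep_meas \<Longrightarrow> f \<in> borel_measurable borel"
  by (simp add: sep_meas_def)

lemma sep_meas_diff:
  fixes f g :: "'k::topological_space \<Rightarrow> 'x::real_normed_vector"
  assumes "f \<in> sep_meas" "g \<in> sep_meas" shows "(\<lambda>t. f t - g t) \<in> sep_meas"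
  using sep_meas_add[OF assms(1) sep_meas_scaleR[OF assms(2), of "-1"]] by simp

lemma sep_meas_simple_function:
  assumes "simple_function borel s" shows "s \<in> sep_meas"
proof -
  have fin: "finite (range s)" using assms by (simp add: simple_function_def)
  moreover have "s \<in> borel_measurable borel"
    using assms by (rule borel_measurable_simple_function)
  ultimately show ?thesis
    using closure_subset[of "range s"]
    unfolding sep_meas_def separable_top_of_set_iff
    by (blast intro: finite_imp_bounded countable_finite)
qed

text \<open>Separability of the ranges is what makes the difference Borel.\<close>

lemma borel_measurable_norm_diff:
  fixes f g :: "'k::topological_space \<Rightarrow> 'x::real_normed_vector"
  assumes "f \<in> sep_meas" "g \<in> sep_meas"
  shows "(\<lambda>t. ennreal (norm (f t - g t))) \<in> borel_measurable (variation_measure \<mu>)"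
  using sep_meas_measurable[OF sep_meas_diff[OF assms]] by measurable

lemma nn_integral_norm_triangle:
  fixes f g h :: "'k::topological_space \<Rightarrow> 'x::real_normed_vector"
  assumes "f \<in> sep_meas" "g \<in> sep_meas" "h \<in> sep_meas"
  shows "(\<integral>\<^sup>+t. ennreal (norm (f t - h t)) \<partial>variation_measure \<mu>) \<le>
    (\<integral>\<^sup>+t. ennreal (norm (f t - g t)) \<partial>variation_measure \<mu>) +
    (\<integral>\<^sup>+t. ennreal (norm (g t - h t)) \<partial>variation_measure \<mu>)"
proof -
  have "(\<integral>\<^sup>+t. ennreal (norm (f t - h t)) \<partial>variation_measure \<mu>) \<le>
    (\<integral>\<^sup>+t. ennreal (norm (f t - g t)) + ennreal (norm (g t - h t)) \<partial>variation_measure \<mu>)"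
    using norm_triangle_ineq[of "f t - g t" "g t - h t" for t]
    by (intro nn_integral_mono) (simp flip: ennreal_plus)
  also have "\<dots> = (\<integral>\<^sup>+t. ennreal (norm (f t - g t)) \<partial>variation_measure \<mu>) +
    (\<integral>\<^sup>+t. ennreal (norm (g t - h t)) \<partial>variation_measure \<mu>)"
    using assms by (intro nn_integral_add borel_measurable_norm_diff)
  finally show ?thesis .
qed

text \<open>Both functions are constant on the joint fibres \<open>E (v, w)\<close>, where the
  integrals differ by \<open>\<mu> (E (v, w)) (v - w)\<close>; the norm of \<open>\<mu>\<close> on a
  fibre is at most its variation. Uniqueness and stability of the integral are drawn from this
  estimate.\<close>

lemma simple_vm_integral_diff:
  fixes s s' :: "'k::topological_space \<Rightarrow> 'x::real_normed_vector"
  assumes m: "vector_measure \<mu>"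
    and s: "simple_function borel s" and s': "simple_function borel s'"
  shows "ennreal \<bar>simple_vm_integral \<mu> s - simple_vm_integral \<mu> s'\<bar> \<le>
    (\<integral>\<^sup>+t. ennreal (norm (s t - s' t)) \<partial>variation_measure \<mu>)"
proof -
  define E where "E = (\<lambda>(v, w). s -` {v} \<inter> s' -` {w})"
  define R where "R = range s \<times> range s'"
  have fin: "finite (range s)" "finite (range s')" and R: "finite R"
    using s s' by (auto simp: simple_function_def R_def)
  have sv: "s -` {v} \<in> sets borel" "s' -` {v} \<in> sets borel" for v
    using simple_functionD(2)[OF s, of "{v}"] simple_functionD(2)[OF s', of "{v}"] by auto
  have E: "E z \<in> sets borel" for z
    using sv by (cases z) (auto simp: E_def)
  have 1: "\<mu> (s -` {v}) = (\<Sum>w\<in>range s'. \<mu> (E (v, w)))" for v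
  proof -
    have "s -` {v} = (\<Union>w\<in>range s'. E (v, w))" by (auto simp: E_def)
    moreover have "disjoint_family_on (\<lambda>w. E (v, w)) (range s')"
      by (auto simp: disjoint_family_on_def E_def)
    ultimately show ?thesis
      using vector_measure_UN[OF m fin(2), of "\<lambda>w. E (v, w)"] E by simp
  qed
  have 2: "\<mu> (s' -` {w}) = (\<Sum>v\<in>range s. \<mu> (E (v, w)))" for w
  proof -
    have "s' -` {w} = (\<Union>v\<in>range s. E (v, w))" by (auto simp: E_def)
    moreover have "disjoint_family_on (\<lambda>v. E (v, w)) (range s)"
      by (auto simp: disjoint_family_on_def E_def)
    ultimately show ?thesis
      using vector_measure_UN[OF m fin(1), of "\<lambda>v. E (v, w)"] E by simp
  qed
  have "simple_vm_integral \<mu> s = (\<Sum>(v, w)\<in>R. \<mu> (E (v, w)) v)"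
    by (simp add: simple_vm_integral_def 1 blinfun.sum_left R_def sum.cartesian_product)
  moreover have "simple_vm_integral \<mu> s' = (\<Sum>(v, w)\<in>R. \<mu> (E (v, w)) w)"
    unfolding simple_vm_integral_def 2 blinfun.sum_left R_def sum.cartesian_product[symmetric]
    by (rule sum.swap)
  ultimately have "simple_vm_integral \<mu> s - simple_vm_integral \<mu> s' = (\<Sum>(v, w)\<in>R. \<mu> (E (v, w)) (v - w))"
    by (simp add: sum_subtractf[symmetric] blinfun.diff_right case_prod_unfold)
  then have "ennreal \<bar>simple_vm_integral \<mu> s - simple_vm_integral \<mu> s'\<bar> \<le>
      ennreal (\<Sum>z\<in>R. norm (\<mu> (E z)) * norm (fst z - snd z))"
    using norm_blinfun[of "\<mu> (E z)" "fst z - snd z" for z]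
    by (auto intro!: ennreal_leI order_trans[OF sum_abs] sum_mono simp: case_prod_unfold)
  also have "\<dots> = (\<Sum>z\<in>R. ennreal (norm (fst z - snd z)) * ennreal (norm (\<mu> (E z))))"
    by (simp add: sum_ennreal[symmetric] ennreal_mult mult.commute)
  also have "\<dots> \<le> (\<Sum>z\<in>R. ennreal (norm (fst z - snd z)) * emeasure (variation_measure \<mu>) (E z))"
    using norm_le_variation[OF m E] by (intro sum_mono mult_left_mono) (auto simp: emeasure_variation_measure m E)
  also have "\<dots> = (\<integral>\<^sup>+t. (\<Sum>z\<in>R. ennreal (norm (fst z - snd z)) * indicator (E z) t) \<partial>variation_measure \<mu>)"
    using E by (simp add: nn_integral_sum nn_integral_cmult_indicator)
  also have "\<dots> = (\<integral>\<^sup>+t. ennreal (norm (s t - s' t)) \<partial>variation_measure \<mu>)"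
  proof (rule nn_integral_cong)
    fix t
    have "(\<Sum>z\<in>R. ennreal (norm (fst z - snd z)) * indicator (E z) t) =
        (\<Sum>z\<in>{(s t, s' t)}. ennreal (norm (fst z - snd z)) * indicator (E z) t)"
      using R by (intro sum.mono_neutral_right) (auto simp: R_def E_def indicator_def)
    then show "(\<Sum>z\<in>R. ennreal (norm (fst z - snd z)) * indicator (E z) t) = ennreal (norm (s t - s' t))"
      by (simp add: E_def)
  qed
  finally show ?thesis .
qed

text \<open>Distances are compared along the chain \<open>s i\<close>, \<open>f\<close>,
  \<open>g\<close>, \<open>s' i\<close>, whose outer links vanish in the limit. The case
  \<open>f = g\<close> is uniqueness of the integral.\<close>

lemma has_vm_integral_diff:
  fixes f g :: "'k::topological_space \<Rightarrow> 'x::real_normed_vector"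
  assumes m: "vector_measure \<mu>" and f: "f \<in> sep_meas" and g: "g \<in> sep_meas"
    and I: "has_vm_integral \<mu> f I" and J: "has_vm_integral \<mu> g J"
  shows "ennreal \<bar>I - J\<bar> \<le> (\<integral>\<^sup>+t. ennreal (norm (f t - g t)) \<partial>variation_measure \<mu>)"
proof -
  let ?d = "\<lambda>f g. \<integral>\<^sup>+t. ennreal (norm (f t - g t)) \<partial>variation_measure \<mu>"
  obtain s where s: "\<And>i. simple_function borel (s i)" "(\<lambda>i. ?d f (s i)) \<longlonglongrightarrow> 0"
      "(\<lambda>i. simple_vm_integral \<mu> (s i)) \<longlonglongrightarrow> I"
    using I by (auto simp: has_vm_integral_def)
  obtain s' where s': "\<And>i. simple_function borel (s' i)" "(\<lambda>i. ?d g (s' i)) \<longlonglongrightarrow> 0"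
      "(\<lambda>i. simple_vm_integral \<mu> (s' i)) \<longlonglongrightarrow> J"
    using J by (auto simp: has_vm_integral_def)
  have "ennreal \<bar>simple_vm_integral \<mu> (s i) - simple_vm_integral \<mu> (s' i)\<bar> \<le>
      ?d f (s i) + (?d f g + ?d g (s' i))" for i
  proof -
    have si: "s i \<in> sep_meas" "s' i \<in> sep_meas"
      using s(1) s'(1) by (auto intro: sep_meas_simple_function)
    have "ennreal \<bar>simple_vm_integral \<mu> (s i) - simple_vm_integral \<mu> (s' i)\<bar> \<le> ?d (s i) (s' i)"
      by (rule simple_vm_integral_diff[OF m s(1) s'(1)])
    also have "\<dots> \<le> ?d (s i) f + ?d f (s' i)" by (rule nn_integral_norm_triangle[OF si(1) f si(2)])
    also have "\<dots> \<le> ?d (s i) f + (?d f g + ?d g (s' i))"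
      by (intro add_left_mono nn_integral_norm_triangle f g si)
    finally show ?thesis by (simp add: norm_minus_commute)
  qed
  moreover have "(\<lambda>i. ennreal \<bar>simple_vm_integral \<mu> (s i) - simple_vm_integral \<mu> (s' i)\<bar>) \<longlonglongrightarrow> ennreal \<bar>I - J\<bar>"
    by (intro tendsto_ennrealI tendsto_rabs tendsto_diff s s')
  moreover have "(\<lambda>i. ?d f (s i) + (?d f g + ?d g (s' i))) \<longlonglongrightarrow> 0 + (?d f g + 0)"
    by (intro tendsto_add tendsto_const s s')
  ultimately show ?thesis
    using LIMSEQ_le by fastforce
qed

lemma has_vm_integral_unique:
  fixes f :: "'k::topological_space \<Rightarrow> 'x::real_normed_vector"
  assumes "vector_measure \<mu>" "f \<in> sep_meas" "has_vm_integral \<mu> f I" "has_vm_integral \<mu> f J"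
  shows "I = J"
  using has_vm_integral_diff[OF assms(1,2,2,3,4)] by simp

lemma vm_integral_eq:
  fixes f :: "'k::topological_space \<Rightarrow> 'x::real_normed_vector"
  assumes "vector_measure \<mu>" "f \<in> sep_meas" "has_vm_integral \<mu> f I"
  shows "vm_integral \<mu> f = I"
  unfolding vm_integral_def using assms has_vm_integral_unique by blast

text \<open>Simple functions that approximate \<open>h\<close> in mean also approximate
  \<open>f\<close>; the two errors add up to \<open>2 * e\<close>, and the choices for
  \<open>e = inverse (Suc n)\<close> form a defining sequence for the integral.\<close>

lemma has_vm_integral_approx:
  fixes f :: "'k::topological_space \<Rightarrow> 'x::real_normed_vector"
  assumes f: "f \<in> sep_meas"
    and appr: "\<And>e::real. 0 < e \<Longrightarrow> \<exists>h I'. h \<in> sep_meas \<and> has_vm_integral \<mu> h I' \<and> \<bar>I' - I\<bar> \<le> e \<and>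
      (\<integral>\<^sup>+t. ennreal (norm (f t - h t)) \<partial>variation_measure \<mu>) \<le> ennreal e"
  shows "has_vm_integral \<mu> f I"
proof -
  let ?d = "\<lambda>f g. \<integral>\<^sup>+t. ennreal (norm (f t - g t)) \<partial>variation_measure \<mu>"
  have "\<exists>s. simple_function borel s \<and> ?d f s \<le> ennreal (2 * e) \<and> \<bar>simple_vm_integral \<mu> s - I\<bar> \<le> 2 * e"
    if e: "0 < e" for e
  proof -
    obtain h I' where h: "h \<in> sep_meas" "has_vm_integral \<mu> h I'" "\<bar>I' - I\<bar> \<le> e" "?d f h \<le> ennreal e"
      using appr[OF e] by blast
    obtain s where s: "\<And>i. simple_function borel (s i)" "(\<lambda>i. ?d h (s i)) \<longlonglongrightarrow> 0"
      "(\<lambda>i. simple_vm_integral \<mu> (s i)) \<longlonglongrightarrow> I'"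
      using h(2) by (auto simp: has_vm_integral_def)
    have "\<forall>\<^sub>F i in sequentially. ?d h (s i) < ennreal e"
      using e by (intro order_tendstoD(2)[OF s(2)]) simp
    moreover have "\<forall>\<^sub>F i in sequentially. dist (simple_vm_integral \<mu> (s i)) I' < e"
      using s(3) e by (rule tendstoD)
    ultimately have "\<forall>\<^sub>F i in sequentially. ?d h (s i) < ennreal e \<and> dist (simple_vm_integral \<mu> (s i)) I' < e"
      by (rule eventually_conj)
    then obtain i where i: "?d h (s i) < ennreal e" "dist (simple_vm_integral \<mu> (s i)) I' < e"
      by (auto simp: eventually_sequentially)
    have "?d f (s i) \<le> ?d f h + ?d h (s i)"
      by (intro nn_integral_norm_triangle f h sep_meas_simple_function s)
    also have "\<dots> \<le> ennreal e + ennreal e" using h(4) i(1) by (intro add_mono) auto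
    also have "\<dots> = ennreal (2 * e)" using e by (simp flip: ennreal_plus)
    finally have "?d f (s i) \<le> ennreal (2 * e)" .
    moreover have "\<bar>simple_vm_integral \<mu> (s i) - I\<bar> \<le> 2 * e"
      using i(2) h(3) by (simp add: dist_real_def)
    ultimately show ?thesis using s(1) by blast
  qed
  then have "\<forall>n. \<exists>s. simple_function borel s \<and> ?d f s \<le> ennreal (2 * inverse (Suc n)) \<and>
      \<bar>simple_vm_integral \<mu> s - I\<bar> \<le> 2 * inverse (Suc n)"
    by simp
  then obtain s where s: "\<And>n. simple_function borel (s n)" "\<And>n. ?d f (s n) \<le> ennreal (2 * inverse (Suc n))"
      "\<And>n. \<bar>simple_vm_integral \<mu> (s n) - I\<bar> \<le> 2 * inverse (Suc n)"
    by metis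
  have lim: "(\<lambda>n. 2 * inverse (real (Suc n))) \<longlonglongrightarrow> 0"
    using tendsto_mult_right_zero[OF LIMSEQ_inverse_real_of_nat] by blast
  have "(\<lambda>n. ?d f (s n)) \<longlonglongrightarrow> 0"
    using tendsto_ennrealI[OF lim] s(2)
    by (intro tendsto_sandwich[of "\<lambda>_. 0" "\<lambda>n. ?d f (s n)" sequentially "\<lambda>n. ennreal (2 * inverse (Suc n))" 0]) auto
  moreover have "(\<lambda>n. simple_vm_integral \<mu> (s n)) \<longlonglongrightarrow> I"
    using s(3) by (intro LIM_zero_cancel[OF Lim_null_comparison[OF _ lim]]) auto
  ultimately show ?thesis
    using s(1) f unfolding has_vm_integral_def by (auto simp: sep_meas_measurable)
qed

lemma has_vm_integral_simple:
  assumes "simple_function borel s"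
  shows "has_vm_integral \<mu> s (simple_vm_integral \<mu> s)"
  unfolding has_vm_integral_def
  using assms borel_measurable_simple_function[OF assms] by (auto intro!: exI[of _ "\<lambda>_. s"])

lemma has_vm_integral_indicator:
  assumes m: "vector_measure \<mu>" and A: "A \<in> sets borel"
  shows "has_vm_integral \<mu> (\<lambda>t. indicator A t *\<^sub>R x) (\<mu> A x)"
proof -
  let ?s = "\<lambda>t. indicator A t *\<^sub>R x"
  have s: "simple_function borel ?s"
    using A by (intro simple_function_compose1[of _ _ "\<lambda>r. r *\<^sub>R x"] simple_function_indicator) auto
  then have fin: "finite (range ?s)" by (simp add: simple_function_def)
  have "simple_vm_integral \<mu> ?s = \<mu> A x"
  \<comment> \<open>For \<open>x = 0\<close> the fibre over \<open>x\<close> is the whole space, and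
    for \<open>A = {}\<close> a nonzero \<open>x\<close> is not a value; in these cases both sides
    are zero.\<close>
  proof (cases "x = 0 \<or> A = {}")
    case True
    then show ?thesis
      by (auto simp: simple_vm_integral_def vector_measure_empty[OF m] intro!: sum.neutral)
  next
    case False
    have "(\<Sum>v\<in>range ?s. \<mu> (?s -` {v}) v) = (\<Sum>v\<in>{x}. \<mu> (?s -` {v}) v)"
    proof (rule sum.mono_neutral_right[OF fin])
      obtain t where "t \<in> A" using False by blast
      then show "{x} \<subseteq> range ?s" by (auto intro!: image_eqI[of _ _ t])
      show "\<forall>v\<in>range ?s - {x}. \<mu> (?s -` {v}) v = 0" by (auto simp: indicator_def)
    qed
    moreover have "?s -` {x} = A" using False by (auto simp: indicator_def of_bool_def split: if_splits)
    ultimately show ?thesis by (simp add: simple_vm_integral_def)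
  qed
  with has_vm_integral_simple[OF s, of \<mu>] show ?thesis by simp
qed

lemma nn_integral_norm_diff_le:
  fixes f g :: "'k::topological_space \<Rightarrow> 'x::real_normed_vector"
  assumes m: "vector_measure \<mu>" and C: "C \<in> sets borel"
    and eq: "\<And>t. t \<in> C \<Longrightarrow> f t = g t" and bound: "\<And>t. norm (f t) \<le> M" "\<And>t. norm (g t) \<le> M"
  shows "(\<integral>\<^sup>+t. ennreal (norm (f t - g t)) \<partial>variation_measure \<mu>) \<le> ennreal (2 * M) * variation \<mu> (- C)"
proof -
  have "norm (f t - g t) \<le> 2 * M" for t
    using norm_triangle_ineq4[of "f t" "g t"] bound[of t] by linarith
  then have "(\<integral>\<^sup>+t. ennreal (norm (f t - g t)) \<partial>variation_measure \<mu>) \<le>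
      (\<integral>\<^sup>+t. ennreal (2 * M) * indicator (- C) t \<partial>variation_measure \<mu>)"
    using eq by (intro nn_integral_mono) (auto simp: indicator_def intro!: ennreal_leI)
  also have "\<dots> = ennreal (2 * M) * variation \<mu> (- C)"
    using C by (simp add: nn_integral_cmult_indicator emeasure_variation_measure[OF m] borel_comp)
  finally show ?thesis .
qed


section \<open>Lusin's theorem\<close>

text \<open>The semivariation, a supremum of measures, is only countably subadditive. This notion
  covers it together with the variations and their sums, so that one proof of Lusin's theorem serves
  them all.\<close>

definition regular_submeasure :: "('k::topological_space set \<Rightarrow> ennreal) \<Rightarrow> bool" where
  "regular_submeasure \<nu> \<longleftrightarrow> \<nu> {} = 0 \<and>
     (\<forall>A\<in>sets borel. \<forall>B\<in>sets borel. A \<subseteq> B \<longrightarrow> \<nu> A \<le> \<nu> B) \<and>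
     (\<forall>A :: nat \<Rightarrow> 'k set. range A \<subseteq> sets borel \<longrightarrow> \<nu> (\<Union>i. A i) \<le> (\<Sum>i. \<nu> (A i))) \<and>
     (\<forall>A\<in>sets borel. \<forall>e>0. \<exists>C. compact C \<and> C \<subseteq> A \<and> \<nu> (A - C) < ennreal e)"

lemma regular_submeasure_mono:
  "regular_submeasure \<nu> \<Longrightarrow> A \<in> sets borel \<Longrightarrow> B \<in> sets borel \<Longrightarrow> A \<subseteq> B \<Longrightarrow> \<nu> A \<le> \<nu> B"
  by (simp add: regular_submeasure_def)

lemma regular_submeasure_UN:
  "regular_submeasure \<nu> \<Longrightarrow> (\<And>i. A i \<in> sets borel) \<Longrightarrow> \<nu> (\<Union>i::nat. A i) \<le> (\<Sum>i. \<nu> (A i))"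
  unfolding regular_submeasure_def by blast

lemma regular_submeasure_Un:
  assumes r: "regular_submeasure \<nu>" and "A \<in> sets borel" "B \<in> sets borel"
  shows "\<nu> (A \<union> B) \<le> \<nu> A + \<nu> B"
proof -
  have "\<nu> {} = 0" using r by (simp add: regular_submeasure_def)
  then have "(\<Sum>i. \<nu> (binaryset A B i)) = \<nu> A + \<nu> B" by (rule suminf_binaryset_eq)
  moreover have "\<nu> (\<Union>i. binaryset A B i) \<le> (\<Sum>i. \<nu> (binaryset A B i))"
    using assms by (intro regular_submeasure_UN) (auto simp: binaryset_def)
  ultimately show ?thesis by (simp add: UN_binaryset_eq)
qed

lemma regular_submeasure_inner:
  assumes "regular_submeasure \<nu>" "A \<in> sets borel" "0 < e"
  obtains C where "compact C" "C \<subseteq> A" "\<nu> (A - C) < ennreal e"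
  using assms unfolding regular_submeasure_def by blast

text \<open>Inner regularity is applied to \<open>A\<close> and to its complement, with error
  \<open>e / 2\<close> each. Relative to \<open>C \<union> D\<close> the set \<open>A\<close> is
  both open and closed, which is what Lusin's theorem exploits.\<close>

lemma regular_submeasure_two_sided:
  fixes \<nu> :: "'k::t2_space set \<Rightarrow> ennreal"
  assumes r: "regular_submeasure \<nu>" and A: "A \<in> sets borel" and e: "0 < (e::real)"
  shows "\<exists>C D. compact C \<and> compact D \<and> C \<subseteq> A \<and> D \<subseteq> - A \<and> \<nu> (- (C \<union> D)) \<le> ennreal e"
proof -
  have e2: "0 < e / 2" using e by simp
  obtain C where C: "compact C" "C \<subseteq> A" "\<nu> (A - C) < ennreal (e / 2)"
    by (rule regular_submeasure_inner[OF r A e2])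
  have A': "- A \<in> sets borel" using A by (simp add: borel_comp)
  obtain D where D: "compact D" "D \<subseteq> - A" "\<nu> (- A - D) < ennreal (e / 2)"
    by (rule regular_submeasure_inner[OF r A' e2])
  have "C \<in> sets borel" "D \<in> sets borel"
    using C D by (auto intro: borel_closed compact_imp_closed)
  then have "\<nu> ((A - C) \<union> (- A - D)) \<le> \<nu> (A - C) + \<nu> (- A - D)"
    using A A' by (intro regular_submeasure_Un[OF r]) auto
  also have "\<dots> \<le> ennreal (e / 2) + ennreal (e / 2)"
    using C D by (intro add_mono) auto
  also have "\<dots> = ennreal e" using e by (simp flip: ennreal_plus)
  also have "(A - C) \<union> (- A - D) = - (C \<union> D)" using C D by blast
  finally show ?thesis using C D by blast
qed

text \<open>As the ranges are separable, continuity of all \<open>f n\<close> at once is tested by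
  countably many sets, the preimages of balls about dense points. Each is made relatively open on a
  compact set, with error \<open>e * (1/2) ^ Suc i\<close>, and the intersection of these compact
  sets loses at most \<open>e\<close>.\<close>

theorem lusin_sequence:
  fixes f :: "nat \<Rightarrow> ('k::t2_space, 'x::real_normed_vector) bsig"
  assumes K: "compact (UNIV :: 'k set)" and r: "regular_submeasure \<nu>" and e: "0 < (e::real)"
  obtains C where "compact C" "\<nu> (- C) \<le> ennreal e" "\<And>n. continuous_on C (apply_bsig (f n))"
proof -
  have "\<exists>D. countable D \<and> range (f n) \<subseteq> closure D" for n
    using apply_bsig[of "f n"] by (simp add: sep_meas_def separable_top_of_set_iff)
  then obtain D where D: "\<And>n. countable (D n)" "\<And>n. range (f n) \<subseteq> closure (D n)" by metis
  have Dne: "D n \<noteq> {}" for n using D(2)[of n] by auto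
  define d where "d n = from_nat_into (D n)" for n
  have d: "range (d n) = D n" for n unfolding d_def using Dne D(1) by (rule range_from_nat_into)
  define A where "A n j l = f n -` ball (d n j) (inverse (real (Suc l)))" for n j l
  have A: "A n j l \<in> sets borel" for n j l
    using measurable_sets[of "apply_bsig (f n)" borel borel "ball (d n j) (inverse (real (Suc l)))"]
      apply_bsig[of "f n"] by (simp add: A_def sep_meas_def)
  \<comment> \<open>One index runs over all functions, centres and radii, so that the errors form a
    single geometric series.\<close>
  define B where "B i = (case from_nat i of (n, j, l) \<Rightarrow> A n j l)" for i
  have Bs: "B i \<in> sets borel" for i by (simp add: B_def A split: prod.split)
  have "\<exists>C C'. compact C \<and> compact C' \<and> C \<subseteq> B i \<and> C' \<subseteq> - B i \<and> \<nu> (- (C \<union> C')) \<le> ennreal (e * (1/2) ^ Suc i)" for i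
    using e by (intro regular_submeasure_two_sided[OF r Bs]) simp
  then obtain P Q where PQ: "\<And>i. compact (P i)" "\<And>i. compact (Q i)" "\<And>i. P i \<subseteq> B i" "\<And>i. Q i \<subseteq> - B i"
      "\<And>i. \<nu> (- (P i \<union> Q i)) \<le> ennreal (e * (1/2) ^ Suc i)"
    by metis
  define C where "C = (\<Inter>i. P i \<union> Q i)"
  have PQs: "closed (P i \<union> Q i)" for i by (intro closed_Un compact_imp_closed PQ)
  have "closed C" unfolding C_def using PQs by blast
  then have "compact C" using compact_Int_closed[OF K] by simp
  moreover have "\<nu> (- C) \<le> ennreal e"
  proof -
    have "- C = (\<Union>i. - (P i \<union> Q i))" by (auto simp: C_def)
    then have "\<nu> (- C) \<le> (\<Sum>i. \<nu> (- (P i \<union> Q i)))"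
      using regular_submeasure_UN[OF r, of "\<lambda>i. - (P i \<union> Q i)"] borel_comp[OF borel_closed[OF PQs]] by simp
    also have "\<dots> \<le> (\<Sum>i. ennreal (e * (1/2) ^ Suc i))"
      by (intro suminf_le PQ) auto
    also have "\<dots> = ennreal (e * 1)"
      using e by (intro suminf_ennreal_eq sums_mult power_half_series) auto
    finally show ?thesis by simp
  qed
  moreover have "continuous_on C (apply_bsig (f n))" for n
    unfolding continuous_on_topological
  proof (intro ballI allI impI)
    fix t U assume t: "t \<in> C" and U: "open U" "f n t \<in> U"
    then obtain r where r: "0 < r" "ball (f n t) r \<subseteq> U" by (auto simp: open_contains_ball)
    \<comment> \<open>With a radius below \<open>r / 2\<close>, a ball about a dense point that
      contains \<open>f n t\<close> lies inside \<open>ball (f n t) r\<close>.\<close>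
    obtain l where l: "inverse (real (Suc l)) < r / 2" using reals_Archimedean[of "r/2"] r by auto
    have "f n t \<in> closure (D n)" using D(2) by blast
    then obtain j where j: "dist (d n j) (f n t) < inverse (real (Suc l))"
      using closure_approachable[of "f n t" "D n"] d[of n]
      by (metis imageE inverse_positive_iff_positive of_nat_0_less_iff zero_less_Suc)
    define i where "i = to_nat (n, j, l)"
    have Bi: "B i = A n j l" by (simp add: B_def i_def)
    have "t \<in> B i" using j by (simp add: Bi A_def)
    then have "t \<in> - Q i" using PQ(4)[of i] by blast
    \<comment> \<open>A point of \<open>C\<close> lies in \<open>P i\<close> or in
      \<open>Q i\<close>, so avoiding the closed set \<open>Q i\<close> forces it into
      \<open>B i\<close>. Hence \<open>- Q i\<close> is the required neighbourhood.\<close>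
    moreover have "f n s \<in> U" if "s \<in> C" "s \<in> - Q i" for s
    proof -
      have "s \<in> P i" using that by (auto simp: C_def)
      then have "dist (d n j) (f n s) < inverse (real (Suc l))"
        using PQ(3)[of i] by (auto simp: Bi A_def)
      then have "dist (f n t) (f n s) < r"
        using j l dist_triangle3[of "f n t" "f n s" "d n j"] by linarith
      then show ?thesis using r by auto
    qed
    moreover have "open (- Q i)" using PQ(2) by (simp add: compact_imp_closed open_Compl)
    ultimately show "\<exists>V. open V \<and> t \<in> V \<and> (\<forall>s\<in>C. s \<in> V \<longrightarrow> f n s \<in> U)" by blast
  qed
  ultimately show ?thesis using that by blast
qed


section \<open>Simultaneous linear extension from a compact subset\<close>

lemma urysohn_point:
  fixes c :: "'k::t2_space"
  assumes K: "compact (UNIV :: 'k set)" and U: "open U" "c \<in> U"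
  obtains g :: "'k \<Rightarrow> real" where "continuous_on UNIV g" "\<And>t. 0 \<le> g t" "g c = 1" "\<And>t. t \<notin> U \<Longrightarrow> g t = 0"
proof -
  have "normal_space (euclidean :: 'k topology)"
  proof (rule compact_Hausdorff_or_regular_imp_normal_space)
    have "Hausdorff_space (euclidean :: 'k topology)"
      unfolding Hausdorff_space_def disjnt_def using hausdorff by auto
    then show "Hausdorff_space (euclidean :: 'k topology) \<or> regular_space (euclidean :: 'k topology)" ..
  qed (use K in \<open>simp add: compact_space_def\<close>)
  moreover have "closedin euclidean (- U)" "closedin euclidean {c}" "disjnt (- U) {c}"
    using U by (auto simp: disjnt_def closed_Compl)
  ultimately obtain g :: "'k \<Rightarrow> real" where g: "continuous_map euclidean (top_of_set {0..1}) g"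
      "g ` (- U) \<subseteq> {0}" "g ` {c} \<subseteq> {1}"
    using Urysohn_lemma[of euclidean "- U" "{c}" 0 1] by (metis zero_le_one)
  then show ?thesis
    by (intro that[of g]) (auto simp: continuous_map_in_subtopology)
qed

text \<open>Each \<open>c\<close> in \<open>C\<close> has a neighbourhood on whose part in
  \<open>C\<close> the first \<open>j\<close> functions vary by less than \<open>\<delta>\<close> in
  total; Urysohn's lemma puts a peak there, and compactness selects finitely many peaks. Closeness
  is claimed on \<open>C\<close> alone, where the \<open>f n\<close> are continuous.\<close>

lemma partition_of_unity_near:
  fixes f :: "nat \<Rightarrow> 'k::t2_space \<Rightarrow> 'x::real_normed_vector"
  assumes K: "compact (UNIV :: 'k set)" and C: "compact C"
    and f: "\<And>n. continuous_on C (f n)" and \<delta>: "0 < \<delta>"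
  obtains I and g :: "'k \<Rightarrow> 'k \<Rightarrow> real" where "finite I" "I \<subseteq> C"
    "\<And>c. c \<in> I \<Longrightarrow> continuous_on UNIV (g c)" "\<And>c t. c \<in> I \<Longrightarrow> 0 \<le> g c t"
    "\<And>t. (\<Sum>c\<in>I. g c t) \<le> 1" "\<And>t. t \<in> C \<Longrightarrow> (\<Sum>c\<in>I. g c t) = 1"
    "\<And>c t. c \<in> I \<Longrightarrow> t \<in> C \<Longrightarrow> g c t \<noteq> 0 \<Longrightarrow> (\<Sum>n<j. norm (f n c - f n t)) < \<delta>"
proof -
  define Q where "Q c h \<longleftrightarrow> continuous_on UNIV h \<and> (\<forall>t. (0::real) \<le> h t) \<and> h c = 1 \<and>
      (\<forall>t\<in>C. h t \<noteq> 0 \<longrightarrow> (\<Sum>n<j. norm (f n c - f n t)) < \<delta>)" for c h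
  have "\<exists>h. Q c h" if c: "c \<in> C" for c
  proof -
    have "continuous_on C (\<lambda>t. \<Sum>n<j. norm (f n c - f n t))"
      using f by (intro continuous_intros)
    moreover have "open {..<\<delta>}" by simp
    ultimately obtain U where U: "open U" "U \<inter> C = (\<lambda>t. \<Sum>n<j. norm (f n c - f n t)) -` {..<\<delta>} \<inter> C"
      unfolding continuous_on_open_invariant by blast
    have "c \<in> U" using U(2) c \<delta> by auto
    then obtain g :: "'k \<Rightarrow> real" where g: "continuous_on UNIV g" "\<And>t. 0 \<le> g t" "g c = 1" "\<And>t. t \<notin> U \<Longrightarrow> g t = 0"
      by (rule urysohn_point[OF K U(1)]) blast
    have "(\<Sum>n<j. norm (f n c - f n t)) < \<delta>" if "t \<in> C" "g t \<noteq> 0" for t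
    proof -
      have "t \<in> U \<inter> C" using g(4) that by blast
      then show ?thesis using U(2) by auto
    qed
    then show ?thesis using g unfolding Q_def by blast
  qed
  then obtain h where "\<And>c. c \<in> C \<Longrightarrow> Q c (h c)" by metis
  then have h: "\<And>c. c \<in> C \<Longrightarrow> continuous_on UNIV (h c)" "\<And>c t. c \<in> C \<Longrightarrow> (0::real) \<le> h c t"
      "\<And>c. c \<in> C \<Longrightarrow> h c c = 1"
      "\<And>c t. c \<in> C \<Longrightarrow> t \<in> C \<Longrightarrow> h c t \<noteq> 0 \<Longrightarrow> (\<Sum>n<j. norm (f n c - f n t)) < \<delta>"
    unfolding Q_def by blast+
  have op: "open {t. h c t > 1/2}" if "c \<in> C" for c
    using h(1)[OF that] by (intro open_Collect_less) (auto intro: continuous_intros)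
  obtain I where I: "I \<subseteq> C" "finite I" "C \<subseteq> (\<Union>c\<in>I. {t. h c t > 1/2})"
  proof (rule compactE_image[OF C, of C "\<lambda>c. {t. h c t > 1/2}"])
    show "C \<subseteq> (\<Union>c\<in>C. {t. h c t > 1/2})" using h(3) by force
  qed (use op in auto)
  \<comment> \<open>On \<open>C\<close> some peak exceeds 1/2, so \<open>G\<close> is the sum of the
    peaks and the quotients add up to 1. Elsewhere the floor 1/2 keeps the division continuous and
    the total at most 1.\<close>
  define G where "G t = max (1/2) (\<Sum>c\<in>I. h c t)" for t
  have G: "0 < G t" for t by (simp add: G_def less_max_iff_disj)
  have sum_eq: "(\<Sum>c\<in>I. h c t / G t) = (\<Sum>c\<in>I. h c t) / G t" for t
    by (simp add: sum_divide_distrib)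
  show ?thesis
  proof (rule that[of I "\<lambda>c t. h c t / G t"])
    show "continuous_on UNIV (\<lambda>t. h c t / G t)" if "c \<in> I" for c
    proof (intro continuous_on_divide ballI)
      show "continuous_on UNIV G" unfolding G_def using h(1) I(1) by (intro continuous_intros) auto
    qed (use h(1) I(1) that G in \<open>auto simp: less_imp_neq[symmetric]\<close>)
    show "0 \<le> h c t / G t" if "c \<in> I" for c t
      using h(2) I(1) that G[of t] by (intro divide_nonneg_pos) auto
    show "(\<Sum>c\<in>I. h c t / G t) \<le> 1" for t
      unfolding sum_eq using G[of t] by (simp add: divide_le_eq) (simp add: G_def)
    show "(\<Sum>c\<in>I. h c t / G t) = 1" if t: "t \<in> C" for t
    proof -
      obtain c where c: "c \<in> I" "h c t > 1/2" using I(3) t by auto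
      have "h c t \<le> (\<Sum>c\<in>I. h c t)" using I h(2) c by (intro member_le_sum) auto
      then have "G t = (\<Sum>c\<in>I. h c t)" using c by (simp add: G_def)
      then show ?thesis unfolding sum_eq using G[of t] by simp
    qed
    show "(\<Sum>n<j. norm (f n c - f n t)) < \<delta>" if "c \<in> I" "t \<in> C" "h c t / G t \<noteq> 0" for c t
      using that I(1) by (intro h(4)) auto
  qed (use I in auto)
qed

lemma Bcontfun_apply:
  assumes "continuous_on UNIV f" "\<And>t. norm (f t) \<le> M"
  shows "apply_bcontfun (Bcontfun f) = (f :: 'k::topological_space \<Rightarrow> 'x::real_normed_vector)"
  using assms by (intro Bcontfun_inverse) (auto simp: bcontfun_def bounded_iff)

text \<open>Sampling at finitely many points with the weights \<open>g c\<close> is linear and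
  contractive on all of \<open>B(\<Sigma>,X)\<close>. At \<open>t\<close> in \<open>C\<close> it
  forms a convex combination of values \<open>f n c\<close> close to \<open>f n t\<close>. The sum
  over \<open>n < j\<close> makes one operator serve the first \<open>j\<close> functions.\<close>

lemma averaging_operator:
  fixes f :: "nat \<Rightarrow> ('k::t2_space, 'x::real_normed_vector) bsig"
  assumes K: "compact (UNIV :: 'k set)" and C: "compact C"
    and f: "\<And>n. continuous_on C (apply_bsig (f n))" and \<delta>: "0 < \<delta>"
  obtains P :: "('k, 'x) bsig \<Rightarrow> ('k \<Rightarrow>\<^sub>C 'x)" where "linear P"
    "\<And>u t. norm (apply_bcontfun (P u) t) \<le> norm u"
    "\<And>t. t \<in> C \<Longrightarrow> (\<Sum>n<j. norm (apply_bcontfun (P (f n)) t - apply_bsig (f n) t)) \<le> \<delta>"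
proof -
  obtain I and g :: "'k \<Rightarrow> 'k \<Rightarrow> real" where I: "finite I" "I \<subseteq> C"
    and g: "\<And>c. c \<in> I \<Longrightarrow> continuous_on UNIV (g c)" "\<And>c t. c \<in> I \<Longrightarrow> 0 \<le> g c t"
    "\<And>t. (\<Sum>c\<in>I. g c t) \<le> 1" "\<And>t. t \<in> C \<Longrightarrow> (\<Sum>c\<in>I. g c t) = 1"
    "\<And>c t. c \<in> I \<Longrightarrow> t \<in> C \<Longrightarrow> g c t \<noteq> 0 \<Longrightarrow> (\<Sum>n<j. norm (f n c - f n t)) < \<delta>"
    by (rule partition_of_unity_near[where f = "\<lambda>n. apply_bsig (f n)" and j = j, OF K C f \<delta>]) blast
  define P :: "('k, 'x) bsig \<Rightarrow> ('k \<Rightarrow>\<^sub>C 'x)"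
    where "P u = Bcontfun (\<lambda>t. \<Sum>c\<in>I. g c t *\<^sub>R u c)" for u
  have bound: "norm (\<Sum>c\<in>I. g c t *\<^sub>R u c) \<le> norm u" for u :: "('k, 'x) bsig" and t
  proof -
    have "norm (\<Sum>c\<in>I. g c t *\<^sub>R u c) \<le> (\<Sum>c\<in>I. g c t * norm u)"
      using g(2) norm_apply_bsig_le[of u] by (intro sum_norm_le) (auto intro: mult_left_mono)
    also have "\<dots> \<le> 1 * norm u"
      unfolding sum_distrib_right[symmetric] using g(3) by (intro mult_right_mono) auto
    finally show ?thesis by simp
  qed
  have P: "apply_bcontfun (P u) t = (\<Sum>c\<in>I. g c t *\<^sub>R u c)" for u t
    unfolding P_def using g(1) bound[of _ u]
    by (subst Bcontfun_apply[where M = "norm u"]) (auto intro!: continuous_intros)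
  show ?thesis
  proof (rule that[of P])
    show "linear P"
      by (rule linearI; rule bcontfun_eqI)
        (simp_all add: P plus_bcontfun.rep_eq scaleR_bcontfun.rep_eq plus_bsig.rep_eq scaleR_bsig.rep_eq
          algebra_simps sum.distrib scaleR_sum_right)
    show "norm (apply_bcontfun (P u) t) \<le> norm u" for u t by (simp add: P bound)
    fix t assume t: "t \<in> C"
    have "norm (apply_bcontfun (P (f n)) t - f n t) \<le> (\<Sum>c\<in>I. g c t * norm (f n c - f n t))" for n
    proof -
      have "(\<Sum>c\<in>I. g c t *\<^sub>R f n t) = f n t"
        using g(4)[OF t] by (simp flip: scaleR_sum_left)
      then have "apply_bcontfun (P (f n)) t - f n t = (\<Sum>c\<in>I. g c t *\<^sub>R (f n c - f n t))"
        by (simp add: P scaleR_diff_right sum_subtractf)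
      then show ?thesis using g(2) by (auto intro!: sum_norm_le)
    qed
    then have "(\<Sum>n<j. norm (apply_bcontfun (P (f n)) t - f n t)) \<le>
        (\<Sum>n<j. \<Sum>c\<in>I. g c t * norm (f n c - f n t))"
      by (rule sum_mono)
    also have "\<dots> = (\<Sum>c\<in>I. g c t * (\<Sum>n<j. norm (f n c - f n t)))"
      by (subst sum.swap) (simp add: sum_distrib_left)
    also have "\<dots> \<le> (\<Sum>c\<in>I. g c t * \<delta>)"
    proof (rule sum_mono)
      fix c assume c: "c \<in> I"
      show "g c t * (\<Sum>n<j. norm (f n c - f n t)) \<le> g c t * \<delta>"
        using g(2)[OF c, of t] g(5)[OF c t] by (cases "g c t = 0") (auto intro: mult_left_mono)
    qed
    also have "\<dots> = \<delta>" using g(4)[OF t] by (simp flip: sum_distrib_right)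
    finally show "(\<Sum>n<j. norm (apply_bcontfun (P (f n)) t - f n t)) \<le> \<delta>" .
  qed
qed


lemma norm_apply_bcontfun_le:
  fixes h :: "'k::topological_space \<Rightarrow>\<^sub>C 'x::real_normed_vector"
  shows "norm (apply_bcontfun h t) \<le> norm h"
  using dist_bounded[of h t 0] by (simp add: dist_norm)

lemma norm_bcontfun_le:
  fixes h :: "'k::topological_space \<Rightarrow>\<^sub>C 'x::real_normed_vector"
  assumes "\<And>t. norm (apply_bcontfun h t) \<le> c"
  shows "norm h \<le> c"
  using dist_bound[of h 0 c] assms by (simp add: dist_norm)

text \<open>Averaging operators of increasing precision converge on \<open>C\<close> but not necessarily
  elsewhere, so the passage from one to the next is damped by continuous cutoffs \<open>w j\<close>
  that equal \<open>1\<close> on \<open>C\<close>. As \<open>w\<close> decreases in \<open>j\<close>, summation by parts shows that the damped sums are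
  averages of the operators \<open>P j\<close> and hence contractions.\<close>

lemma extension_operators:
  fixes f :: "nat \<Rightarrow> ('k::t2_space, 'x::banach) bsig"
  assumes K: "compact (UNIV :: 'k set)" and C: "compact C"
    and f: "\<And>n. continuous_on C (apply_bsig (f n))"
  obtains S :: "nat \<Rightarrow> ('k, 'x) bsig \<Rightarrow> ('k \<Rightarrow>\<^sub>C 'x)" and h where
    "\<And>J. linear (S J)" "\<And>J u. norm (S J u) \<le> norm u" "\<And>n. (\<lambda>J. S J (f n)) \<longlonglongrightarrow> h n"
    "\<And>n t. t \<in> C \<Longrightarrow> apply_bcontfun (h n) t = apply_bsig (f n) t"
proof -
  define good where "good j P \<longleftrightarrow> linear P \<and> (\<forall>u t. norm (apply_bcontfun (P u) t) \<le> norm u) \<and>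
      (\<forall>t\<in>C. (\<Sum>n<j. norm (apply_bcontfun (P (f n)) t - apply_bsig (f n) t)) \<le> (1/2) ^ j)"
    for j and P :: "('k, 'x) bsig \<Rightarrow> ('k \<Rightarrow>\<^sub>C 'x)"
  have "\<exists>P. good j P" for j
  proof -
    have "0 < (1/2 :: real) ^ j" by simp
    then obtain P :: "('k, 'x) bsig \<Rightarrow> ('k \<Rightarrow>\<^sub>C 'x)" where "linear P"
      "\<And>u t. norm (apply_bcontfun (P u) t) \<le> norm u"
      "\<And>t. t \<in> C \<Longrightarrow> (\<Sum>n<j. norm (apply_bcontfun (P (f n)) t - apply_bsig (f n) t)) \<le> (1/2) ^ j"
      by (rule averaging_operator[where f = f and j = j, OF K C f]) blast
    then show ?thesis unfolding good_def by blast
  qed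
  then obtain P where good: "\<And>j. good j (P j)" by metis
  have linP: "linear (P j)" and Ple: "norm (apply_bcontfun (P j u) t) \<le> norm u" for j u t
    using good[of j] by (auto simp: good_def)
  have near: "(\<Sum>n<j. norm (apply_bcontfun (P j (f n)) t - f n t)) \<le> (1/2) ^ j" if "t \<in> C" for j t
    using good[of j] that by (simp add: good_def)
  \<comment> \<open>The change of the first \<open>j\<close> functions from one stage to the next:
    small on \<open>C\<close>, where both stages are close to \<open>f n\<close>, but uncontrolled
    elsewhere.\<close>
  define d where "d j t = (\<Sum>n<j. norm (apply_bcontfun (P (Suc j) (f n)) t - apply_bcontfun (P j (f n)) t))" for j t
  \<comment> \<open>This is 1 where \<open>d j t \<le> 2 * (1/2) ^ j\<close>, which holds on
    \<open>C\<close>, and 0 where \<open>d j t \<ge> 3 * (1/2) ^ j\<close>.\<close>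
  define v where "v j t = max 0 (min 1 (3 - 2 ^ j * d j t))" for j t
  define w where "w J t = (\<Prod>j<J. v j t)" for J t
  have v: "0 \<le> v j t" "v j t \<le> 1" for j t by (auto simp: v_def)
  have w: "0 \<le> w J t" "w J t \<le> 1" "w (Suc J) t \<le> w J t" for J t
  proof -
    show w0: "0 \<le> w J t" and "w J t \<le> 1" using v by (auto simp: w_def intro: prod_nonneg prod_le_1)
    then show "w (Suc J) t \<le> w J t"
      using v[of J t] mult_left_le[of "v J t" "w J t"] by (simp add: w_def)
  qed
  have contw: "continuous_on UNIV (w J)" for J
    unfolding w_def v_def d_def by (intro continuous_intros continuous_on_apply_bcontfun)
  have d_small: "d j t \<le> 3 * (1/2) ^ j" if "w (Suc j) t \<noteq> 0" for j t
  proof -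
    have "v j t \<noteq> 0" using that by (simp add: w_def)
    then have "2 ^ j * d j t \<le> 3" by (auto simp: v_def)
    then show ?thesis by (simp add: field_simps power_one_over)
  qed
  have wC: "w J t = 1" if t: "t \<in> C" for J t
  proof -
    have "d j t \<le> 2 * (1/2) ^ j" for j
    proof -
      have "d j t \<le> (\<Sum>n<j. norm (apply_bcontfun (P (Suc j) (f n)) t - f n t) + norm (apply_bcontfun (P j (f n)) t - f n t))"
        unfolding d_def
        using norm_triangle_ineq4[of "apply_bcontfun (P (Suc j) (f n)) t - f n t"
            "apply_bcontfun (P j (f n)) t - f n t" for n]
        by (intro sum_mono) simp
      also have "\<dots> \<le> (\<Sum>n<Suc j. norm (apply_bcontfun (P (Suc j) (f n)) t - f n t)) + (1/2) ^ j"
        using near[OF t, of j] by (simp add: sum.distrib) (intro add_increasing norm_ge_zero)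
      also have "\<dots> \<le> (1/2) ^ Suc j + (1/2) ^ j" using near[OF t, of "Suc j"] by (rule add_right_mono)
      also have "\<dots> \<le> 2 * (1/2) ^ j" by simp
      finally show ?thesis .
    qed
    then have "2 ^ j * d j t \<le> 2" for j by (simp add: field_simps power_one_over)
    then have "v j t = 1" for j unfolding v_def by (smt (verit))
    then show ?thesis by (simp add: w_def)
  qed
  define s where "s J u t = apply_bcontfun (P 0 u) t +
      (\<Sum>j<J. w (Suc j) t *\<^sub>R (apply_bcontfun (P (Suc j) u) t - apply_bcontfun (P j u) t))" for J u t
  \<comment> \<open>Besides \<open>w J t\<close> times the value of \<open>P J u\<close>, the sum
    contains the values of the earlier \<open>P j u\<close> with weights
    \<open>w j t - w (Suc j) t\<close>; these are nonnegative and add up to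
    \<open>1 - w J t\<close>.\<close>
  have damped: "norm (s J u t - w J t *\<^sub>R apply_bcontfun (P J u) t) \<le> (1 - w J t) * norm u" for J u t
  proof (induction J)
    case (Suc J)
    have "s (Suc J) u t - w (Suc J) t *\<^sub>R apply_bcontfun (P (Suc J) u) t =
        (s J u t - w J t *\<^sub>R apply_bcontfun (P J u) t) + (w J t - w (Suc J) t) *\<^sub>R apply_bcontfun (P J u) t"
      by (simp add: s_def algebra_simps)
    also have "norm \<dots> \<le> (1 - w J t) * norm u + (w J t - w (Suc J) t) * norm u"
    proof (rule norm_triangle_mono[OF Suc])
      show "norm ((w J t - w (Suc J) t) *\<^sub>R apply_bcontfun (P J u) t) \<le> (w J t - w (Suc J) t) * norm u"
        using w(3)[of J t] Ple[of J u t] by (simp add: mult_left_mono)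
    qed
    finally show ?case by (simp add: algebra_simps)
  qed (simp add: s_def w_def)
  have s_bound: "norm (s J u t) \<le> norm u" for J u t
  proof -
    have "norm (w J t *\<^sub>R apply_bcontfun (P J u) t) \<le> w J t * norm u"
      using w(1) Ple by (simp add: mult_left_mono)
    from norm_triangle_mono[OF damped[of J u t] this] show ?thesis by (simp add: algebra_simps)
  qed
  define S where "S J u = Bcontfun (s J u)" for J u
  have S: "apply_bcontfun (S J u) t = s J u t" for J u t
    unfolding S_def using s_bound
    by (subst Bcontfun_apply[where M = "norm u"]) (auto simp: s_def intro!: continuous_intros contw)
  have linS: "linear (S J)" for J
    by (rule linearI; rule bcontfun_eqI)
      (simp_all add: S s_def linear_add[OF linP] linear_scale[OF linP] plus_bcontfun.rep_eq scaleR_bcontfun.rep_eq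
        algebra_simps sum.distrib sum_subtractf scaleR_sum_right)
  have "convergent (\<lambda>J. S J (f n))" for n
  proof -
    \<comment> \<open>Where the cutoff does not vanish, \<open>d j\<close> is at most
      \<open>3 * (1/2) ^ j\<close>, so the increment is small on all of \<open>K\<close>. The
      condition \<open>n < j\<close> puts \<open>f n\<close> among the functions that
      \<open>d j\<close> takes into account.\<close>
    have step: "norm (S (Suc j) (f n) - S j (f n)) \<le> 3 * (1/2) ^ j" if "n < j" for j
    proof (rule norm_bcontfun_le)
      fix t
      have *: "apply_bcontfun (S (Suc j) (f n) - S j (f n)) t =
          w (Suc j) t *\<^sub>R (apply_bcontfun (P (Suc j) (f n)) t - apply_bcontfun (P j (f n)) t)"
        by (simp add: minus_bcontfun.rep_eq S s_def)
      show "norm (apply_bcontfun (S (Suc j) (f n) - S j (f n)) t) \<le> 3 * (1/2) ^ j"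
      proof (cases "w (Suc j) t = 0")
        case True
        then show ?thesis unfolding * by simp
      next
        case False
        have "norm (apply_bcontfun (P (Suc j) (f n)) t - apply_bcontfun (P j (f n)) t) \<le> d j t"
          unfolding d_def using that by (intro member_le_sum) auto
        also have "\<dots> \<le> 3 * (1/2) ^ j" by (rule d_small[OF False])
        finally show ?thesis
          unfolding * using w(1,2)[of "Suc j" t] by (simp add: mult_left_le_one_le order_trans[rotated])
      qed
    qed
    define F where "F j t = apply_bcontfun (S (Suc j) (f n) - S j (f n)) t" for j t
    have "norm (F j t) \<le> 3 * (1/2) ^ j" if "n < j" for j t
      unfolding F_def using norm_apply_bcontfun_le step[OF that] by (rule order_trans)
    moreover have "summable (\<lambda>j. 3 * (1/2 :: real) ^ j)" by (intro summable_mult summable_geometric) simp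
    ultimately have "uniform_limit UNIV (\<lambda>J t. \<Sum>j<J. F j t) (\<lambda>t. \<Sum>j. F j t) sequentially"
      by (intro Weierstrass_m_test_ev[where M = "\<lambda>j. 3 * (1/2) ^ j"]) (auto simp: eventually_sequentially intro!: exI[of _ "Suc n"])
    then have "uniform_limit UNIV (\<lambda>J t. (\<Sum>j<J. F j t) + apply_bcontfun (S 0 (f n)) t)
        (\<lambda>t. (\<Sum>j. F j t) + apply_bcontfun (S 0 (f n)) t) sequentially"
      by (intro uniform_limit_add uniform_limit_const)
    also have "(\<lambda>J t. (\<Sum>j<J. F j t) + apply_bcontfun (S 0 (f n)) t) = (\<lambda>J. apply_bcontfun (S J (f n)))"
      using sum_lessThan_telescope[of "\<lambda>j. apply_bcontfun (S j (f n)) t" for t]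
      by (simp add: F_def minus_bcontfun.rep_eq fun_eq_iff)
    finally show ?thesis
      by (rule uniform_limit_bcontfunE[OF _ sequentially_bot]) (auto simp: convergent_def)
  qed
  then obtain h where h: "\<And>n. (\<lambda>J. S J (f n)) \<longlonglongrightarrow> h n" unfolding convergent_def by metis
  have "apply_bcontfun (h n) t = f n t" if t: "t \<in> C" for n t
  proof (rule LIMSEQ_unique)
    have ev: "\<forall>\<^sub>F J in sequentially. norm (apply_bcontfun (S J (f n)) t - apply_bcontfun (h n) t) \<le> norm (S J (f n) - h n)"
      using norm_apply_bcontfun_le[of "S J (f n) - h n" t for J] by (simp add: minus_bcontfun.rep_eq)
    have "(\<lambda>J. norm (S J (f n) - h n)) \<longlonglongrightarrow> 0"
      using h[of n] by (simp add: LIM_zero tendsto_norm_zero)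
    then show "(\<lambda>J. apply_bcontfun (S J (f n)) t) \<longlonglongrightarrow> apply_bcontfun (h n) t"
      by (rule LIM_zero_cancel[OF Lim_null_comparison[OF ev]])
    \<comment> \<open>On \<open>C\<close> all cutoffs are 1 and the damped sum telescopes.\<close>
    have SP: "apply_bcontfun (S J (f n)) t = apply_bcontfun (P J (f n)) t" for J
      using sum_lessThan_telescope[of "\<lambda>j. apply_bcontfun (P j (f n)) t" J] by (simp add: S s_def wC[OF t])
    have "norm (apply_bcontfun (S J (f n)) t - f n t) \<le> (1/2) ^ J" if "n < J" for J
    proof -
      have "norm (apply_bcontfun (P J (f n)) t - f n t) \<le> (\<Sum>n<J. norm (apply_bcontfun (P J (f n)) t - f n t))"
        using that by (intro member_le_sum) auto
      then show ?thesis using near[OF t, of J] by (simp add: SP)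
    qed
    then have ev: "\<forall>\<^sub>F J in sequentially. norm (apply_bcontfun (S J (f n)) t - f n t) \<le> (1/2) ^ J"
      by (auto simp: eventually_sequentially intro!: exI[of _ "Suc n"])
    show "(\<lambda>J. apply_bcontfun (S J (f n)) t) \<longlonglongrightarrow> f n t"
      by (rule LIM_zero_cancel, rule Lim_null_comparison[OF ev], rule LIMSEQ_realpow_zero) auto
  qed
  moreover have "norm (S J u) \<le> norm u" for J u
    by (rule norm_bcontfun_le) (simp add: S s_bound)
  ultimately show ?thesis using that[of S h] linS h by blast
qed

text \<open>The last clause expresses that \<open>f n \<mapsto> h n\<close> induces a bounded linear map on the span; it
  carries weak convergence and weak summability from \<open>f\<close> to \<open>h\<close>.\<close>

theorem linear_extension_from_compact:
  fixes f :: "nat \<Rightarrow> ('k::t2_space, 'x::banach) bsig"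
  assumes K: "compact (UNIV :: 'k set)" and C: "compact C"
    and f: "\<And>n. continuous_on C (apply_bsig (f n))"
  obtains h :: "nat \<Rightarrow> ('k \<Rightarrow>\<^sub>C 'x)" where "\<And>n. norm (h n) \<le> norm (f n)"
    "\<And>n t. t \<in> C \<Longrightarrow> apply_bcontfun (h n) t = apply_bsig (f n) t"
    "\<And>\<phi> :: ('k \<Rightarrow>\<^sub>C 'x) dual. \<exists>\<psi> :: ('k, 'x) bsig dual. \<forall>n. blinfun_apply \<phi> (h n) = blinfun_apply \<psi> (f n)"
proof -
  obtain S :: "nat \<Rightarrow> ('k, 'x) bsig \<Rightarrow> ('k \<Rightarrow>\<^sub>C 'x)" and h where
    S: "\<And>J. linear (S J)" "\<And>J u. norm (S J u) \<le> norm u" and h: "\<And>n. (\<lambda>J. S J (f n)) \<longlonglongrightarrow> h n"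
    and hC: "\<And>n t. t \<in> C \<Longrightarrow> apply_bcontfun (h n) t = apply_bsig (f n) t"
    by (rule extension_operators[where f = f, OF K C f]) blast
  have "\<exists>\<psi> :: ('k, 'x) bsig dual. \<forall>n. blinfun_apply \<phi> (h n) = blinfun_apply \<psi> (f n)" for \<phi> :: "('k \<Rightarrow>\<^sub>C 'x) dual"
  proof -
    \<comment> \<open>On the subspace \<open>V\<close> of convergence, which contains every
      \<open>f n\<close>, the limit is a linear contraction; \<open>\<phi>\<close> composed with it
      extends from there to all of \<open>B(\<Sigma>,X)\<close>.\<close>
    define V where "V = {u. convergent (\<lambda>J. S J u)}"
    define L where "L u = lim (\<lambda>J. S J u)" for u
    have L: "(\<lambda>J. S J u) \<longlonglongrightarrow> L u" if "u \<in> V" for u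
      using that by (simp add: V_def L_def convergent_LIMSEQ_iff)
    have VL: "u \<in> V \<and> L u = l" if "(\<lambda>J. S J u) \<longlonglongrightarrow> l" for u l
      using that by (auto simp: V_def L_def convergent_def limI)
    have add: "u + u' \<in> V \<and> L (u + u') = L u + L u'" if "u \<in> V" "u' \<in> V" for u u'
      using tendsto_add[OF L[OF that(1)] L[OF that(2)]] by (intro VL) (simp add: linear_add[OF S(1)])
    have scale: "r *\<^sub>R u \<in> V \<and> L (r *\<^sub>R u) = r *\<^sub>R L u" if "u \<in> V" for r u
      using tendsto_scaleR[OF tendsto_const L[OF that]] by (intro VL) (simp add: linear_scale[OF S(1)])
    have zero: "0 \<in> V" by (simp add: V_def linear_0[OF S(1)] convergent_const)
    have LV: "norm (L u) \<le> norm u" if "u \<in> V" for u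
      using S(2) by (intro LIMSEQ_le_const2[OF tendsto_norm[OF L[OF that]]]) auto
    obtain \<psi> :: "('k, 'x) bsig dual" where
      psi: "\<And>u. u \<in> V \<Longrightarrow> blinfun_apply \<psi> u = blinfun_apply \<phi> (L u)"
    proof (rule hahn_banach_extension[of V "\<lambda>u. blinfun_apply \<phi> (L u)" "norm \<phi>"])
      show "subspace V" using add scale zero by (auto simp: subspace_def)
      show "\<bar>blinfun_apply \<phi> (L u)\<bar> \<le> norm \<phi> * norm u" if "u \<in> V" for u
        using norm_blinfun[of \<phi> "L u"] mult_left_mono[OF LV[OF that] norm_ge_zero[of \<phi>]] by simp
    qed (auto simp: add scale blinfun.add_right blinfun.scaleR_right)
    have "f n \<in> V \<and> L (f n) = h n" for n by (rule VL[OF h])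
    then show ?thesis using psi by (intro exI[of _ \<psi>]) auto
  qed
  moreover have "norm (h n) \<le> norm (f n)" for n
    using S(2) by (intro LIMSEQ_le_const2[OF tendsto_norm[OF h]]) auto
  ultimately show ?thesis using that hC by blast
qed


section \<open>Regularity of the semivariation\<close>

lemma regular_submeasure_variation:
  fixes \<mu> :: "'k::t2_space set \<Rightarrow> 'z::real_normed_vector"
  assumes "\<mu> \<in> rcabv"
  shows "regular_submeasure (variation \<mu>)"
proof -
  have m: "vector_measure \<mu>" using assms by (rule rcabv_imp_vector_measure)
  have "variation \<mu> (\<Union>i. A i) \<le> (\<Sum>i. variation \<mu> (A i))" if "range A \<subseteq> sets borel" for A :: "nat \<Rightarrow> 'k set"
  proof -
    have "A i \<in> sets borel" for i using that by auto
    moreover have "emeasure (variation_measure \<mu>) (\<Union>i. A i) \<le> (\<Sum>i. emeasure (variation_measure \<mu>) (A i))"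
      using that by (intro emeasure_subadditive_countably) simp
    ultimately show ?thesis by (simp add: emeasure_variation_measure[OF m] sets.countable_UN)
  qed
  moreover have "\<exists>C. compact C \<and> C \<subseteq> A \<and> variation \<mu> (A - C) < ennreal e"
    if A: "A \<in> sets borel" and e: "0 < e" for A e
  proof -
    have "0 < ennreal e" using e by simp
    then obtain C U where CU: "compact C" "open U" "C \<subseteq> A" "A \<subseteq> U" "variation \<mu> (U - C) < ennreal e"
      using assms A unfolding rcabv_def by blast
    have "C \<in> sets borel" "U \<in> sets borel" using CU by (auto intro: borel_closed compact_imp_closed)
    then have "variation \<mu> (A - C) \<le> variation \<mu> (U - C)"
      using A CU by (intro variation_mono[OF m]) auto
    with CU show ?thesis by (meson le_less_trans)
  qed
  ultimately show ?thesis
    using variation_mono[OF m] by (simp add: regular_submeasure_def m)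
qed

text \<open>The union of two compact subsets, one good for each summand, is good for both. This
  yields a common compact set for the two measures compared in the proof of uniqueness.\<close>

lemma regular_submeasure_add:
  fixes \<nu> \<nu>' :: "'k::t2_space set \<Rightarrow> ennreal"
  assumes r: "regular_submeasure \<nu>" and r': "regular_submeasure \<nu>'"
  shows "regular_submeasure (\<lambda>A. \<nu> A + \<nu>' A)"
proof -
  have "\<nu> (\<Union>i. A i) + \<nu>' (\<Union>i. A i) \<le> (\<Sum>i. \<nu> (A i) + \<nu>' (A i))"
    if "range A \<subseteq> sets borel" for A :: "nat \<Rightarrow> 'k set"
  proof -
    have "\<nu> (\<Union>i. A i) + \<nu>' (\<Union>i. A i) \<le> (\<Sum>i. \<nu> (A i)) + (\<Sum>i. \<nu>' (A i))"
      using that by (intro add_mono regular_submeasure_UN[OF r] regular_submeasure_UN[OF r']) auto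
    then show ?thesis by (simp add: suminf_add)
  qed
  moreover have "\<exists>C. compact C \<and> C \<subseteq> A \<and> \<nu> (A - C) + \<nu>' (A - C) < ennreal e"
    if A: "A \<in> sets borel" and e: "0 < e" for A e
  proof -
    have e2: "0 < e / 2" using e by simp
    obtain C where C: "compact C" "C \<subseteq> A" "\<nu> (A - C) < ennreal (e / 2)"
      by (rule regular_submeasure_inner[OF r A e2])
    obtain D where D: "compact D" "D \<subseteq> A" "\<nu>' (A - D) < ennreal (e / 2)"
      by (rule regular_submeasure_inner[OF r' A e2])
    have CD: "C \<in> sets borel" "D \<in> sets borel" using C D by (auto intro: borel_closed compact_imp_closed)
    have "\<nu> (A - (C \<union> D)) \<le> \<nu> (A - C)" "\<nu>' (A - (C \<union> D)) \<le> \<nu>' (A - D)"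
      using A CD by (auto intro!: regular_submeasure_mono[OF r] regular_submeasure_mono[OF r'])
    then have "\<nu> (A - (C \<union> D)) + \<nu>' (A - (C \<union> D)) < ennreal (e / 2) + ennreal (e / 2)"
      using C(3) D(3) by (intro add_strict_mono) auto
    also have "\<dots> = ennreal e" using e by (simp flip: ennreal_plus)
    finally show ?thesis using C D by (intro exI[of _ "C \<union> D"]) auto
  qed
  ultimately show ?thesis
    using r r' by (auto simp: regular_submeasure_def intro!: add_mono)
qed

section \<open>Representing measures and their semivariation\<close>

lemma represents_rcabv:
  "represents m T \<Longrightarrow> scalar_part m \<phi> \<in> rcabv"
  by (simp add: represents_def functional_measure_def)

lemma represents_vector_measure:
  "represents m T \<Longrightarrow> vector_measure (scalar_part m \<phi>)"
  by (rule rcabv_imp_vector_measure[OF represents_rcabv])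

lemma represents_has_vm_integral:
  "represents m T \<Longrightarrow> has_vm_integral (scalar_part m \<phi>) (apply_bcontfun h) (blinfun_apply \<phi> (blinfun_apply T h))"
  by (simp add: represents_def functional_measure_def)

lemma variation_le_semivariation:
  assumes "norm \<phi> \<le> 1"
  shows "variation (scalar_part m \<phi>) E \<le> semivariation m E"
  unfolding semivariation_def using assms by (intro SUP_upper) simp

lemma variation_scalar_part_le:
  "variation (scalar_part m \<phi>) E \<le> ennreal (norm \<phi>) * semivariation m E"
proof -
  have "scalar_part m \<phi> A = norm \<phi> *\<^sub>R scalar_part m (sgn \<phi>) A" for A
  proof (rule blinfun_eqI)
    fix x
    have "\<phi> = norm \<phi> *\<^sub>R sgn \<phi>" by (cases "\<phi> = 0") (simp_all add: sgn_div_norm)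
    then have "m A x \<phi> = norm \<phi> *\<^sub>R m A x (sgn \<phi>)" by (metis blinfun.scaleR_right)
    then show "scalar_part m \<phi> A x = (norm \<phi> *\<^sub>R scalar_part m (sgn \<phi>) A) x"
      by (simp add: blinfun.scaleR_left)
  qed
  then have "scalar_part m \<phi> = (\<lambda>A. norm \<phi> *\<^sub>R scalar_part m (sgn \<phi>) A)" by blast
  then have "variation (scalar_part m \<phi>) E = ennreal (norm \<phi>) * variation (scalar_part m (sgn \<phi>)) E"
    using variation_scaleR[of "norm \<phi>" "scalar_part m (sgn \<phi>)" E] by simp
  also have "\<dots> \<le> ennreal (norm \<phi>) * semivariation m E"
    by (intro mult_left_mono variation_le_semivariation) (auto simp: norm_sgn)
  finally show ?thesis .
qed

text \<open>If compact sets failed to exhaust \<open>A\<close> in semivariation, one could pick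
  increasing compact subsets whose successive differences have semivariation bounded below; their tails
  decrease to the empty set, contradicting strong boundedness.\<close>

lemma regular_submeasure_semivariation:
  fixes m :: "'k::t2_space set \<Rightarrow> 'x::real_normed_vector \<Rightarrow>\<^sub>L 'y::real_normed_vector dual dual"
  assumes rep: "represents m T"
    and cont: "\<And>A :: nat \<Rightarrow> 'k set. range A \<subseteq> sets borel \<Longrightarrow> decseq A \<Longrightarrow> (\<Inter>i. A i) = {} \<Longrightarrow>
      (\<lambda>i. semivariation m (A i)) \<longlonglongrightarrow> 0"
  shows "regular_submeasure (semivariation m)"
proof -
  have reg: "regular_submeasure (variation (scalar_part m \<phi>))" for \<phi>
    by (rule regular_submeasure_variation[OF represents_rcabv[OF rep]])
  have mono: "semivariation m A \<le> semivariation m B"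
    if "A \<in> sets borel" "B \<in> sets borel" "A \<subseteq> B" for A B
    unfolding semivariation_def by (intro SUP_mono) (use that regular_submeasure_mono[OF reg] in blast)
  have "semivariation m (\<Union>i. A i) \<le> (\<Sum>i. semivariation m (A i))"
    if "range A \<subseteq> sets borel" for A :: "nat \<Rightarrow> 'k set"
    unfolding semivariation_def[of m "\<Union>i. A i"]
  proof (rule SUP_least)
    fix \<phi> :: "'y dual" assume "\<phi> \<in> {\<phi>. norm \<phi> \<le> 1}"
    then have "(\<Sum>i. variation (scalar_part m \<phi>) (A i)) \<le> (\<Sum>i. semivariation m (A i))"
      by (intro suminf_le variation_le_semivariation) auto
    then show "variation (scalar_part m \<phi>) (\<Union>i. A i) \<le> (\<Sum>i. semivariation m (A i))"
      using regular_submeasure_UN[OF reg, of A \<phi>] that by (auto intro: order_trans)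
  qed
  moreover have "semivariation m {} = 0"
    by (simp add: semivariation_def represents_vector_measure[OF rep] SUP_constant bot_ennreal)
  moreover have "\<exists>C. compact C \<and> C \<subseteq> A \<and> semivariation m (A - C) < ennreal e"
    if A: "A \<in> sets borel" and e: "0 < e" for A e
  proof (rule ccontr)
    assume "\<not> ?thesis"
    then have big: "ennreal e \<le> semivariation m (A - C)" if "compact C" "C \<subseteq> A" for C
      using that by (meson not_le)
    have cb: "C \<in> sets borel" if "compact C" for C :: "'k set"
      using that by (intro borel_closed compact_imp_closed)
    have e4: "0 < e / 4" using e by simp
    \<comment> \<open>Some functional sees more than \<open>e / 2\<close> on \<open>A - C\<close>
      and misses less than \<open>e / 4\<close> of \<open>A\<close> outside a compact
      \<open>D\<close>; at least \<open>e / 4\<close> is left on the part of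
      \<open>C \<union> D\<close> outside \<open>C\<close>.\<close>
    have step: "\<exists>D. (compact D \<and> D \<subseteq> A) \<and> C \<subseteq> D \<and> ennreal (e / 4) \<le> semivariation m (D - C)"
      if C: "compact C \<and> C \<subseteq> A" for C
    proof -
      have "ennreal (e / 2) < ennreal e" using e by (simp add: ennreal_less_iff)
      then have "ennreal (e / 2) < semivariation m (A - C)" using big[of C] C by (meson less_le_trans)
      then obtain \<phi> :: "'y dual" where phi: "norm \<phi> \<le> 1"
          and large: "ennreal (e / 2) < variation (scalar_part m \<phi>) (A - C)"
        unfolding semivariation_def less_SUP_iff by blast
      let ?v = "variation (scalar_part m \<phi>)"
      obtain D where D: "compact D" "D \<subseteq> A" "?v (A - D) < ennreal (e / 4)"
        by (rule regular_submeasure_inner[OF reg A e4])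
      have "?v (A - C) \<le> ?v ((C \<union> D - C) \<union> (A - D))"
        using A C D cb by (intro regular_submeasure_mono[OF reg]) auto
      also have "\<dots> \<le> ?v (C \<union> D - C) + ?v (A - D)"
        using A C D cb by (intro regular_submeasure_Un[OF reg]) auto
      finally have sum: "?v (A - C) \<le> ?v (C \<union> D - C) + ?v (A - D)" .
      have "ennreal (e / 4) \<le> ?v (C \<union> D - C)"
      proof (rule ccontr)
        assume "\<not> ?thesis"
        then have "?v (C \<union> D - C) + ?v (A - D) < ennreal (e / 4) + ennreal (e / 4)"
          using D by (intro add_strict_mono) auto
        also have "\<dots> = ennreal (e / 2)" using e by (simp flip: ennreal_plus)
        finally show False using sum large by (meson less_le_trans less_asym le_less_trans)
      qed
      then have "ennreal (e / 4) \<le> semivariation m (C \<union> D - C)"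
        using variation_le_semivariation[OF phi] by (rule order_trans)
      then show ?thesis using C D by (intro exI[of _ "C \<union> D"]) auto
    qed
    have "\<exists>F. \<forall>n::nat. (compact (F n) \<and> F n \<subseteq> A) \<and>
        (F n \<subseteq> F (Suc n) \<and> ennreal (e / 4) \<le> semivariation m (F (Suc n) - F n))"
    proof (rule dependent_nat_choice)
      show "\<exists>C. compact C \<and> C \<subseteq> A" by (rule exI[of _ "{}"]) simp
    qed (rule step)
    then obtain F where F: "\<And>n. compact (F n)" "\<And>n. F n \<subseteq> F (Suc n)"
        "\<And>n. ennreal (e / 4) \<le> semivariation m (F (Suc n) - F n)"
      by blast
    \<comment> \<open>The tail \<open>R n\<close> contains \<open>F (Suc n) - F n\<close>, so its
      semivariation is at least \<open>e / 4\<close>, although no point lies in all tails.\<close>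
    define R where "R n = (\<Union>k. F k) - F n" for n
    have Fb: "F n \<in> sets borel" for n by (rule cb[OF F(1)])
    then have Rb: "R n \<in> sets borel" for n unfolding R_def by (intro sets.Diff sets.countable_UN) auto
    have "decseq R" using F(2) by (auto simp: decseq_Suc_iff R_def)
    moreover have "range R \<subseteq> sets borel" using Rb by blast
    moreover have "(\<Inter>n. R n) = {}" by (auto simp: R_def)
    ultimately have lim: "(\<lambda>n. semivariation m (R n)) \<longlonglongrightarrow> 0" by (intro cont)
    have "ennreal (e / 4) \<le> semivariation m (R n)" for n
    proof -
      have "semivariation m (F (Suc n) - F n) \<le> semivariation m (R n)"
        using Fb Rb by (intro mono) (auto simp: R_def)
      with F(3)[of n] show ?thesis by (rule order_trans)
    qed
    then have "ennreal (e / 4) \<le> 0" by (intro LIMSEQ_le_const[OF lim]) auto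
    with e show False by simp
  qed
  ultimately show ?thesis using mono by (simp add: regular_submeasure_def)
qed


section \<open>Uniqueness of the representing measure\<close>

text \<open>The range is compact, hence totally bounded, and the centres of finite nets of radius
  \<open>inverse (Suc n)\<close> form a countable set whose closure contains it.\<close>

lemma apply_bcontfun_sep_meas:
  fixes h :: "'k::topological_space \<Rightarrow>\<^sub>C 'x::real_normed_vector"
  assumes K: "compact (UNIV :: 'k set)"
  shows "apply_bcontfun h \<in> sep_meas"
proof -
  have "compact (range h)" by (rule compact_continuous_image[OF _ K]) simp
  then have "\<forall>n. \<exists>k. finite k \<and> range h \<subseteq> (\<Union>x\<in>k. ball x (inverse (real (Suc n))))"
    using seq_compact_imp_totally_bounded[of "range h"] by (metis compact_imp_seq_compact inverse_positive_iff_positive of_nat_0_less_iff zero_less_Suc)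
  then obtain k where k: "\<And>n. finite (k n)" "\<And>n. range h \<subseteq> (\<Union>x\<in>k n. ball x (inverse (real (Suc n))))"
    by metis
  have "h t \<in> closure (\<Union>n. k n)" for t
    unfolding closure_approachable
  proof (intro allI impI)
    fix e :: real assume "0 < e"
    then obtain n where n: "inverse (real (Suc n)) < e" using reals_Archimedean by blast
    have "h t \<in> (\<Union>x\<in>k n. ball x (inverse (real (Suc n))))" using k(2) by blast
    then obtain x where "x \<in> k n" "dist x (h t) < inverse (real (Suc n))" by auto
    with n show "\<exists>y\<in>\<Union>n. k n. dist y (h t) < e" by (intro bexI[of _ x]) auto
  qed
  moreover have "countable (\<Union>n. k n)" using k(1) by (simp add: countable_finite)
  ultimately show ?thesis
    unfolding sep_meas_def separable_top_of_set_iff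
    by (auto intro: borel_measurable_continuous_onI)
qed

text \<open>The functions agree on \<open>C\<close> and differ by at most \<open>2 * M\<close>
  elsewhere, so their distance in mean is at most \<open>2 * M\<close> times the variation of the
  complement.\<close>

lemma has_vm_integral_close:
  fixes f :: "('k::t2_space, 'x::real_normed_vector) bsig" and h :: "'k \<Rightarrow>\<^sub>C 'x"
  assumes K: "compact (UNIV :: 'k set)" and m: "vector_measure \<mu>" and C: "compact C"
    and eq: "\<And>t. t \<in> C \<Longrightarrow> apply_bcontfun h t = apply_bsig f t"
    and M: "norm f \<le> M" "norm h \<le> M"
    and I: "has_vm_integral \<mu> (apply_bsig f) I" and J: "has_vm_integral \<mu> (apply_bcontfun h) J"
    and e: "variation \<mu> (- C) \<le> ennreal e" "0 \<le> e"
  shows "\<bar>I - J\<bar> \<le> 2 * M * e"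
proof -
  have M0: "0 \<le> M" using M(1) norm_ge_zero order_trans by blast
  have "ennreal \<bar>I - J\<bar> \<le> (\<integral>\<^sup>+t. ennreal (norm (f t - h t)) \<partial>variation_measure \<mu>)"
    by (rule has_vm_integral_diff[OF m apply_bsig apply_bcontfun_sep_meas[OF K] I J])
  also have "\<dots> \<le> ennreal (2 * M) * variation \<mu> (- C)"
    using C eq norm_apply_bsig_le[of f] norm_apply_bcontfun_le[of h] M
    by (intro nn_integral_norm_diff_le[OF m]) (auto intro: borel_closed compact_imp_closed order_trans)
  also have "\<dots> \<le> ennreal (2 * M) * ennreal e" by (intro mult_left_mono e) simp
  also have "\<dots> = ennreal (2 * M * e)" using M0 e by (simp add: ennreal_mult)
  finally show ?thesis using M0 e by simp
qed

text \<open>A functional prescribes the integrals of continuous functions only. The function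
  \<open>x\<close> on \<open>A\<close> and 0 elsewhere is continuous on a compact set that is large
  for both measures, and a continuous \<open>h 0\<close> agrees with it there; both measures give
  \<open>h 0\<close> the integral \<open>\<Lambda> (h 0)\<close>.\<close>

lemma functional_measure_unique:
  fixes \<Lambda> :: "('k::t2_space \<Rightarrow>\<^sub>C 'x::banach) dual"
  assumes K: "compact (UNIV :: 'k set)"
    and fm: "functional_measure \<Lambda> \<mu>" "functional_measure \<Lambda> \<mu>'"
  shows "\<mu> = \<mu>'"
proof (intro ext blinfun_eqI)
  fix A :: "'k set" and x
  have rc: "\<mu> \<in> rcabv" "\<mu>' \<in> rcabv" using fm by (auto simp: functional_measure_def)
  note m = rcabv_imp_vector_measure[OF rc(1)] rcabv_imp_vector_measure[OF rc(2)]
  show "\<mu> A x = \<mu>' A x"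
  proof (cases "A \<in> sets borel")
    case False
    then show ?thesis using rc by (simp add: rcabv_def)
  next
    case A: True
    have "simple_function borel (\<lambda>t. indicator A t *\<^sub>R x)"
      using A by (intro simple_function_compose1[of _ _ "\<lambda>r. r *\<^sub>R x"] simple_function_indicator) auto
    then obtain f :: "('k, 'x) bsig" where f: "apply_bsig f = (\<lambda>t. indicator A t *\<^sub>R x)"
      using Bsig_inverse sep_meas_simple_function by blast
    let ?\<nu> = "\<lambda>A. variation \<mu> A + variation \<mu>' A"
    have reg: "regular_submeasure ?\<nu>"
      by (intro regular_submeasure_add regular_submeasure_variation rc)
    have "\<bar>\<mu> A x - \<mu>' A x\<bar> \<le> 0 + e" if e: "0 < e" for e
    proof -
      \<comment> \<open>Two errors of \<open>2 * norm f * \<delta>\<close> must fit into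
        \<open>e\<close>; the summand 1 guards against a zero denominator.\<close>
      define \<delta> where "\<delta> = e / (4 * norm f + 1)"
      have \<delta>: "0 < \<delta>" using e by (simp add: \<delta>_def add_nonneg_pos)
      have "4 * norm f * \<delta> \<le> (4 * norm f + 1) * \<delta>" using \<delta> by (intro mult_right_mono) auto
      also have "\<dots> = e" using norm_ge_zero[of f] by (simp add: \<delta>_def field_simps add_nonneg_eq_0_iff)
      finally have le: "4 * norm f * \<delta> \<le> e" .
      obtain C where C: "compact C" "?\<nu> (- C) \<le> ennreal \<delta>" "\<And>n::nat. continuous_on C (apply_bsig f)"
        by (rule lusin_sequence[where f = "\<lambda>_. f", OF K reg \<delta>]) blast
      obtain h where h: "\<And>n::nat. norm (h n) \<le> norm f" "\<And>n t. t \<in> C \<Longrightarrow> apply_bcontfun (h n) t = apply_bsig f t"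
        by (rule linear_extension_from_compact[where f = "\<lambda>_. f", OF K C(1,3)]) blast
      have "variation \<mu> (- C) \<le> ?\<nu> (- C)" "variation \<mu>' (- C) \<le> ?\<nu> (- C)"
        by (auto intro: add_increasing add_increasing2)
      then have v: "variation \<mu> (- C) \<le> ennreal \<delta>" "variation \<mu>' (- C) \<le> ennreal \<delta>"
        using C(2) by (meson order_trans)+
      have int: "has_vm_integral \<mu> (apply_bsig f) (\<mu> A x)" "has_vm_integral \<mu>' (apply_bsig f) (\<mu>' A x)"
        "has_vm_integral \<mu> (apply_bcontfun (h 0)) (\<Lambda> (h 0))" "has_vm_integral \<mu>' (apply_bcontfun (h 0)) (\<Lambda> (h 0))"
        using fm A has_vm_integral_indicator[OF m(1)] has_vm_integral_indicator[OF m(2)]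
        by (auto simp: functional_measure_def f)
      have "\<bar>\<mu> A x - \<Lambda> (h 0)\<bar> \<le> 2 * norm f * \<delta>"
        by (rule has_vm_integral_close[OF K m(1) C(1) h(2) order_refl h(1) int(1,3) v(1)]) (use \<delta> in auto)
      moreover have "\<bar>\<mu>' A x - \<Lambda> (h 0)\<bar> \<le> 2 * norm f * \<delta>"
        by (rule has_vm_integral_close[OF K m(2) C(1) h(2) order_refl h(1) int(2,4) v(2)]) (use \<delta> in auto)
      ultimately show ?thesis using le by linarith
    qed
    then have "\<bar>\<mu> A x - \<mu>' A x\<bar> \<le> 0" by (rule field_le_epsilon)
    then show ?thesis by simp
  qed
qed

lemma rep_measure_eq:
  fixes T :: "('k::t2_space \<Rightarrow>\<^sub>C 'x::banach) \<Rightarrow>\<^sub>L 'y::real_normed_vector"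
  assumes K: "compact (UNIV :: 'k set)" and rep: "represents m T"
  shows "rep_measure T = m"
  unfolding rep_measure_def
proof (rule the_equality)
  show "represents m T" by (rule rep)
  fix m' assume rep': "represents m' T"
  have "scalar_part m' \<phi> = scalar_part m \<phi>" for \<phi>
    using rep rep' unfolding represents_def by (intro functional_measure_unique[OF K, of "\<phi> o\<^sub>L T"]) auto
  then have "m' A x \<phi> = m A x \<phi>" for A x \<phi> by (metis scalar_part_apply)
  then show "m' = m" by (intro ext blinfun_eqI)
qed


section \<open>The extension\<close>

text \<open>The difference is tested on functionals of norm at most 1, whose variations the
  semivariation bounds all at once. As \<open>y\<close> is any vector with the right integrals, the
  estimate is available before \<open>extension T\<close> is known to be well defined.\<close>

lemma operator_close:
  fixes T :: "('k::t2_space \<Rightarrow>\<^sub>C 'x::real_normed_vector) \<Rightarrow>\<^sub>L 'y::real_normed_vector"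
  assumes K: "compact (UNIV :: 'k set)" and rep: "represents m T" and C: "compact C"
    and eq: "\<And>t. t \<in> C \<Longrightarrow> apply_bcontfun h t = apply_bsig f t"
    and M: "norm f \<le> M" "norm h \<le> M"
    and y: "\<And>\<phi> :: 'y dual. has_vm_integral (scalar_part m \<phi>) (apply_bsig f) (blinfun_apply \<phi> y)"
    and e: "semivariation m (- C) \<le> ennreal e" "0 \<le> e"
  shows "norm (y - T h) \<le> 2 * M * e"
proof (rule norm_le_by_functionals)
  fix \<phi> :: "'y dual" assume phi: "norm \<phi> \<le> 1"
  have "variation (scalar_part m \<phi>) (- C) \<le> ennreal e"
    using variation_le_semivariation[OF phi] e(1) by (rule order_trans)
  then have "\<bar>\<phi> y - \<phi> (T h)\<bar> \<le> 2 * M * e"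
    by (intro has_vm_integral_close[OF K represents_vector_measure[OF rep] C eq M y
        represents_has_vm_integral[OF rep]] e)
  then show "\<bar>blinfun_apply \<phi> (y - T h)\<bar> \<le> 2 * M * e" by (simp add: blinfun.diff_right)
qed

lemma operator_close_bcontfun:
  fixes T :: "('k::t2_space \<Rightarrow>\<^sub>C 'x::real_normed_vector) \<Rightarrow>\<^sub>L 'y::real_normed_vector"
  assumes K: "compact (UNIV :: 'k set)" and rep: "represents m T" and C: "compact C"
    and eq: "\<And>t. t \<in> C \<Longrightarrow> apply_bcontfun h t = apply_bcontfun g t"
    and M: "norm g \<le> M" "norm h \<le> M"
    and e: "semivariation m (- C) \<le> ennreal e" "0 \<le> e"
  shows "norm (T g - T h) \<le> 2 * M * e"
proof -
  obtain f :: "('k, 'x) bsig" where f: "apply_bsig f = apply_bcontfun g"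
    using Bsig_inverse[OF apply_bcontfun_sep_meas[OF K]] by blast
  have "norm f \<le> M"
    using norm_apply_bcontfun_le[of g] M(1) by (intro norm_bsig_le) (auto simp: f intro: order_trans)
  moreover have "has_vm_integral (scalar_part m \<phi>) (apply_bsig f) (blinfun_apply \<phi> (T g))" for \<phi> :: "'y dual"
    unfolding f by (rule represents_has_vm_integral[OF rep])
  moreover have "apply_bcontfun h t = apply_bsig f t" if "t \<in> C" for t
    unfolding f by (rule eq[OF that])
  ultimately show ?thesis
    by (intro operator_close[OF K rep C _ _ M(2) _ e])
qed

text \<open>The value is the limit of \<open>T\<close> along continuous functions that agree with \<open>f\<close> off sets of small
  semivariation. In particular it lies in \<open>'y\<close>, not just in the bidual.\<close>

lemma extension_value_exists:
  fixes T :: "('k::t2_space \<Rightarrow>\<^sub>C 'x::banach) \<Rightarrow>\<^sub>L 'y::banach"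
  assumes K: "compact (UNIV :: 'k set)" and rep: "represents m T"
    and reg: "regular_submeasure (semivariation m)"
  shows "\<exists>y. \<forall>\<phi> :: 'y dual. has_vm_integral (scalar_part m \<phi>) (apply_bsig f) (blinfun_apply \<phi> y)"
proof -
  define M where "M = norm f"
  have "\<exists>C h. compact C \<and> semivariation m (- C) \<le> ennreal ((1/2) ^ n) \<and> norm h \<le> M \<and>
      (\<forall>t\<in>C. apply_bcontfun h t = f t)" for n
  proof -
    have pos: "0 < (1/2 :: real) ^ n" by simp
    obtain C where C: "compact C" "semivariation m (- C) \<le> ennreal ((1/2) ^ n)" "\<And>n::nat. continuous_on C (apply_bsig f)"
      by (rule lusin_sequence[where f = "\<lambda>_. f", OF K reg pos]) blast
    obtain h where h: "\<And>n::nat. norm (h n) \<le> norm f" "\<And>n t. t \<in> C \<Longrightarrow> apply_bcontfun (h n) t = apply_bsig f t"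
      by (rule linear_extension_from_compact[where f = "\<lambda>_. f", OF K C(1,3)]) blast
    show ?thesis using C h(1)[of 0] h(2)[of _ 0] unfolding M_def by blast
  qed
  then obtain C h where C: "\<And>n. compact (C n)" "\<And>n. semivariation m (- C n) \<le> ennreal ((1/2) ^ n)"
    and h: "\<And>n. norm (h n) \<le> M" "\<And>n t. t \<in> C n \<Longrightarrow> apply_bcontfun (h n) t = f t"
    by metis
  have Cb: "C n \<in> sets borel" for n using C(1) by (intro borel_closed compact_imp_closed)
  have M0: "0 \<le> M" by (simp add: M_def)
  have lim0: "(\<lambda>n. c * (1/2 :: real) ^ n) \<longlonglongrightarrow> 0" for c
    by (intro tendsto_mult_right_zero LIMSEQ_realpow_zero) auto
  \<comment> \<open>Both \<open>h k\<close> and \<open>h l\<close> agree with \<open>f\<close> on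
    \<open>C k \<inter> C l\<close>, whose complement has semivariation at most the sum of the two
    bounds.\<close>
  have close: "norm (T (h k) - T (h l)) \<le> 4 * M * (1/2) ^ n" if "n \<le> k" "n \<le> l" for n k l
  proof -
    have "semivariation m (- (C k \<inter> C l)) = semivariation m (- C k \<union> - C l)" by (simp add: Compl_Int)
    also have "\<dots> \<le> semivariation m (- C k) + semivariation m (- C l)"
      using Cb by (intro regular_submeasure_Un[OF reg]) (auto intro: borel_comp)
    also have "\<dots> \<le> ennreal ((1/2) ^ k) + ennreal ((1/2) ^ l)" by (intro add_mono C)
    also have "\<dots> = ennreal ((1/2) ^ k + (1/2) ^ l)" by simp
    finally have s: "semivariation m (- (C k \<inter> C l)) \<le> ennreal ((1/2) ^ k + (1/2) ^ l)" .
    have "norm (T (h k) - T (h l)) \<le> 2 * M * ((1/2) ^ k + (1/2) ^ l)"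
      using h C(1) by (intro operator_close_bcontfun[OF K rep _ _ _ _ s] compact_Int) auto
    also have "\<dots> \<le> 2 * M * ((1/2) ^ n + (1/2) ^ n)"
      using that M0 by (intro mult_left_mono add_mono power_decreasing) auto
    finally show ?thesis by simp
  qed
  have "Cauchy (\<lambda>n. T (h n))"
  proof (rule CauchyI)
    fix e :: real assume "0 < e"
    then have "\<forall>\<^sub>F n in sequentially. 4 * M * (1/2) ^ n < e" by (intro order_tendstoD(2)[OF lim0])
    then obtain n where "4 * M * (1/2) ^ n < e" by (auto simp: eventually_sequentially)
    then show "\<exists>N. \<forall>k\<ge>N. \<forall>l\<ge>N. norm (T (h k) - T (h l)) < e"
      using close by (meson le_less_trans)
  qed
  then obtain y where y: "(\<lambda>n. T (h n)) \<longlonglongrightarrow> y" using Cauchy_convergent_iff convergent_def by blast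
  have "has_vm_integral (scalar_part m \<phi>) (apply_bsig f) (blinfun_apply \<phi> y)" for \<phi> :: "'y dual"
  proof (rule has_vm_integral_approx[OF apply_bsig])
    fix e :: real assume e: "0 < e"
    let ?I = "\<lambda>n. \<integral>\<^sup>+t. ennreal (norm (f t - apply_bcontfun (h n) t)) \<partial>variation_measure (scalar_part m \<phi>)"
    have I: "?I n \<le> ennreal (2 * M * norm \<phi> * (1/2) ^ n)" for n
    proof -
      have "?I n \<le> ennreal (2 * M) * variation (scalar_part m \<phi>) (- C n)"
        using Cb h(2) norm_apply_bsig_le[of f] order_trans[OF norm_apply_bcontfun_le h(1)]
        by (intro nn_integral_norm_diff_le represents_vector_measure[OF rep]) (auto simp: M_def)
      also have "\<dots> \<le> ennreal (2 * M) * (ennreal (norm \<phi>) * ennreal ((1/2) ^ n))"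
        using C(2)[of n]
        by (intro mult_left_mono order_trans[OF variation_scalar_part_le]) auto
      also have "\<dots> = ennreal (2 * M * norm \<phi> * (1/2) ^ n)"
        using M0 by (simp add: ennreal_mult mult.assoc)
      finally show ?thesis .
    qed
    have "\<forall>\<^sub>F n in sequentially. 2 * M * norm \<phi> * (1/2) ^ n < e"
      using e by (intro order_tendstoD(2)[OF lim0])
    moreover have "\<forall>\<^sub>F n in sequentially. dist (\<phi> (T (h n))) (\<phi> y) < e"
      using tendstoD[OF blinfun.tendsto[OF tendsto_const y] e] .
    ultimately have "\<forall>\<^sub>F n in sequentially. 2 * M * norm \<phi> * (1/2) ^ n < e \<and> dist (\<phi> (T (h n))) (\<phi> y) < e"
      by (rule eventually_conj)
    then obtain n where n: "2 * M * norm \<phi> * (1/2) ^ n < e" "dist (\<phi> (T (h n))) (\<phi> y) < e"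
      by (auto simp: eventually_sequentially)
    have "?I n \<le> ennreal e" using I[of n] n(1) by (meson ennreal_leI less_imp_le order_trans)
    then show "\<exists>h' I'. h' \<in> sep_meas \<and> has_vm_integral (scalar_part m \<phi>) h' I' \<and> \<bar>I' - \<phi> y\<bar> \<le> e \<and>
        (\<integral>\<^sup>+t. ennreal (norm (f t - h' t)) \<partial>variation_measure (scalar_part m \<phi>)) \<le> ennreal e"
      using n(2) apply_bcontfun_sep_meas[OF K] represents_has_vm_integral[OF rep, of \<phi> "h n"]
      by (intro exI[of _ "apply_bcontfun (h n)"] exI[of _ "\<phi> (T (h n))"]) (auto simp: dist_real_def)
  qed
  then show ?thesis by blast
qed

text \<open>Used in both directions: \<open>h\<close> arises from \<open>f\<close> by extension of
  continuous functions, and \<open>f\<close> from \<open>h\<close> by inclusion. A property that is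
  read off from the scalar sequences of all functionals passes along.\<close>

definition functionally_dominated ::
    "(nat \<Rightarrow> 'a::real_normed_vector) \<Rightarrow> (nat \<Rightarrow> 'b::real_normed_vector) \<Rightarrow> bool" where
  "functionally_dominated h f \<longleftrightarrow>
    (\<forall>\<phi> :: 'a dual. \<exists>\<psi> :: 'b dual. \<forall>n. blinfun_apply \<phi> (h n) = blinfun_apply \<psi> (f n))"

lemma functionally_dominated_weakly_null:
  assumes "functionally_dominated h f" "weakly_null f" shows "weakly_null h"
  unfolding weakly_null_def
proof
  fix \<phi> :: "'a dual"
  obtain \<psi> :: "'b dual" where "\<And>n. blinfun_apply \<phi> (h n) = blinfun_apply \<psi> (f n)"
    using assms(1) unfolding functionally_dominated_def by blast
  then show "(\<lambda>n. \<phi> (h n)) \<longlonglongrightarrow> 0" using assms(2) by (simp add: weakly_null_def)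
qed

lemma functionally_dominated_weakly_p_summable:
  assumes "functionally_dominated h f" "weakly_p_summable p f" shows "weakly_p_summable p h"
  unfolding weakly_p_summable_def
proof
  fix \<phi> :: "'a dual"
  obtain \<psi> :: "'b dual" where "\<And>n. blinfun_apply \<phi> (h n) = blinfun_apply \<psi> (f n)"
    using assms(1) unfolding functionally_dominated_def by blast
  then show "summable (\<lambda>n. \<bar>blinfun_apply \<phi> (h n)\<bar> powr p)" using assms(2) by (simp add: weakly_p_summable_def)
qed

lemma functionally_dominated_blinfun:
  "functionally_dominated (\<lambda>n. blinfun_apply J (f n)) f"
  unfolding functionally_dominated_def
proof
  fix \<phi> :: "'a dual"
  show "\<exists>\<psi>. \<forall>n. blinfun_apply \<phi> (blinfun_apply J (f n)) = blinfun_apply \<psi> (f n)"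
    by (rule exI[of _ "\<phi> o\<^sub>L J"]) simp
qed

text \<open>\<open>E\<close> stands for any map with the right integrals: the lemma serves to prove
  that such a map is linear and bounded, and later for \<open>extension T\<close> itself. The common
  bound \<open>M\<close> makes the error uniform in \<open>n\<close>.\<close>

lemma approximation_by_continuous:
  fixes T :: "('k::t2_space \<Rightarrow>\<^sub>C 'x::banach) \<Rightarrow>\<^sub>L 'y::real_normed_vector"
  assumes K: "compact (UNIV :: 'k set)" and rep: "represents m T"
    and reg: "regular_submeasure (semivariation m)"
    and E: "\<And>u (\<phi> :: 'y dual). has_vm_integral (scalar_part m \<phi>) (apply_bsig u) (blinfun_apply \<phi> (E u))"
    and M: "\<And>n. norm (f n) \<le> M" and e: "0 < (e::real)"
  obtains h where "functionally_dominated h f" "\<And>n. norm (h n) \<le> norm (f n)" "\<And>n. norm (E (f n) - T (h n)) \<le> e"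
proof -
  have M0: "0 \<le> M" using M[of 0] norm_ge_zero order_trans by blast
  define \<delta> where "\<delta> = e / (2 * M + 1)"
  have \<delta>: "0 < \<delta>" using e M0 by (simp add: \<delta>_def)
  have "2 * M * \<delta> \<le> (2 * M + 1) * \<delta>" using \<delta> by (intro mult_right_mono) auto
  also have "\<dots> = e" using M0 by (simp add: \<delta>_def)
  finally have le: "2 * M * \<delta> \<le> e" .
  obtain C where C: "compact C" "semivariation m (- C) \<le> ennreal \<delta>" "\<And>n. continuous_on C (apply_bsig (f n))"
    by (rule lusin_sequence[where f = f, OF K reg \<delta>]) blast
  obtain h where h: "\<And>n. norm (h n) \<le> norm (f n)" "\<And>n t. t \<in> C \<Longrightarrow> apply_bcontfun (h n) t = apply_bsig (f n) t"
    and dom: "\<And>\<phi> :: ('k \<Rightarrow>\<^sub>C 'x) dual. \<exists>\<psi> :: ('k, 'x) bsig dual. \<forall>n. blinfun_apply \<phi> (h n) = blinfun_apply \<psi> (f n)"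
    by (rule linear_extension_from_compact[where f = f, OF K C(1,3)]) blast
  have "norm (E (f n) - T (h n)) \<le> 2 * M * \<delta>" for n
    using \<delta> order_trans[OF h(1) M]
    by (intro operator_close[OF K rep C(1) h(2) M _ E C(2)]) auto
  with le have "norm (E (f n) - T (h n)) \<le> e" for n by (meson order_trans)
  with h(1) dom show ?thesis using that unfolding functionally_dominated_def by blast
qed

text \<open>Linearity is transported from \<open>T\<close>. One approximation handles
  \<open>u\<close>, \<open>u'\<close> and their combination simultaneously, and the linear relation
  between them passes to the continuous approximants because functionals separate points.\<close>

lemma extension_operator_bounded_linear:
  fixes T :: "('k::t2_space \<Rightarrow>\<^sub>C 'x::banach) \<Rightarrow>\<^sub>L 'y::real_normed_vector"
  assumes K: "compact (UNIV :: 'k set)" and rep: "represents m T"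
    and reg: "regular_submeasure (semivariation m)"
    and E: "\<And>u (\<phi> :: 'y dual). has_vm_integral (scalar_part m \<phi>) (apply_bsig u) (blinfun_apply \<phi> (E u))"
  shows "bounded_linear E"
proof -
  have lin: "E (r *\<^sub>R u + u') = r *\<^sub>R E u + E u'" for r u u'
  proof -
    define f where "f n = (if n = 0 then u else if n = 1 then u' else r *\<^sub>R u + u')" for n :: nat
    have f: "f 0 = u" "f 1 = u'" "f 2 = r *\<^sub>R u + u'" by (auto simp: f_def)
    have M: "norm (f n) \<le> max (norm u) (max (norm u') (norm (r *\<^sub>R u + u')))" for n
      by (auto simp: f_def)
    have "norm (E (r *\<^sub>R u + u') - (r *\<^sub>R E u + E u')) \<le> 0 + e" if e: "0 < e" for e
    proof -
      \<comment> \<open>The three approximation errors enter with the coefficients 1,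
        \<open>\<bar>r\<bar>\<close> and 1.\<close>
      define \<delta> where "\<delta> = e / (\<bar>r\<bar> + 2)"
      have \<delta>: "0 < \<delta>" using e by (simp add: \<delta>_def)
      obtain h where dom: "functionally_dominated h f" and h: "\<And>n. norm (E (f n) - T (h n)) \<le> \<delta>"
        by (rule approximation_by_continuous[where f = f and E = E, OF K rep reg E M \<delta>]) blast
      have "h 2 = r *\<^sub>R h 0 + h 1"
      proof (rule eq_by_functionals)
        fix \<phi> :: "('k \<Rightarrow>\<^sub>C 'x) dual"
        obtain \<psi> :: "('k, 'x) bsig dual" where psi: "\<And>n. blinfun_apply \<phi> (h n) = blinfun_apply \<psi> (f n)"
          using dom unfolding functionally_dominated_def by blast
        have "blinfun_apply \<phi> (h 2) = blinfun_apply \<psi> (f 2)" by (rule psi)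
        also have "\<dots> = r * blinfun_apply \<psi> (f 0) + blinfun_apply \<psi> (f 1)"
          unfolding f by (simp add: blinfun.add_right blinfun.scaleR_right)
        also have "\<dots> = blinfun_apply \<phi> (r *\<^sub>R h 0 + h 1)"
          by (simp add: blinfun.add_right blinfun.scaleR_right psi)
        finally show "blinfun_apply \<phi> (h 2) = blinfun_apply \<phi> (r *\<^sub>R h 0 + h 1)" .
      qed
      then have "E (f 2) - (r *\<^sub>R E (f 0) + E (f 1)) =
          (E (f 2) - T (h 2)) - r *\<^sub>R (E (f 0) - T (h 0)) - (E (f 1) - T (h 1))"
        by (simp add: blinfun.add_right blinfun.scaleR_right algebra_simps)
      also have "norm \<dots> \<le> norm (E (f 2) - T (h 2)) + \<bar>r\<bar> * norm (E (f 0) - T (h 0)) + norm (E (f 1) - T (h 1))"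
        by (intro order_trans[OF norm_triangle_ineq4] add_mono order_refl) simp
      also have "\<dots> \<le> \<delta> + \<bar>r\<bar> * \<delta> + \<delta>" by (intro add_mono mult_left_mono h) auto
      also have "\<dots> = (\<bar>r\<bar> + 2) * \<delta>" by (simp add: algebra_simps)
      also have "\<dots> = e" by (simp add: \<delta>_def)
      finally show ?thesis unfolding f by simp
    qed
    then have "norm (E (r *\<^sub>R u + u') - (r *\<^sub>R E u + E u')) \<le> 0" by (rule field_le_epsilon)
    then show ?thesis by simp
  qed
  have E0: "E 0 = 0" using lin[of 1 0 0] by simp
  have bound: "norm (E u) \<le> norm u * norm T" for u
  proof (rule field_le_epsilon)
    fix e :: real assume e: "0 < e"
    obtain h where h: "\<And>n::nat. norm (h n) \<le> norm u" "\<And>n. norm (E u - T (h n)) \<le> e"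
      by (rule approximation_by_continuous[where f = "\<lambda>_. u" and E = E, OF K rep reg E order_refl e]) blast
    have "norm (T (h 0)) \<le> norm T * norm u"
      using norm_blinfun[of T "h 0"] mult_left_mono[OF h(1)[of 0] norm_ge_zero[of T]] by linarith
    then show "norm (E u) \<le> norm u * norm T + e"
      using h(2)[of 0] norm_triangle_sub[of "E u" "T (h 0)"] by (simp add: mult.commute)
  qed
  show ?thesis
  proof (rule bounded_linear_intro)
    show "E (u + u') = E u + E u'" for u u' using lin[of 1 u u'] by simp
    show "E (r *\<^sub>R u) = r *\<^sub>R E u" for r u using lin[of r u 0] by (simp add: E0)
  qed (rule bound)
qed

text \<open>This justifies the definition of \<open>extension\<close>: its \<open>THE\<close> by
  existence of the value and separation of points by functionals, its \<open>Blinfun\<close> by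
  bounded linearity.\<close>

lemma extension_has_vm_integral:
  fixes T :: "('k::t2_space \<Rightarrow>\<^sub>C 'x::banach) \<Rightarrow>\<^sub>L 'y::banach"
  assumes K: "compact (UNIV :: 'k set)" and rep: "represents m T"
    and reg: "regular_submeasure (semivariation m)"
  shows "has_vm_integral (scalar_part m \<phi>) (apply_bsig u) (blinfun_apply \<phi> (blinfun_apply (extension T) u))"
proof -
  obtain E where E: "\<And>u (\<phi> :: 'y dual). has_vm_integral (scalar_part m \<phi>) (apply_bsig u) (blinfun_apply \<phi> (E u))"
    using extension_value_exists[OF K rep reg] by metis
  have "(THE y. \<forall>\<phi> :: 'y dual. blinfun_apply \<phi> y = vm_integral (scalar_part (rep_measure T) \<phi>) (apply_bsig u)) = E u" for u
  proof (rule the_equality)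
    have vm: "vm_integral (scalar_part (rep_measure T) \<phi>) (apply_bsig u) = blinfun_apply \<phi> (E u)" for \<phi> :: "'y dual"
      unfolding rep_measure_eq[OF K rep]
      by (rule vm_integral_eq[OF represents_vector_measure[OF rep] apply_bsig E])
    then show "\<forall>\<phi> :: 'y dual. blinfun_apply \<phi> (E u) = vm_integral (scalar_part (rep_measure T) \<phi>) (apply_bsig u)"
      by simp
    fix y assume "\<forall>\<phi> :: 'y dual. blinfun_apply \<phi> y = vm_integral (scalar_part (rep_measure T) \<phi>) (apply_bsig u)"
    then show "y = E u" using eq_by_functionals[of y "E u"] by (simp add: vm)
  qed
  then have "extension T = Blinfun E" by (simp add: extension_def)
  then show ?thesis
    using E extension_operator_bounded_linear[OF K rep reg E] by (simp add: bounded_linear_Blinfun_apply)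
qed

section \<open>Transfer between an operator and its extension\<close>

lemma bcontfun_into_bsig:
  assumes K: "compact (UNIV :: 'k set)"
  obtains J :: "('k::topological_space \<Rightarrow>\<^sub>C 'x::real_normed_vector) \<Rightarrow>\<^sub>L ('k, 'x) bsig"
  where "\<And>h. apply_bsig (blinfun_apply J h) = apply_bcontfun h"
proof -
  define J :: "('k \<Rightarrow>\<^sub>C 'x) \<Rightarrow> ('k, 'x) bsig" where "J h = Bsig (apply_bcontfun h)" for h
  have J: "apply_bsig (J h) = apply_bcontfun h" for h
    unfolding J_def by (rule Bsig_inverse[OF apply_bcontfun_sep_meas[OF K]])
  have "bounded_linear J"
  proof (rule bounded_linear_intro[where K = 1])
    show "J (g + h) = J g + J h" for g h
      by (simp add: apply_bsig_inject[symmetric] J plus_bsig.rep_eq plus_bcontfun.rep_eq fun_eq_iff)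
    show "J (r *\<^sub>R h) = r *\<^sub>R J h" for r h
      by (simp add: apply_bsig_inject[symmetric] J scaleR_bsig.rep_eq scaleR_bcontfun.rep_eq fun_eq_iff)
    show "norm (J h) \<le> norm h * 1" for h
      by (rule norm_bsig_le) (simp add: J norm_apply_bcontfun_le)
  qed
  then show ?thesis using that[of "Blinfun J"] by (simp add: J bounded_linear_Blinfun_apply)
qed

text \<open>Common form of the four equivalences. \<open>P\<close> and \<open>P'\<close> are the
  same convergence property in \<open>B(\<Sigma>,X)\<close> and in \<open>C(K,X)\<close>, kept apart
  because the types differ, and \<open>Q\<close> is one of the two kinds of nullity of functionals.
  The assumptions on weak and weak-star nullity supply the norm bounds through which a norm
  approximation controls the pairings.\<close>

lemma pairing_null_iff_extension:
  fixes T :: "('k::t2_space \<Rightarrow>\<^sub>C 'x::banach) \<Rightarrow>\<^sub>L 'y::banach"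
  assumes K: "compact (UNIV :: 'k set)" and sb: "strongly_bounded T"
    and bounded: "\<And>f. P f \<Longrightarrow> weakly_null f"
    and down: "\<And>h f. functionally_dominated h f \<Longrightarrow> P f \<Longrightarrow> P' h"
    and up: "\<And>h f. functionally_dominated f h \<Longrightarrow> P' h \<Longrightarrow> P f"
    and Q: "\<And>\<phi>. Q \<phi> \<Longrightarrow> weak_star_null \<phi>"
  shows "(\<forall>h \<phi>. P' h \<longrightarrow> Q \<phi> \<longrightarrow> (\<lambda>n. blinfun_apply (\<phi> n) (T (h n))) \<longlonglongrightarrow> 0) \<longleftrightarrow>
    (\<forall>f \<phi>. P f \<longrightarrow> Q \<phi> \<longrightarrow> (\<lambda>n. blinfun_apply (\<phi> n) (extension T (f n))) \<longlonglongrightarrow> 0)"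
proof -
  obtain m where rep: "represents m T" and cont: "\<And>A :: nat \<Rightarrow> 'k set. range A \<subseteq> sets borel \<Longrightarrow> decseq A \<Longrightarrow>
      (\<Inter>i. A i) = {} \<Longrightarrow> (\<lambda>i. semivariation m (A i)) \<longlonglongrightarrow> 0"
    using sb unfolding strongly_bounded_def by blast
  have reg: "regular_submeasure (semivariation m)"
    by (rule regular_submeasure_semivariation[OF rep cont])
  note E = extension_has_vm_integral[OF K rep reg]
  show ?thesis
  proof (intro iffI allI impI)
    fix h :: "nat \<Rightarrow> 'k \<Rightarrow>\<^sub>C 'x" and \<phi> :: "nat \<Rightarrow> 'y dual"
    assume ext: "\<forall>f \<phi>. P f \<longrightarrow> Q \<phi> \<longrightarrow> (\<lambda>n. blinfun_apply (\<phi> n) (extension T (f n))) \<longlonglongrightarrow> 0"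
      and h: "P' h" and q: "Q \<phi>"
    obtain J :: "('k \<Rightarrow>\<^sub>C 'x) \<Rightarrow>\<^sub>L ('k, 'x) bsig" where J: "\<And>h. apply_bsig (blinfun_apply J h) = apply_bcontfun h"
      by (rule bcontfun_into_bsig[OF K]) blast
    have "P (\<lambda>n. J (h n))" by (rule up[OF functionally_dominated_blinfun h])
    then have "(\<lambda>n. blinfun_apply (\<phi> n) (extension T (J (h n)))) \<longlonglongrightarrow> 0" using ext q by blast
    \<comment> \<open>Under each functional, both sides become the integral of \<open>g\<close>
      against the same measure.\<close>
    moreover have "extension T (J g) = T g" for g
    proof (rule eq_by_functionals)
      fix \<phi> :: "'y dual"
      show "blinfun_apply \<phi> (extension T (J g)) = blinfun_apply \<phi> (T g)"
        using E[of \<phi> "J g"] represents_has_vm_integral[OF rep, of \<phi> g]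
        by (intro has_vm_integral_unique[OF represents_vector_measure[OF rep] apply_bsig[of "J g"]]) (auto simp: J)
    qed
    ultimately show "(\<lambda>n. blinfun_apply (\<phi> n) (T (h n))) \<longlonglongrightarrow> 0" by simp
  next
    fix f :: "nat \<Rightarrow> ('k, 'x) bsig" and \<phi> :: "nat \<Rightarrow> 'y dual"
    assume T: "\<forall>h \<phi>. P' h \<longrightarrow> Q \<phi> \<longrightarrow> (\<lambda>n. blinfun_apply (\<phi> n) (T (h n))) \<longlonglongrightarrow> 0"
      and f: "P f" and q: "Q \<phi>"
    obtain M where M: "\<And>n. norm (f n) \<le> M"
      by (rule weakly_null_bounded[OF bounded[OF f]]) blast
    obtain c where c: "0 < c" "\<And>n. norm (\<phi> n) \<le> c"
      by (rule weak_star_null_bounded[OF Q[OF q]]) blast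
    show "(\<lambda>n. blinfun_apply (\<phi> n) (extension T (f n))) \<longlonglongrightarrow> 0"
    proof (rule LIMSEQ_I)
      fix e :: real assume e: "0 < e"
      \<comment> \<open>After pairing with functionals of norm at most \<open>c\<close>, this error
        contributes at most \<open>e / 2\<close>.\<close>
      then have e': "0 < e / (2 * c)" using c by simp
      obtain h where h: "functionally_dominated h f" "\<And>n. norm (extension T (f n) - T (h n)) \<le> e / (2 * c)"
        by (rule approximation_by_continuous[where f = f and E = "blinfun_apply (extension T)", OF K rep reg E M e']) blast
      have "(\<lambda>n. blinfun_apply (\<phi> n) (T (h n))) \<longlonglongrightarrow> 0" using T down[OF h(1) f] q by blast
      from LIMSEQ_D[OF this, of "e / 2"]
      obtain N where N: "\<And>n. n \<ge> N \<Longrightarrow> norm (blinfun_apply (\<phi> n) (T (h n)) - 0) < e / 2"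
        using e by auto
      have "norm (blinfun_apply (\<phi> n) (extension T (f n)) - 0) < e" if "n \<ge> N" for n
      proof -
        have "norm (blinfun_apply (\<phi> n) (extension T (f n) - T (h n))) \<le> c * (e / (2 * c))"
          using c by (intro order_trans[OF norm_blinfun mult_mono[OF c(2) h(2)]]) auto
        also have "\<dots> = e / 2" using c by simp
        finally have "\<bar>blinfun_apply (\<phi> n) (extension T (f n)) - blinfun_apply (\<phi> n) (T (h n))\<bar> \<le> e / 2"
          by (simp add: blinfun.diff_right)
        moreover have "\<bar>blinfun_apply (\<phi> n) (T (h n))\<bar> < e / 2" using N[OF that] by simp
        ultimately show ?thesis unfolding real_norm_def diff_zero by linarith
      qed
      then show "\<exists>N. \<forall>n\<ge>N. norm (blinfun_apply (\<phi> n) (extension T (f n)) - 0) < e" by blast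
    qed
  qed
qed

theorem theorem3:
  fixes T :: "('k::t2_space \<Rightarrow>\<^sub>C 'x::banach) \<Rightarrow>\<^sub>L 'y::banach"
    and p :: real
  assumes "1 \<le> p"
    and "compact (UNIV :: 'k set)"
    and "strongly_bounded T"
  shows "(weak_DP T \<longleftrightarrow> weak_DP (extension T))
    \<and> (weak_star_DP T \<longleftrightarrow> weak_star_DP (extension T))
    \<and> (weak_p_convergent p T \<longleftrightarrow> weak_p_convergent p (extension T))
    \<and> (weak_star_p_convergent p T \<longleftrightarrow> weak_star_p_convergent p (extension T))"
proof -
  have p: "0 < p" using assms(1) by simp
  note iff = pairing_null_iff_extension[OF assms(2,3)]
  note null = functionally_dominated_weakly_null
  note summable = functionally_dominated_weakly_p_summable
  note bdd = weakly_p_summable_imp_weakly_null[OF p]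
  note ws = weakly_null_imp_weak_star_null
  show ?thesis
    \<comment> \<open>Matching each conjunct against \<open>iff\<close> determines \<open>P\<close>,
      \<open>P'\<close> and \<open>Q\<close>; what remains are the transfers in both directions and
      the nullity conditions.\<close>
    unfolding weak_DP_def weak_star_DP_def weak_p_convergent_def weak_star_p_convergent_def
    by (intro conjI iff) (assumption | erule (1) null summable | erule bdd ws)+
qed

end
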